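(* Let $d\ge2$, $\kappa>0$, and $\eta,\theta\in\{1,\ldots,2d\}$ with $|\eta-\theta|\notin\{0,d\}$. If $\mu$ is a Dirac mass at a vector $\xi\in\Sigma_{\mathcal{N}}^{\kappa,\eta,\theta}$ with all positive entries, then the function $\overset{\star}{v}:\mathcal{M}_1(\Sigma_{\mathcal{N}}^{\kappa,\eta,\theta})\to\mathcal{M}_1(B_1^1(0))$ is continuous at $\mu$.
   Context: Let $\mathcal{N}=\{e_1,\ldots,e_{2d}\}$ be the set of nearest neighbors of the origin in $\mathbb{Z}^d$, where $e_1,\dots,e_d$ are the standard basis vectors and $e_{i+d}=-e_i$ for $1\le i\le d$. Define $$\Sigma_{\mathcal{N}}^{\kappa,\eta,\theta}=\left\{\xi:\mathcal{N}\to[0,1]\ :\ \sum_{i=1}^{2d}\xi(e_i)=1,\ \xi(e_\theta)\ge\kappa,\ \xi(e_\eta)\geq\kappa\right\},$$ a compact subset of a Euclidean space with the subspace topology, and let $\mathcal{M}_1(\Sigma_{\mathcal{N}}^{\kappa,\eta,\theta})$ be the set of Borel probability measures on it, with the topology of weak convergence. Let $B_1^1(0)$ be the $L^1$ unit ball centered at the origin in $\mathbb{R}^d$ and $\mathcal{M}_1(B_1^1(0))$ the space of probability measures on $B_1^1(0)$ with the topology of weak convergence. For $\mu\in\mathcal{M}_1(\Sigma_{\mathcal{N}}^{\kappa,\eta,\theta})$, consider the random walk in random environment in which the transition probability vectors $\omega^x$, $x\in\mathbb{Z}^d$, are i.i.d. with law $\mu$, and, given $\omega=(\omega^x)_x$,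 $(X_n)_{n\ge0}$ is the Markov chain on $\mathbb{Z}^d$ with $X_0=0$ that from site $z$ steps to $z+e_i$ with probability $\omega^z(e_i)$. The limiting velocity is $\lim_{n\to\infty}X_n/n\in B_1^1(0)$; it is known (and taken as given) that it exists almost surely (under the joint law of environment and walk) and takes at most two values. The function $\overset{\star}{v}$ is defined by: $\overset{\star}{v}(\mu)=\delta_{\vec v}$ if, when sites are drawn i.i.d. according to $\mu$, the limiting velocity is almost surely $\vec{v}$; and $\overset{\star}{v}(\mu)=\frac12\delta_{\vec{v}}+\frac12\delta_{\vec{w}}$ if the limiting velocity is almost surely either $\vec{v}$ or $\vec{w}$ ($\vec v\ne\vec w$), each with positive probability. Here $\delta_{\vec v}$ denotes the Dirac mass at $\vec v$. *)

theory Defs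
  imports "HOL-Probability.Probability"
begin

(* The type 'd is the index set of the coordinates of Z^d and R^d, so d = CARD('d).
   'd + 'd indexes the 2d nearest neighbours of the origin: Inl j stands for the standard
   basis vector of coordinate j, Inr j for its negative. *)

definition nbr :: "'d::finite + 'd \<Rightarrow> int ^ 'd" where
  "nbr s = (case s of Inl j \<Rightarrow> axis j 1 | Inr j \<Rightarrow> - axis j 1)"

(* For i in {1..2d}, nbr (dir i) is the neighbour e_i: dir enumerates the basis vectors as
   1..d, and dir (i + d) is opposite to dir i.  Other values of i are irrelevant. *)

definition dir :: "nat \<Rightarrow> 'd::finite + 'd" where
  "dir i = (if i \<le> CARD('d) then Inl (from_nat_into UNIV (i - 1))
            else Inr (from_nat_into UNIV (i - CARD('d) - 1)))"

definition Sigma_N :: "real \<Rightarrow> nat \<Rightarrow> nat \<Rightarrow> (real ^ ('d::finite + 'd)) set" where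
  "Sigma_N \<kappa> \<eta> \<theta> = {\<xi>. (\<forall>s. 0 \<le> \<xi> $ s \<and> \<xi> $ s \<le> 1) \<and> (\<Sum>s\<in>UNIV. \<xi> $ s) = 1 \<and>
                      \<kappa> \<le> \<xi> $ dir \<theta> \<and> \<kappa> \<le> \<xi> $ dir \<eta>}"

definition l1_ball :: "(real ^ 'd::finite) set" where
  "l1_ball = {x. (\<Sum>j\<in>UNIV. \<bar>x $ j\<bar>) \<le> 1}"

abbreviation borel_on :: "'a::topological_space set \<Rightarrow> 'a measure" where
  "borel_on S \<equiv> restrict_space borel S"

definition prob_measures :: "'a::topological_space set \<Rightarrow> 'a measure set" where
  "prob_measures S = {\<mu>. prob_space \<mu> \<and> sets \<mu> = sets (borel_on S)}"

(* The coarsest topology on prob_measures S that makes the integral of every bounded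
   continuous real function on S continuous (U = UNIV yields prob_measures S itself). *)

definition weak_topology :: "'a::topological_space set \<Rightarrow> 'a measure topology" where
  "weak_topology S = topology_generated_by
     {{\<mu> \<in> prob_measures S. (\<integral>x. f x \<partial>\<mu>) \<in> U} | (f :: 'a \<Rightarrow> real) U.
        continuous_on S f \<and> bounded (f ` S) \<and> open U}"

abbreviation dirac_on :: "'a::topological_space set \<Rightarrow> 'a \<Rightarrow> 'a measure" where
  "dirac_on S x \<equiv> return (borel_on S) x"

definition half_half :: "'a::topological_space set \<Rightarrow> 'a \<Rightarrow> 'a \<Rightarrow> 'a measure" where
  "half_half S v w = measure_of S (sets (borel_on S))
     (\<lambda>A. 1 / 2 * emeasure (dirac_on S v) A + 1 / 2 * emeasure (dirac_on S w) A)"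

type_synonym 'd environment = "int ^ 'd \<Rightarrow> real ^ ('d + 'd)"

definition jump_law :: "'d::finite environment \<Rightarrow> int ^ 'd \<Rightarrow> (int ^ 'd) measure" where
  "jump_law \<omega> z = distr (point_measure UNIV (\<lambda>s. ennreal (\<omega> z $ s))) (count_space UNIV)
                    (\<lambda>s. z + nbr s)"

definition walk_kernel ::
    "'d::finite environment \<Rightarrow> nat \<Rightarrow> (nat \<Rightarrow> int ^ 'd) \<Rightarrow> (int ^ 'd) measure" where
  "walk_kernel \<omega> n X = (if n = 0 then return (count_space UNIV) 0 else jump_law \<omega> (X (n - 1)))"

(* The law of the chain in the environment \<omega>, obtained from walk_kernel by the
   Ionescu-Tulcea theorem; quenched_law_cylinder below gives its marginals. *)

definition quenched_law :: "'d::finite environment \<Rightarrow> (nat \<Rightarrow> int ^ 'd) measure" where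
  "quenched_law \<omega> = projective_family.lim UNIV
     (Ionescu_Tulcea.CI (walk_kernel \<omega>) (\<lambda>_. count_space UNIV)) (\<lambda>_. count_space UNIV)"

definition env_law :: "(real ^ ('d::finite + 'd)) measure \<Rightarrow> 'd environment measure" where
  "env_law \<mu> = (\<Pi>\<^sub>M z\<in>UNIV. \<mu>)"

definition joint_law :: "(real ^ ('d::finite + 'd)) measure \<Rightarrow>
    ('d environment \<times> (nat \<Rightarrow> int ^ 'd)) measure" where
  "joint_law \<mu> = env_law \<mu> \<bind>
     (\<lambda>\<omega>. distr (quenched_law \<omega>) (env_law \<mu> \<Otimes>\<^sub>M (\<Pi>\<^sub>M n\<in>UNIV. count_space UNIV)) (\<lambda>X. (\<omega>, X)))"

definition has_velocity :: "(nat \<Rightarrow> int ^ 'd::finite) \<Rightarrow> real ^ 'd \<Rightarrow> bool" where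
  "has_velocity X v \<longleftrightarrow> (\<lambda>n. (1 / real n) *\<^sub>R (\<chi> j. real_of_int (X n $ j))) \<longlonglongrightarrow> v"

definition is_velocity_law ::
    "(real ^ ('d::finite + 'd)) measure \<Rightarrow> (real ^ 'd) measure \<Rightarrow> bool" where
  "is_velocity_law \<mu> \<rho> \<longleftrightarrow>
     (\<exists>v. (AE (\<omega>, X) in joint_law \<mu>. has_velocity X v) \<and> \<rho> = dirac_on l1_ball v) \<or>
     (\<exists>v w. v \<noteq> w \<and> (AE (\<omega>, X) in joint_law \<mu>. has_velocity X v \<or> has_velocity X w) \<and>
        \<P>(p in joint_law \<mu>. has_velocity (snd p) v) > 0 \<and>
        \<P>(p in joint_law \<mu>. has_velocity (snd p) w) > 0 \<and>
        \<rho> = half_half l1_ball v w)"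

(* If the velocity exists almost surely and takes at most two values, then exactly one
   measure \<rho> satisfies is_velocity_law \<mu> \<rho>. *)

definition v_star :: "(real ^ ('d::finite + 'd)) measure \<Rightarrow> (real ^ 'd) measure" where
  "v_star \<mu> = (THE \<rho>. is_velocity_law \<mu> \<rho>)"

(* joint_law is a bind, hence meaningful only if its kernel is measurable.  The lemmas below
   verify this (prob_space_joint_law) and that the chain has the intended law. *)

lemma bij_betw_dir: "bij_betw (dir :: nat \<Rightarrow> 'd::finite + 'd) {1..2 * CARD('d)} UNIV"
proof -
  define F :: "nat \<Rightarrow> 'd" where "F = from_nat_into UNIV"
  have F: "bij_betw F {..<CARD('d)} UNIV"
    unfolding F_def by (intro bij_betw_from_nat_into_finite) simp
  have inj: "a = b" if "F a = F b" "a < CARD('d)" "b < CARD('d)" for a b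
    using F that by (auto simp: bij_betw_def inj_on_def)
  have dir: "dir i = (if i \<le> CARD('d) then Inl (F (i - 1)) else Inr (F (i - CARD('d) - 1)))" for i
    by (simp add: dir_def F_def)
  show ?thesis
  proof (rule bij_betwI')
    fix x y assume xy: "x \<in> {1..2 * CARD('d)}" "y \<in> {1..2 * CARD('d)}"
    have rep: "\<exists>k<CARD('d). i = Suc k \<or> i = Suc (k + CARD('d))" if "i \<in> {1..2 * CARD('d)}" for i
      using that by (intro exI[of _ "if i \<le> CARD('d) then i - 1 else i - CARD('d) - 1"]) auto
    obtain k where k: "k < CARD('d)" "x = Suc k \<or> x = Suc (k + CARD('d))" using rep[OF xy(1)] by blast
    obtain l where l: "l < CARD('d)" "y = Suc l \<or> y = Suc (l + CARD('d))" using rep[OF xy(2)] by blast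
    show "(dir x = (dir y :: 'd + 'd)) = (x = y)"
      using k l inj[of k l] by (auto simp: dir split: if_splits)
  next
    fix s :: "'d + 'd"
    have "\<exists>k<CARD('d). F k = j" for j
      using F by (auto simp: bij_betw_def) (metis imageE lessThan_iff UNIV_I)
    then obtain k where k: "k < CARD('d)" "F k = (case s of Inl j \<Rightarrow> j | Inr j \<Rightarrow> j)" by blast
    show "\<exists>x\<in>{1..2 * CARD('d)}. s = dir x"
    proof (cases s)
      case (Inl j)
      then show ?thesis using k by (intro bexI[of _ "Suc k"]) (auto simp: dir)
    next
      case (Inr j)
      then show ?thesis using k by (intro bexI[of _ "Suc (k + CARD('d))"]) (auto simp: dir)
    qed
  qed simp
qed

definition prob_vectors :: "'d::finite environment \<Rightarrow> bool" where
  "prob_vectors \<omega> \<longleftrightarrow> (\<forall>z. (\<forall>s. 0 \<le> \<omega> z $ s) \<and> (\<Sum>s\<in>UNIV. \<omega> z $ s) = 1)"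

lemma sets_jump_law [simp]: "sets (jump_law \<omega> z) = UNIV"
  and space_jump_law [simp]: "space (jump_law \<omega> z) = UNIV"
  by (auto simp: jump_law_def)

lemma emeasure_jump_law:
  "emeasure (jump_law \<omega> z) A = (\<Sum>s | z + nbr s \<in> A. ennreal (\<omega> z $ s))"
  unfolding jump_law_def
  by (subst emeasure_distr) (auto simp: emeasure_point_measure_finite space_point_measure
      sets_point_measure measurable_def vimage_def)

lemma prob_space_jump_law: "prob_vectors \<omega> \<Longrightarrow> prob_space (jump_law \<omega> z)"
  by (rule prob_spaceI) (simp add: emeasure_jump_law prob_vectors_def)

lemma Ionescu_Tulcea_walk_kernel:
  fixes \<omega> :: "'d::finite environment"
  assumes "prob_vectors \<omega>"
  shows "Ionescu_Tulcea (walk_kernel \<omega>) (\<lambda>_. count_space UNIV)"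
proof (rule Ionescu_Tulcea.intro)
  fix i
  have J: "jump_law \<omega> \<in> count_space UNIV \<rightarrow>\<^sub>M subprob_algebra (count_space UNIV)"
    using prob_space_jump_law[OF assms]
    by (auto simp: space_subprob_algebra intro!: prob_space_imp_subprob_space)
  show "walk_kernel \<omega> i \<in> PiM {0..<i} (\<lambda>_. count_space UNIV) \<rightarrow>\<^sub>M subprob_algebra (count_space UNIV)"
  proof (cases "i = 0")
    case True
    then show ?thesis
      by (auto simp: walk_kernel_def[abs_def] space_subprob_algebra
          intro!: prob_space_imp_subprob_space prob_space_return)
  next
    case False
    then show ?thesis
      unfolding walk_kernel_def[abs_def]
      using False by (simp, intro measurable_compose[where f = "\<lambda>X. X (i - Suc 0)", OF _ J] measurable_component_singleton) simp
  qed
next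
  fix i and x :: "nat \<Rightarrow> int ^ 'd"
  show "prob_space (walk_kernel \<omega> i x)"
    by (auto simp: walk_kernel_def prob_space_return prob_space_jump_law[OF assms])
qed

lemma sets_quenched_law: "prob_vectors \<omega> \<Longrightarrow>
    sets (quenched_law \<omega>) = sets (\<Pi>\<^sub>M n\<in>UNIV. count_space UNIV)"
proof -
  assume "prob_vectors \<omega>"
  then interpret Ionescu_Tulcea "walk_kernel \<omega>" "\<lambda>_. count_space UNIV"
    by (rule Ionescu_Tulcea_walk_kernel)
  show ?thesis unfolding quenched_law_def by simp
qed

lemma quenched_law_cylinder:
  fixes \<omega> :: "'d::finite environment"
  assumes "prob_vectors \<omega>"
  shows "emeasure (quenched_law \<omega>) {X. \<forall>k\<le>n. X k = x k} =
    (if x 0 = 0 then \<Prod>k<n. \<Sum>s | x k + nbr s = x (Suc k). ennreal (\<omega> (x k) $ s) else 0)"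
proof -
  let ?M = "\<lambda>_::nat. count_space (UNIV :: (int ^ 'd) set)"
  let ?p = "\<lambda>m. (if x 0 = 0 then \<Prod>k<m. \<Sum>s | x k + nbr s = x (Suc k). ennreal (\<omega> (x k) $ s) else 0)"
  interpret Ionescu_Tulcea "walk_kernel \<omega>" ?M
    using assms by (rule Ionescu_Tulcea_walk_kernel)
  define R where "R m = restrict x {0..<m}" for m
  have sing [measurable]: "{R m} \<in> sets (PiM {0..<m} ?M)" for m
  proof -
    have "{R m} = (\<Pi>\<^sub>E k\<in>{0..<m}. {x k})"
      by (auto simp: R_def PiE_iff extensional_def fun_eq_iff)
    then show ?thesis by (simp add: sets_PiM_I_finite)
  qed
  have R_space [simp]: "R m \<in> space (PiM {0..<m} ?M)" for m
    by (simp add: R_def space_PiM)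
  have step: "emeasure (C 0 (Suc m) (\<lambda>x. undefined)) {R (Suc m)} =
      emeasure (C 0 m (\<lambda>x. undefined)) {R m} * emeasure (walk_kernel \<omega> m (R m)) {x m}" for m
  proof -
    have *: "emeasure (eP m X) {R (Suc m)} = emeasure (walk_kernel \<omega> m (R m)) {x m} * indicator {R m} X"
      if "X \<in> space (PiM {0..<m} ?M)" for X
    proof -
      have "(\<lambda>y. X(m := y)) -` {R (Suc m)} = (if X = R m then {x m} else {})"
      proof -
        have X: "X k = undefined" if "k \<ge> m" for k
          using that \<open>X \<in> _\<close> by (auto simp: space_PiM PiE_iff extensional_def)
        have "X(m := y) = R (Suc m) \<longleftrightarrow> X = R m \<and> y = x m" for y
        proof (intro iffI conjI)
          assume eq: "X(m := y) = R (Suc m)"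
          show "X = R m"
          proof
            fix k
            show "X k = R m k"
              using fun_cong[OF eq, of k] X[of k] by (auto simp: R_def split: if_splits)
          qed
          show "y = x m"
            using fun_cong[OF eq, of m] by (simp add: R_def)
        qed (auto simp: R_def fun_eq_iff)
        then show ?thesis by auto
      qed
      then show ?thesis
        using emeasure_eP[OF that sing[of "Suc m"]] by (auto split: if_splits)
    qed
    have "emeasure (C 0 (Suc m) (\<lambda>x. undefined)) {R (Suc m)} =
        (\<integral>\<^sup>+X. emeasure (eP m X) {R (Suc m)} \<partial>C 0 m (\<lambda>x. undefined))"
      using measurable_eP[of m] sing[of "Suc m"]
      by (simp, subst emeasure_bind[where N = "PiM {0..<Suc m} ?M"])
         (auto simp: space_C space_PiM cong: measurable_cong_sets sets_C)
    also have "\<dots> = (\<integral>\<^sup>+X. emeasure (walk_kernel \<omega> m (R m)) {x m} * indicator {R m} X \<partial>C 0 m (\<lambda>x. undefined))"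
      by (intro nn_integral_cong *) (simp add: space_C)
    also have "\<dots> = emeasure (walk_kernel \<omega> m (R m)) {x m} * emeasure (C 0 m (\<lambda>x. undefined)) {R m}"
      using sing[of m] by (intro nn_integral_cmult_indicator) (simp add: sets_C)
    finally show ?thesis by (simp add: mult.commute)
  qed
  have "emeasure (C 0 (Suc m) (\<lambda>x. undefined)) {R (Suc m)} = ?p m" for m
  proof (induction m)
    case 0
    have "emeasure (C 0 0 (\<lambda>x. undefined)) {R 0} = 1"
      using sing[of 0] by (simp add: R_def restrict_def)
    then show ?case
      by (simp only: step) (auto simp: walk_kernel_def)
  next
    case (Suc m)
    have "emeasure (walk_kernel \<omega> (Suc m) (R (Suc m))) {x (Suc m)} =
        (\<Sum>s | x m + nbr s = x (Suc m). ennreal (\<omega> (x m) $ s))"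
      by (simp add: walk_kernel_def emeasure_jump_law R_def)
    then show ?case
      by (simp only: step[of "Suc m"] Suc) simp
  qed
  moreover have "{X. \<forall>k\<le>n. X k = x k} = prod_emb UNIV ?M {0..<Suc n} {R (Suc n)}"
    by (auto simp: prod_emb_def R_def fun_eq_iff restrict_def less_Suc_eq_le) meson
  moreover have "emeasure PF.lim (prod_emb UNIV ?M {0..<Suc n} {R (Suc n)}) = emeasure (CI {0..<Suc n}) {R (Suc n)}"
    by (intro lim sing) simp
  moreover have "\<dots> = emeasure (C 0 (Suc n) (\<lambda>x. undefined)) {R (Suc n)}"
    using emeasure_CI[of "{0..<Suc n}" "Suc n" "{R (Suc n)}"] sing[of "Suc n"]
      prod_emb_id[of "{R (Suc n)}" "{0..<Suc n}" ?M] R_space[of "Suc n"]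
    by (simp add: space_PiM del: C.simps)
  ultimately show ?thesis
    unfolding quenched_law_def by simp
qed

lemma sets_paths_eq_cylinders:
  "sets (\<Pi>\<^sub>M n\<in>UNIV. count_space (UNIV :: (int ^ 'd::finite) set)) =
     sigma_sets UNIV (insert {} (range (\<lambda>(n, x). {X. \<forall>k\<le>n::nat. X k = x k})))"
  (is "sets ?P = sigma_sets UNIV ?G")
proof
  have "{X. X i \<in> A} \<in> sigma_sets UNIV ?G" for i and A :: "(int ^ 'd) set"
  proof -
    have "{X. X i \<in> A} = (\<Union>l\<in>{l. length l = Suc i \<and> l ! i \<in> A}. {X. \<forall>k\<le>i. X k = l ! k})"
    proof (intro equalityI subsetI)
      fix X assume "X \<in> {X. X i \<in> A}"
      then show "X \<in> (\<Union>l\<in>{l. length l = Suc i \<and> l ! i \<in> A}. {X. \<forall>k\<le>i. X k = l ! k})"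
        by (intro UN_I[of "map X [0..<Suc i]"]) (auto simp: less_Suc_eq_le simp del: upt_Suc)
    qed auto
    moreover have "(\<Union>l\<in>{l. length l = Suc i \<and> l ! i \<in> A}. {X. \<forall>k\<le>i. X k = l ! k}) \<in> sigma_sets UNIV ?G"
      by (rule sigma_algebra.countable_UN''[OF sigma_algebra_sigma_sets])
         (auto intro!: sigma_sets.Basic)
    ultimately show ?thesis by simp
  qed
  then show "sets ?P \<subseteq> sigma_sets UNIV ?G"
    unfolding sets_PiM_single space_count_space PiE_UNIV_domain Pi_UNIV
    by (intro sigma_sets_mono) auto
  have "{X. \<forall>k\<le>n. X k = x k} \<in> sets ?P" for n and x :: "nat \<Rightarrow> int ^ 'd"
  proof -
    have "{X\<in>space ?P. \<forall>k\<le>n. X k = x k} \<in> sets ?P"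
      by measurable
    then show ?thesis by (simp add: space_PiM)
  qed
  then have "?G \<subseteq> sets ?P"
    by auto
  then show "sigma_sets UNIV ?G \<subseteq> sets ?P"
    using sets.sigma_sets_subset[of ?G ?P] by (simp add: space_PiM)
qed

lemma prob_vectors_env:
  assumes "\<mu> \<in> prob_measures (Sigma_N \<kappa> \<eta> \<theta>)" "\<omega> \<in> space (env_law \<mu>)"
  shows "prob_vectors \<omega>"
proof -
  have "space \<mu> = Sigma_N \<kappa> \<eta> \<theta>"
    using assms(1) by (auto simp: prob_measures_def space_restrict_space dest: sets_eq_imp_space_eq)
  then show ?thesis
    using assms(2) by (auto simp: env_law_def space_PiM Sigma_N_def prob_vectors_def)
qed

lemma measurable_quenched_law:
  assumes \<mu>: "\<mu> \<in> prob_measures (Sigma_N \<kappa> \<eta> \<theta>)"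
  shows "quenched_law \<in> env_law \<mu> \<rightarrow>\<^sub>M prob_algebra (\<Pi>\<^sub>M n\<in>UNIV. count_space (UNIV :: (int ^ 'd::finite) set))"
proof (rule measurable_prob_algebra_generated[OF sets_paths_eq_cylinders])
  let ?G = "insert {} (range (\<lambda>(n, x). {X :: nat \<Rightarrow> int ^ 'd. \<forall>k\<le>n::nat. X k = x k}))"
  show "Int_stable ?G"
  proof (rule Int_stableI)
    fix A B assume AB: "A \<in> ?G" "B \<in> ?G"
    show "A \<inter> B \<in> ?G"
    proof (cases "A \<inter> B = {}")
      case False
      then obtain Z where Z: "Z \<in> A" "Z \<in> B" by auto
      with AB obtain n m x y where nm: "A = {X. \<forall>k\<le>n. X k = x k}" "B = {X. \<forall>k\<le>m. X k = y k}"
        by auto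
      then have "A = {X. \<forall>k\<le>n. X k = Z k}" "B = {X. \<forall>k\<le>m. X k = Z k}"
        using Z by auto
      then have "A \<inter> B = {X. \<forall>k\<le>max n m. X k = Z k}"
        by (auto simp: le_max_iff_disj)
      then show ?thesis by auto
    qed simp
  qed
  show "?G \<subseteq> Pow UNIV" by auto
  show "prob_space (quenched_law \<omega>)" if "\<omega> \<in> space (env_law \<mu>)" for \<omega>
  proof -
    interpret Ionescu_Tulcea "walk_kernel \<omega>" "\<lambda>_. count_space UNIV"
      using prob_vectors_env[OF \<mu> that] by (rule Ionescu_Tulcea_walk_kernel)
    have "prob_space (distr PF.lim (PiM {} (\<lambda>_. count_space UNIV)) (\<lambda>x. restrict x {}))"
      unfolding distr_lim[OF finite.emptyI] by (intro PF.prob_space_P) auto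
    then show ?thesis
      unfolding quenched_law_def
      by (rule prob_space_distrD[rotated])
         (simp add: measurable_cong_sets[OF PF.sets_lim refl])
  qed
  show "sets (quenched_law \<omega>) = sets (\<Pi>\<^sub>M n\<in>UNIV. count_space UNIV)" if "\<omega> \<in> space (env_law \<mu>)" for \<omega>
    using prob_vectors_env[OF \<mu> that] by (rule sets_quenched_law)
  have sets: "sets \<mu> = sets (borel_on (Sigma_N \<kappa> \<eta> \<theta>))"
    using \<mu> by (simp add: prob_measures_def)
  have comp [measurable]: "(\<lambda>\<omega>. \<omega> z $ s) \<in> borel_measurable (env_law \<mu>)" for z s
  proof -
    have "(\<lambda>\<xi>. \<xi> $ s) \<in> borel_measurable \<mu>"
      unfolding measurable_cong_sets[OF sets refl]
      by (intro measurable_restrict_space1 borel_measurable_continuous_onI continuous_intros)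
    then show ?thesis
      unfolding env_law_def
      by (rule measurable_compose[rotated]) (rule measurable_component_singleton, simp)
  qed
  show "(\<lambda>\<omega>. emeasure (quenched_law \<omega>) A) \<in> borel_measurable (env_law \<mu>)" if "A \<in> ?G" for A
  proof (cases "A = {}")
    case False
    with that obtain n x where A: "A = {X. \<forall>k\<le>n. X k = x k}" by auto
    have "(\<lambda>\<omega>. if x 0 = 0 then \<Prod>k<n. \<Sum>s | x k + nbr s = x (Suc k). ennreal (\<omega> (x k) $ s) else 0)
        \<in> borel_measurable (env_law \<mu>)"
      by measurable
    then show ?thesis
      unfolding A
      by (rule measurable_cong[THEN iffD2, rotated])
         (rule quenched_law_cylinder[OF prob_vectors_env[OF \<mu>]])
  qed simp
qed

lemma prob_space_joint_law:
  assumes \<mu>: "\<mu> \<in> prob_measures (Sigma_N \<kappa> \<eta> \<theta>)"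
  shows "prob_space (joint_law \<mu>)"
    and "sets (joint_law \<mu>) = sets (env_law \<mu> \<Otimes>\<^sub>M (\<Pi>\<^sub>M n\<in>UNIV. count_space UNIV))"
proof -
  let ?P = "\<Pi>\<^sub>M n\<in>(UNIV::nat set). count_space (UNIV :: (int ^ 'a) set)"
  interpret M: prob_space \<mu> using \<mu> by (simp add: prob_measures_def)
  interpret E: prob_space "env_law \<mu>"
    unfolding env_law_def by (intro prob_space_PiM) (rule M.prob_space_axioms)
  have Q: "quenched_law \<in> env_law \<mu> \<rightarrow>\<^sub>M subprob_algebra ?P"
    using measurable_quenched_law[OF \<mu>] by (rule measurable_prob_algebraD)
  have K: "(\<lambda>\<omega>. distr (quenched_law \<omega>) (env_law \<mu> \<Otimes>\<^sub>M ?P) (\<lambda>X. (\<omega>, X)))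
      \<in> env_law \<mu> \<rightarrow>\<^sub>M subprob_algebra (env_law \<mu> \<Otimes>\<^sub>M ?P)"
    by (rule measurable_distr2[OF _ Q]) simp
  show "sets (joint_law \<mu>) = sets (env_law \<mu> \<Otimes>\<^sub>M ?P)"
    unfolding joint_law_def by (intro sets_bind E.not_empty) simp
  have "prob_space (distr (quenched_law \<omega>) (env_law \<mu> \<Otimes>\<^sub>M ?P) (\<lambda>X. (\<omega>, X)))"
    if "\<omega> \<in> space (env_law \<mu>)" for \<omega>
  proof (rule prob_space.prob_space_distr)
    show "prob_space (quenched_law \<omega>)"
      using measurable_space[OF measurable_quenched_law[OF \<mu>] that] by (simp add: space_prob_algebra)
    show "(\<lambda>X. (\<omega>, X)) \<in> quenched_law \<omega> \<rightarrow>\<^sub>M env_law \<mu> \<Otimes>\<^sub>M ?P"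
      unfolding measurable_cong_sets[OF sets_quenched_law[OF prob_vectors_env[OF \<mu> that]] refl]
      using that by simp
  qed
  then show "prob_space (joint_law \<mu>)"
    unfolding joint_law_def by (intro E.prob_space_bind[OF _ K]) (auto intro!: AE_I2)
qed

end

theory Submission
  imports Defs
begin

text \<open>If \<open>\<nu>\<close> is close to the Dirac mass at \<open>\<xi>\<close>, a site is bad, that is, its vector is not within
  \<open>\<epsilon>\<close> of \<open>\<xi>\<close>, with probability at most \<open>\<epsilon>\<close>.  The walk might be attracted to bad sites, and the
  point is that the expected discounted number of its visits of a site \<open>x\<close> on the event that \<open>x\<close> is
  bad is at most a constant times \<open>\<epsilon>\<close> times its expected discounted number of visits of \<open>x\<close>.  Changing the
  environment in a finite cluster multiplies the Green function at \<open>x\<close> by at most a constant which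
  is exponential in the diameter of the cluster, provided that all sites around the cluster can be
  reached from \<open>x\<close>, and vice versa, by steps of probability bounded below.  The two non-parallel
  directions that are possible everywhere let the walk get past bad sites, unless these
  are so dense that the large power of \<open>\<epsilon>\<close> which they cost beats the constant.

  Hence the walk spends a fraction of order \<open>\<epsilon>\<close> of its time at bad sites, and its mean displacement
  per step is within order \<open>\<epsilon>\<close> of the drift of \<open>\<xi>\<close>.  To obtain this for each of two possible velocities,
  condition on a finite path after which the velocity is almost decided.  If
  the velocity is nonzero, the walk leaves the environment seen by that path; if it is zero, the
  bound is applied to a region that grows slowly compared with time.\<close>

section \<open>Discounted Green functions\<close>

text \<open>Discounting keeps the Green function finite even for a recurrent walk, and with r = 1 -
  1/N it counts visits up to time N up to a factor 3, so bounds that are uniform for r in [1/2, 1)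
  speak of time averages. The obstacle is that an environment cannot be repaired one bad site at a
  time: the paths needed for a comparison may have to cross further bad sites. Therefore the whole
  obstructing cluster is exchanged at once, at one of the scales n = (2 * d + 9)^i. At scale n there
  are at most \<open>entropy_const\<close>^n candidates, each contains at least n sites, and each
  exchange costs at most \<open>modification_const\<close>^n. All factors are n-th powers, so
  \<open>cluster_const\<close> * \<epsilon> \<le> 1/2 is enough at all scales simultaneously, and
  since the smallest scale is n = 1, the sum over the scales is still of order \<epsilon>. The ratio
  2 * d + 9 is the reach of a cluster: connectivity around a cluster found at one scale has to be
  known at the next one. The constants involve d and \<alpha> only, and this makes the bound uniform
  over all measures near the Dirac mass.\<close>

definition subprob_vectors :: "'d::finite environment \<Rightarrow> bool" where
  "subprob_vectors \<omega> \<longleftrightarrow> (\<forall>z. (\<forall>s. 0 \<le> \<omega> z $ s) \<and> (\<Sum>s\<in>UNIV. \<omega> z $ s) \<le> 1)"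

lemma prob_imp_subprob_vectors: "prob_vectors \<omega> \<Longrightarrow> subprob_vectors \<omega>"
  by (auto simp: prob_vectors_def subprob_vectors_def)

definition avg :: "'d::finite environment \<Rightarrow> (int ^ 'd \<Rightarrow> real) \<Rightarrow> int ^ 'd \<Rightarrow> real" where
  "avg \<omega> \<phi> x = (\<Sum>s\<in>UNIV. \<omega> x $ s * \<phi> (x + nbr s))"

text \<open>The inverse of 1 - r P applied to \<phi>, for the transition operator P =
  \<open>avg \<omega>\<close>: the expected discounted sum of \<phi> along the walk. Powers of P
  replace paths, so that Green functions can be treated by algebra;
  \<open>quenched_occupation\<close> makes the connection with the walk.\<close>

definition resolvent :: "'d::finite environment \<Rightarrow> real \<Rightarrow> (int ^ 'd \<Rightarrow> real) \<Rightarrow> int ^ 'd \<Rightarrow> real" where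
  "resolvent \<omega> r \<phi> x = (\<Sum>n. r ^ n * (avg \<omega> ^^ n) \<phi> x)"

lemma avg_cmult: "avg \<omega> (\<lambda>x. c * \<phi> x) = (\<lambda>x. c * avg \<omega> \<phi> x)"
  by (simp add: avg_def fun_eq_iff algebra_simps sum_distrib_left)

lemma avg_sum: "avg \<omega> (\<lambda>x. \<Sum>a\<in>A. \<phi> a x) = (\<lambda>x. \<Sum>a\<in>A. avg \<omega> (\<phi> a) x)"
  unfolding avg_def fun_eq_iff sum_distrib_left by (auto intro: sum.swap)

lemma avg_mono: "subprob_vectors \<omega> \<Longrightarrow> (\<And>x. \<phi> x \<le> \<psi> x) \<Longrightarrow> avg \<omega> \<phi> x \<le> avg \<omega> \<psi> x"
  unfolding avg_def by (intro sum_mono mult_left_mono) (auto simp: subprob_vectors_def)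

lemma avg_nonneg: "subprob_vectors \<omega> \<Longrightarrow> (\<And>x. 0 \<le> \<phi> x) \<Longrightarrow> 0 \<le> avg \<omega> \<phi> x"
  unfolding avg_def by (intro sum_nonneg mult_nonneg_nonneg) (auto simp: subprob_vectors_def)

lemma avg_ge_step:
  "subprob_vectors \<omega> \<Longrightarrow> (\<And>x. 0 \<le> \<phi> x) \<Longrightarrow> \<omega> x $ s * \<phi> (x + nbr s) \<le> avg \<omega> \<phi> x"
  unfolding avg_def by (rule member_le_sum[of s]) (auto simp: subprob_vectors_def)

lemma avg_const: "prob_vectors \<omega> \<Longrightarrow> avg \<omega> (\<lambda>_. c) = (\<lambda>_. c)"
  by (simp add: avg_def prob_vectors_def fun_eq_iff flip: sum_distrib_right)

lemma avg_bounded: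
  assumes "subprob_vectors \<omega>" "\<And>x. \<bar>\<phi> x\<bar> \<le> c"
  shows "\<bar>avg \<omega> \<phi> x\<bar> \<le> c"
proof -
  have "\<bar>avg \<omega> \<phi> x\<bar> \<le> (\<Sum>s\<in>UNIV. \<omega> x $ s * c)"
    unfolding avg_def using assms
    by (intro order_trans[OF sum_abs] sum_mono) (auto simp: abs_mult subprob_vectors_def intro!: mult_left_mono)
  also have "\<dots> \<le> 1 * c"
    unfolding sum_distrib_right[symmetric] using assms(1) assms(2)[of x]
    by (intro mult_right_mono) (auto simp: subprob_vectors_def)
  finally show ?thesis by simp
qed

lemma avg_pow_bounded:
  assumes "subprob_vectors \<omega>" "\<And>x. \<bar>\<phi> x\<bar> \<le> c"
  shows "\<bar>(avg \<omega> ^^ n) \<phi> x\<bar> \<le> c"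
  by (induction n arbitrary: x) (auto simp: assms intro: avg_bounded)

lemma avg_pow_mono:
  assumes "subprob_vectors \<omega>" "\<And>x. \<phi> x \<le> \<psi> x"
  shows "(avg \<omega> ^^ n) \<phi> x \<le> (avg \<omega> ^^ n) \<psi> x"
  by (induction n arbitrary: x) (auto simp: assms intro: avg_mono)

lemma avg_pow_nonneg:
  assumes "subprob_vectors \<omega>" "\<And>x. 0 \<le> \<phi> x"
  shows "0 \<le> (avg \<omega> ^^ n) \<phi> x"
  by (induction n arbitrary: x) (auto simp: assms intro: avg_nonneg)

lemma avg_pow_cmult: "(avg \<omega> ^^ n) (\<lambda>x. c * \<phi> x) = (\<lambda>x. c * (avg \<omega> ^^ n) \<phi> x)"
  by (induction n) (simp_all add: avg_cmult)

lemma avg_pow_sum: "(avg \<omega> ^^ n) (\<lambda>x. \<Sum>a\<in>A. \<phi> a x) = (\<lambda>x. \<Sum>a\<in>A. (avg \<omega> ^^ n) (\<phi> a) x)"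
  by (induction n) (simp_all add: avg_sum)

lemma avg_pow_const: "prob_vectors \<omega> \<Longrightarrow> (avg \<omega> ^^ n) (\<lambda>_. c) = (\<lambda>_. c)"
  by (induction n) (simp_all add: avg_const)

context
  fixes \<omega> :: "'d::finite environment" and r :: real
  assumes sub: "subprob_vectors \<omega>" and r: "0 \<le> r" "r < 1"
begin

lemma resolvent_summable:
  assumes "\<And>x. \<bar>\<phi> x\<bar> \<le> c"
  shows "summable (\<lambda>n. r ^ n * (avg \<omega> ^^ n) \<phi> x)"
proof (rule summable_comparison_test'[of "\<lambda>n. c * r ^ n" 0])
  show "summable (\<lambda>n. c * r ^ n)" using r by (intro summable_mult summable_geometric) simp
  show "norm (r ^ n * (avg \<omega> ^^ n) \<phi> x) \<le> c * r ^ n" for n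
    using mult_right_mono[OF avg_pow_bounded[OF sub assms, where n=n and x=x], of "r ^ n"] r by (simp add: abs_mult mult.commute)
qed

lemma resolvent_nonneg:
  assumes "\<And>x. 0 \<le> \<phi> x" "\<And>x. \<phi> x \<le> c"
  shows "0 \<le> resolvent \<omega> r \<phi> x"
  unfolding resolvent_def
  by (intro suminf_nonneg resolvent_summable[of \<phi> c] mult_nonneg_nonneg avg_pow_nonneg sub)
     (use assms r in \<open>auto simp: abs_le_iff intro: order_trans[of _ 0]\<close>)

lemma resolvent_le:
  assumes "\<And>x. 0 \<le> \<phi> x" "\<And>x. \<phi> x \<le> c"
  shows "resolvent \<omega> r \<phi> x \<le> c / (1 - r)"
proof -
  have b: "\<bar>\<phi> x\<bar> \<le> c" for x using assms[of x] by auto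
  have "resolvent \<omega> r \<phi> x \<le> (\<Sum>n. r ^ n * c)"
    unfolding resolvent_def
  proof (intro suminf_le resolvent_summable[OF b] mult_left_mono)
    show "(avg \<omega> ^^ n) \<phi> x \<le> c" for n using avg_pow_bounded[where \<phi>=\<phi>, OF sub b, of n x] by linarith
    show "summable (\<lambda>n. r ^ n * c)" using r by (intro summable_mult2 summable_geometric) simp
  qed (use r in auto)
  also have "\<dots> = c / (1 - r)"
    using r by (simp add: suminf_mult2[symmetric] suminf_geometric)
  finally show ?thesis .
qed

lemma resolvent_bounded:
  assumes "\<And>x. \<bar>\<phi> x\<bar> \<le> c"
  shows "\<bar>resolvent \<omega> r \<phi> x\<bar> \<le> c / (1 - r)"
proof -
  have *: "summable (\<lambda>n. \<bar>r ^ n * (avg \<omega> ^^ n) \<phi> x\<bar>)" 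
    and **: "\<bar>r ^ n * (avg \<omega> ^^ n) \<phi> x\<bar> \<le> r ^ n * c" for n
  proof -
    show **: "\<bar>r ^ n * (avg \<omega> ^^ n) \<phi> x\<bar> \<le> r ^ n * c" for n
      using mult_right_mono[OF avg_pow_bounded[OF sub assms, where n=n and x=x], of "r ^ n"] r by (simp add: abs_mult mult.commute)
    have "summable (\<lambda>n. r ^ n * c)" using r by (intro summable_mult2 summable_geometric) simp
    then show "summable (\<lambda>n. \<bar>r ^ n * (avg \<omega> ^^ n) \<phi> x\<bar>)"
      by (rule summable_comparison_test'[of _ 0]) (use ** in auto)
  qed
  have "\<bar>resolvent \<omega> r \<phi> x\<bar> \<le> (\<Sum>n. \<bar>r ^ n * (avg \<omega> ^^ n) \<phi> x\<bar>)"
    unfolding resolvent_def by (rule summable_rabs[OF *])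
  also have "\<dots> \<le> (\<Sum>n. r ^ n * c)"
    using r by (intro suminf_le ** * summable_mult2 summable_geometric) simp
  also have "\<dots> = c / (1 - r)"
    using r by (simp add: suminf_mult2[symmetric] suminf_geometric)
  finally show ?thesis .
qed

lemma resolvent_mono:
  assumes "\<And>x. \<phi> x \<le> \<psi> x" "\<And>x. \<bar>\<phi> x\<bar> \<le> c" "\<And>x. \<bar>\<psi> x\<bar> \<le> c'"
  shows "resolvent \<omega> r \<phi> x \<le> resolvent \<omega> r \<psi> x"
  unfolding resolvent_def
  by (intro suminf_le resolvent_summable[OF assms(2)] resolvent_summable[OF assms(3)] mult_left_mono avg_pow_mono sub assms(1))
     (use r in auto)

lemma resolvent_cmult:
  assumes "\<And>x. \<bar>\<phi> x\<bar> \<le> c"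
  shows "resolvent \<omega> r (\<lambda>x. a * \<phi> x) x = a * resolvent \<omega> r \<phi> x"
  unfolding resolvent_def avg_pow_cmult
  using suminf_mult[OF resolvent_summable[OF assms, where x=x], of a] by (simp add: algebra_simps)

lemma resolvent_sum:
  assumes "\<And>a x. \<bar>\<phi> a x\<bar> \<le> c a"
  shows "resolvent \<omega> r (\<lambda>x. \<Sum>a\<in>A. \<phi> a x) x = (\<Sum>a\<in>A. resolvent \<omega> r (\<phi> a) x)"
  unfolding resolvent_def avg_pow_sum sum_distrib_left
  by (rule suminf_sum) (rule resolvent_summable[OF assms])

text \<open>Splitting off the first term of the series leaves one factor P, which can be taken out
  on either side. On the left this is one-step analysis in the starting point; on the right P acts
  on \<phi>, which lets \<open>green_step\<close> move the target.\<close>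

lemma resolvent_fixpoint:
  assumes "\<And>x. \<bar>\<phi> x\<bar> \<le> c"
  shows "resolvent \<omega> r \<phi> x = \<phi> x + r * avg \<omega> (resolvent \<omega> r \<phi>) x"
    and "resolvent \<omega> r \<phi> x = \<phi> x + r * resolvent \<omega> r (avg \<omega> \<phi>) x"
proof -
  note s = resolvent_summable[where \<phi>=\<phi>, OF assms]
  have s2: "summable (\<lambda>n. r ^ n * (avg \<omega> ^^ n) (avg \<omega> \<phi>) x)" for x
    by (rule resolvent_summable) (rule avg_bounded[OF sub assms])
  have *: "resolvent \<omega> r \<phi> x = \<phi> x + (\<Sum>n. r * (r ^ n * avg \<omega> ((avg \<omega> ^^ n) \<phi>) x))"
    unfolding resolvent_def using suminf_split_head[OF s, of x] by (simp add: algebra_simps)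
  have "(\<Sum>n. r * (r ^ n * avg \<omega> ((avg \<omega> ^^ n) \<phi>) x)) = r * (\<Sum>n. r ^ n * (avg \<omega> ^^ n) (avg \<omega> \<phi>) x)"
    using suminf_mult[OF s2, where c=r] by (simp add: funpow_swap1)
  then show "resolvent \<omega> r \<phi> x = \<phi> x + r * resolvent \<omega> r (avg \<omega> \<phi>) x"
    using * by (simp add: resolvent_def)
  have "avg \<omega> (resolvent \<omega> r \<phi>) x = (\<Sum>s\<in>UNIV. \<Sum>n. \<omega> x $ s * (r ^ n * (avg \<omega> ^^ n) \<phi> (x + nbr s)))"
    unfolding avg_def[of \<omega> "resolvent \<omega> r \<phi>" x] resolvent_def by (simp only: suminf_mult[OF s])
  also have "\<dots> = (\<Sum>n. \<Sum>s\<in>UNIV. \<omega> x $ s * (r ^ n * (avg \<omega> ^^ n) \<phi> (x + nbr s)))"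
    by (rule suminf_sum[symmetric]) (intro summable_mult s)
  also have "\<dots> = (\<Sum>n. r ^ n * avg \<omega> ((avg \<omega> ^^ n) \<phi>) x)"
    by (simp add: avg_def sum_distrib_left algebra_simps)
  finally have "r * avg \<omega> (resolvent \<omega> r \<phi>) x = (\<Sum>n. r * (r ^ n * avg \<omega> ((avg \<omega> ^^ n) \<phi>) x))"
    using suminf_mult[OF s2, where c=r] by (simp add: funpow_swap1)
  then show "resolvent \<omega> r \<phi> x = \<phi> x + r * avg \<omega> (resolvent \<omega> r \<phi>) x"
    using * by simp
qed

text \<open>The difference g of two bounded solutions satisfies g = r P g, so it is at most r^n
  times a constant for every n. Identities such as \<open>last_exit\<close> are proved by checking
  this equation instead of decomposing paths.\<close>

lemma resolvent_unique:
  assumes \<psi>: "\<And>x. \<bar>\<psi> x\<bar> \<le> c" and f: "\<And>x. \<bar>f x\<bar> \<le> c'" and eq: "\<And>x. f x = \<psi> x + r * avg \<omega> f x"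
  shows "f x = resolvent \<omega> r \<psi> x"
proof -
  define g where "g = (\<lambda>x. f x - resolvent \<omega> r \<psi> x)"
  have g: "g x = r * avg \<omega> g x" for x
  proof -
    have "avg \<omega> g = (\<lambda>x. avg \<omega> f x - avg \<omega> (resolvent \<omega> r \<psi>) x)"
      by (simp add: g_def avg_def fun_eq_iff sum_subtractf algebra_simps)
    then show ?thesis
      unfolding g_def using eq[of x] resolvent_fixpoint(1)[where \<phi>=\<psi>, OF \<psi>, of x] by (simp add: algebra_simps)
  qed
  have bound: "\<bar>g x\<bar> \<le> c' + c / (1 - r)" for x
    unfolding g_def using f[of x] resolvent_bounded[where \<phi>=\<psi>, OF \<psi>, of x] by linarith
  have "\<bar>g x\<bar> \<le> r ^ n * (c' + c / (1 - r))" for n x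
  proof (induction n arbitrary: x)
    case (Suc n)
    have "\<bar>avg \<omega> g x\<bar> \<le> r ^ n * (c' + c / (1 - r))"
      by (rule avg_bounded[OF sub Suc])
    then have "r * \<bar>avg \<omega> g x\<bar> \<le> r * (r ^ n * (c' + c / (1 - r)))"
      by (rule mult_left_mono) (rule r)
    then show ?case using r by (subst g) (simp add: abs_mult)
  qed (simp add: bound)
  moreover have "(\<lambda>n. r ^ n * (c' + c / (1 - r))) \<longlonglongrightarrow> 0"
    using r by (intro tendsto_mult_left_zero LIMSEQ_realpow_zero) auto
  ultimately have "\<bar>g x\<bar> \<le> 0"
    by (intro LIMSEQ_le_const[of _ 0 "\<bar>g x\<bar>"]) auto
  then show ?thesis by (simp add: g_def)
qed

end

section \<open>Green functions along likely steps, and the last-exit decomposition\<close>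

definition green :: "'d::finite environment \<Rightarrow> real \<Rightarrow> int ^ 'd \<Rightarrow> int ^ 'd \<Rightarrow> real" where
  "green \<omega> r x a = resolvent \<omega> r (indicator {a}) x"

definition steps :: "(int ^ 'd::finite) rel \<Rightarrow> nat \<Rightarrow> int ^ 'd \<Rightarrow> int ^ 'd \<Rightarrow> bool" where
  "steps E k a b \<longleftrightarrow> (\<exists>j\<le>k. (a, b) \<in> E ^^ j)"

definition admissible :: "'d::finite environment \<Rightarrow> real \<Rightarrow> (int ^ 'd) rel \<Rightarrow> bool" where
  "admissible \<omega> \<alpha> E \<longleftrightarrow> (\<forall>(a, b)\<in>E. \<exists>s. b = a + nbr s \<and> \<alpha> \<le> \<omega> a $ s)"

context
  fixes \<omega> :: "'d::finite environment" and r \<alpha> :: real and E :: "(int ^ 'd) rel"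
  assumes pv: "prob_vectors \<omega>" and r: "0 \<le> r" "r < 1" and \<alpha>: "0 \<le> \<alpha>" and E: "admissible \<omega> \<alpha> E"
begin

lemma green_nonneg: "0 \<le> green \<omega> r x a"
  unfolding green_def
  by (rule resolvent_nonneg[OF prob_imp_subprob_vectors[OF pv] r, of _ 1]) (auto simp: indicator_def)

text \<open>Each visit of \<open>a\<close> is followed by a visit of \<open>b\<close> with
  probability at least \<alpha>, and the extra step costs a factor r. In terms of operators,
  \<alpha> times the indicator of \<open>a\<close> lies below P applied to the indicator of
  \<open>b\<close>, and the resolvent is monotone.\<close>

lemma green_step:
  assumes "(a, b) \<in> E"
  shows "r * \<alpha> * green \<omega> r x a \<le> green \<omega> r x b"
proof -
  note sub = prob_imp_subprob_vectors[OF pv]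
  obtain s where s: "b = a + nbr s" "\<alpha> \<le> \<omega> a $ s" using E assms by (auto simp: admissible_def)
  have b1: "\<bar>indicator {b} x :: real\<bar> \<le> 1" for b x :: "int ^ 'd" by (auto simp: indicator_def)
  have "\<alpha> * resolvent \<omega> r (indicator {a}) x = resolvent \<omega> r (\<lambda>y. \<alpha> * indicator {a} y) x"
    by (rule resolvent_cmult[OF sub r, symmetric]) (rule b1)
  also have "\<dots> \<le> resolvent \<omega> r (avg \<omega> (indicator {b})) x"
  proof (rule resolvent_mono[OF sub r, of _ _ \<alpha> 1])
    show "\<alpha> * indicator {a} y \<le> avg \<omega> (indicator {b}) y" for y
    proof (cases "y = a")
      case True
      then show ?thesis
        using avg_ge_step[OF sub, of "indicator {b}" a s] s by simp
    qed (auto intro!: avg_nonneg sub)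
    show "\<bar>avg \<omega> (indicator {b}) x\<bar> \<le> 1" for x by (intro avg_bounded[OF sub] b1)
  qed (use \<alpha> in \<open>auto simp: indicator_def\<close>)
  finally have "r * (\<alpha> * resolvent \<omega> r (indicator {a}) x) \<le> r * resolvent \<omega> r (avg \<omega> (indicator {b})) x"
    using r by (intro mult_left_mono)
  also have "\<dots> \<le> resolvent \<omega> r (indicator {b}) x"
    unfolding resolvent_fixpoint(2)[OF sub r b1, where x=x] by simp
  finally show ?thesis by (simp add: green_def)
qed

lemma green_steps:
  assumes "(a, b) \<in> E ^^ k"
  shows "(r * \<alpha>) ^ k * green \<omega> r x a \<le> green \<omega> r x b"
  using assms
proof (induction k arbitrary: b)
  case (Suc k)
  then obtain c where c: "(a, c) \<in> E ^^ k" "(c, b) \<in> E" by auto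
  have "(r * \<alpha>) * ((r * \<alpha>) ^ k * green \<omega> r x a) \<le> r * \<alpha> * green \<omega> r x c"
    using Suc.IH[OF c(1)] r \<alpha> by (intro mult_left_mono) auto
  with green_step[OF c(2), of x] show ?case by (simp add: mult.assoc)
qed simp

end

text \<open>The discounted probability of being killed before hitting \<open>A\<close>.\<close>

definition escape :: "'d::finite environment \<Rightarrow> real \<Rightarrow> (int ^ 'd) set \<Rightarrow> int ^ 'd \<Rightarrow> real" where
  "escape \<omega> r A = resolvent (\<lambda>z. if z \<in> A then 0 else \<omega> z) r (\<lambda>z. if z \<in> A then 0 else 1 - r)"

lemma escape_cong: "(\<And>z. z \<notin> A \<Longrightarrow> \<omega> z = \<omega>' z) \<Longrightarrow> escape \<omega> r A = escape \<omega>' r A"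
  unfolding escape_def by (rule arg_cong[where f = "\<lambda>\<omega>. resolvent \<omega> r _"]) auto

context
  fixes \<omega> :: "'d::finite environment" and r :: real and A :: "(int ^ 'd) set"
  assumes pv: "prob_vectors \<omega>" and r: "0 \<le> r" "r < 1"
begin

lemma escape_props:
  shows "0 \<le> escape \<omega> r A x" "escape \<omega> r A x \<le> 1" "x \<in> A \<Longrightarrow> escape \<omega> r A x = 0"
    "x \<notin> A \<Longrightarrow> escape \<omega> r A x = (1 - r) + r * avg \<omega> (escape \<omega> r A) x"
proof -
  let ?\<omega> = "\<lambda>z. if z \<in> A then 0 else \<omega> z" and ?\<phi> = "\<lambda>z. if z \<in> A then 0 else 1 - r"
  have sub: "subprob_vectors ?\<omega>" using pv by (auto simp: prob_vectors_def subprob_vectors_def)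
  have b: "\<bar>?\<phi> x\<bar> \<le> 1 - r" for x using r by auto
  show "0 \<le> escape \<omega> r A x"
    unfolding escape_def by (rule resolvent_nonneg[OF sub r, of _ "1 - r"]) (use r in auto)
  show "escape \<omega> r A x \<le> 1"
    using resolvent_le[OF sub r, of ?\<phi> "1 - r" x] r by (auto simp: escape_def)
  have fix': "escape \<omega> r A x = ?\<phi> x + r * avg ?\<omega> (escape \<omega> r A) x" for x
    unfolding escape_def by (rule resolvent_fixpoint(1)[OF sub r b])
  show "x \<in> A \<Longrightarrow> escape \<omega> r A x = 0" by (subst fix') (auto simp: avg_def)
  show "x \<notin> A \<Longrightarrow> escape \<omega> r A x = (1 - r) + r * avg \<omega> (escape \<omega> r A) x"
    by (subst fix') (auto simp: avg_def)
qed

text \<open>Let the walk die with probability 1 - r at each time; then 1 - \<open>escape\<close> is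
  the probability that it visits A. Decompose at the last site \<open>a\<close> of A that it visits:
  from there it either dies at once or survives, steps and never returns. Both sides solve the same
  fixed-point equation.\<close>

lemma last_exit:
  assumes "finite A"
  shows "1 - escape \<omega> r A x =
    (\<Sum>a\<in>A. green \<omega> r x a * ((1 - r) + r * avg \<omega> (escape \<omega> r A) a))"
proof -
  note sub = prob_imp_subprob_vectors[OF pv]
  let ?q = "escape \<omega> r A"
  let ?e = "\<lambda>a. (1 - r) + r * avg \<omega> ?q a"
  have q: "\<bar>?q x\<bar> \<le> 1" for x using escape_props(1,2)[of x] by auto
  have aq: "0 \<le> avg \<omega> ?q x" "avg \<omega> ?q x \<le> 1" for x
    using avg_nonneg[OF sub, of ?q x] escape_props(1) avg_bounded[OF sub q, where x=x] by (auto simp: abs_le_iff)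
  have e: "\<bar>?e a\<bar> \<le> 2" for a
    using aq[of a] r mult_left_le[of "avg \<omega> ?q a" r] mult_nonneg_nonneg[OF r(1) aq(1)[of a]] by auto
  have eq: "(\<Sum>a\<in>A. ?e a * indicator {a} y) = (if y \<in> A then ?e y else 0)" for y
    using assms by (auto simp: indicator_def sum.delta if_distrib cong: if_cong)
  have "1 - ?q x = resolvent \<omega> r (\<lambda>y. \<Sum>a\<in>A. ?e a * indicator {a} y) x"
  proof (rule resolvent_unique[OF sub r, where c = 2 and c' = 1])
    show "\<bar>\<Sum>a\<in>A. ?e a * indicator {a} x\<bar> \<le> 2" for x unfolding eq using e[of x] by auto
    show "\<bar>1 - ?q x\<bar> \<le> 1" for x using escape_props(1,2)[of x] by auto
    have "avg \<omega> (\<lambda>y. 1 - ?q y) y = 1 - avg \<omega> ?q y" for y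
      using pv by (simp add: avg_def algebra_simps sum_subtractf prob_vectors_def)
    note * = this
    show "1 - ?q y = (\<Sum>a\<in>A. ?e a * indicator {a} y) + r * avg \<omega> (\<lambda>y. 1 - ?q y) y" for y
      unfolding eq * using escape_props(3,4)[of y] by (auto simp: algebra_simps)
  qed
  also have "\<dots> = (\<Sum>a\<in>A. resolvent \<omega> r (\<lambda>y. ?e a * indicator {a} y) x)"
    by (rule resolvent_sum[OF sub r, where c = "\<lambda>_. 2"])
       (use e in \<open>auto simp: indicator_def\<close>)
  also have "\<dots> = (\<Sum>a\<in>A. ?e a * green \<omega> r x a)"
    unfolding green_def by (intro sum.cong refl resolvent_cmult[OF sub r, of _ 1]) (auto simp: indicator_def)
  finally show ?thesis by (simp add: mult.commute)
qed

end

text \<open>The expected discounted number of visits of \<open>A\<close> times the probability to escape from \<open>A\<close>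
  equals the probability of hitting \<open>A\<close>, which does not depend on the environment in \<open>A\<close>.\<close>

lemma green_comparison:
  fixes \<omega> \<omega>' :: "'d::finite environment"
  assumes pv: "prob_vectors \<omega>" "prob_vectors \<omega>'" and eq: "\<And>z. z \<notin> A \<Longrightarrow> \<omega> z = \<omega>' z"
    and A: "finite A" "x \<in> A" and r: "0 \<le> r" "r < 1" and \<alpha>: "0 \<le> \<alpha>" "\<alpha> \<le> 1" and \<beta>: "0 < \<beta>" "\<beta> \<le> r * \<alpha>"
    and E: "admissible \<omega> \<alpha> E" "admissible \<omega>' \<alpha> E"
    and out: "\<And>a s. a \<in> A \<Longrightarrow> steps E k x (a + nbr s)" and into: "\<And>a. a \<in> A \<Longrightarrow> steps E k a x"
  shows "green \<omega> r x0 x \<le> 2 * card A * (1 / \<beta>) ^ (2 * k) * green \<omega>' r x0 x"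
proof -
  define q where "q = escape \<omega> r A"
  have q': "escape \<omega>' r A = q" unfolding q_def by (intro escape_cong) (simp add: eq)
  let ?G = "green \<omega> r x0" and ?G' = "green \<omega>' r x0"
  define T where "T = (\<Sum>a\<in>A. ?G a * ((1 - r) + r * avg \<omega> q a))"
  note sub = prob_imp_subprob_vectors[OF pv(1)]
  note G0 = green_nonneg[OF pv(1) r \<alpha>(1) E(1), of x0] green_nonneg[OF pv(2) r \<alpha>(1) E(2), of x0]
  note q0 = escape_props(1)[OF pv(1) r, of A, folded q_def] and qA = escape_props(3)[OF pv(1) r, of _ A, folded q_def]
    and qfix = escape_props(4)[OF pv(1) r, of _ A, folded q_def]
  have aq0: "0 \<le> avg \<omega> q a" for a by (intro avg_nonneg[OF sub] q0)
  have term0: "0 \<le> ?G a * ((1 - r) + r * avg \<omega> q a)" for a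
    using G0(1)[of a] aq0[of a] r by (intro mult_nonneg_nonneg add_nonneg_nonneg) auto
  have T0: "0 \<le> T" unfolding T_def by (intro sum_nonneg term0)
  have T_ge: "?G a * ((1 - r) + r * avg \<omega> q a) \<le> T" if "a \<in> A" for a
    unfolding T_def using that A(1) by (intro member_le_sum term0) auto
  \<comment> \<open>\<open>q\<close> depends on the environment outside A only, so it is the same in
    both environments, and T is the probability of visiting A in either of them.\<close>
  have T': "T = (\<Sum>a\<in>A. ?G' a * ((1 - r) + r * avg \<omega>' q a))"
    unfolding T_def q_def last_exit[OF pv(1) r A(1), symmetric]
    using last_exit[OF pv(2) r A(1), of x0] by (simp add: q_def[symmetric] q')
  have r0: "0 < r" and \<alpha>0: "0 < \<alpha>" using \<beta> \<alpha> r by (auto simp: zero_less_mult_iff dest: less_le_trans)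
  let ?c = "r * \<alpha>"
  have c: "0 < ?c" "?c \<le> 1" using r \<alpha> r0 \<alpha>0 mult_le_one[of r \<alpha>] by auto
  \<comment> \<open>\<open>q\<close> vanishes on A, so an escape from \<open>b\<close> cannot simply
    be traced back along a path that meets A. Outside A the escape probability is carried back step
    by step; at the last site of A on the path, the summand of T that belongs to this site already
    dominates the left-hand side.\<close>
  have key: "?c ^ j * ?G a * q b \<le> max T (?G a * q a)" if "(a, b) \<in> E ^^ j" for a b j
    using that
  proof (induction j arbitrary: a)
    case (Suc j)
    then obtain a' where a': "(a, a') \<in> E" "(a', b) \<in> E ^^ j" by (meson relpow_Suc_D2)
    have ga: "?c * ?G a \<le> ?G a'" by (rule green_step[OF pv(1) r \<alpha>(1) E(1) a'(1)])
    then have "?c ^ j * q b * (?c * ?G a) \<le> ?c ^ j * q b * ?G a'"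
      using c q0[of b] by (intro mult_left_mono) auto
    then have 1: "?c ^ Suc j * ?G a * q b \<le> ?c ^ j * ?G a' * q b" by (simp add: mult_ac)
    show ?case
    proof (cases "?c ^ j * ?G a' * q b \<le> T")
      case False
      then have "?c ^ j * ?G a' * q b \<le> ?G a' * q a'" using Suc.IH[OF a'(2)] by auto
      moreover have "?G a' > 0"
      proof (rule ccontr)
        assume "\<not> ?thesis"
        then have "?G a' = 0" using G0(1)[of a'] by auto
        then show False using False T0 by simp
      qed
      ultimately have qa': "?c ^ j * q b \<le> q a'" by (simp add: mult_ac)
      obtain s where s: "a' = a + nbr s" "\<alpha> \<le> \<omega> a $ s" using E(1) a'(1) by (auto simp: admissible_def)
      have "\<alpha> * q a' \<le> \<omega> a $ s * q a'" using s q0 by (intro mult_right_mono) auto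
      also have "\<dots> \<le> avg \<omega> q a" unfolding s(1) by (rule avg_ge_step[OF sub q0])
      finally have "?c * q a' \<le> r * avg \<omega> q a" using r by (simp add: mult.assoc mult_left_mono)
      then have "?c * (?c ^ j * q b) \<le> r * avg \<omega> q a" using qa' c
        by (meson mult_left_mono order_trans less_imp_le)
      then have *: "?G a * (?c * (?c ^ j * q b)) \<le> ?G a * ((1 - r) + r * avg \<omega> q a)"
        using r G0 by (intro mult_left_mono) auto
      show ?thesis
      proof (cases "a \<in> A")
        case True
        then show ?thesis using * T_ge[OF True] by (simp add: mult_ac)
      next
        case False
        then show ?thesis using * qfix[OF False] by (simp add: mult_ac)
      qed
    qed (use 1 in auto)
  qed simp
  have \<beta>c: "\<beta> ^ k \<le> ?c ^ j" if "j \<le> k" for j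
  proof -
    have "\<beta> ^ k \<le> ?c ^ k" using \<beta> by (intro power_mono) auto
    also have "\<dots> \<le> ?c ^ j" using c that by (intro power_decreasing) auto
    finally show ?thesis .
  qed
  \<comment> \<open>The path starts at \<open>x\<close> in A, where \<open>q\<close> vanishes, so
    the maximum in \<open>key\<close> is T.\<close>
  have qb: "\<beta> ^ k * ?G x * q b \<le> T" if ab: "a \<in> A" "b = a + nbr s" for a b s
  proof -
    obtain j where j: "j \<le> k" "(x, b) \<in> E ^^ j" using out[OF ab(1), of s] ab(2) by (auto simp: steps_def)
    have "\<beta> ^ k * (?G x * q b) \<le> ?c ^ j * (?G x * q b)"
      using \<beta>c[OF j(1)] G0 q0 by (intro mult_right_mono) auto
    also have "\<dots> \<le> max T (?G x * q x)" using key[OF j(2)] by (simp add: mult_ac)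
    finally show ?thesis using qA[OF A(2)] T0 by (simp add: mult_ac)
  qed
  have \<beta>1: "\<beta> \<le> 1" using \<beta> c by linarith
  have Gx: "(1 - r) * ?G x \<le> T"
    using T_ge[OF A(2)] aq0[of x] r G0(1)[of x] by (simp add: algebra_simps)
      (smt (verit) mult_nonneg_nonneg)
  \<comment> \<open>In the new environment the escape probability from \<open>a\<close> is an
    average of values of \<open>q\<close> next to A, which \<open>qb\<close> controls; the term 1 -
    r is controlled by \<open>Gx\<close>. Hence the 2.\<close>
  have e': "\<beta> ^ k * ?G x * ((1 - r) + r * avg \<omega>' q a) \<le> 2 * T" if "a \<in> A" for a
  proof -
    have "\<beta> ^ k * ?G x * avg \<omega>' q a = (\<Sum>s\<in>UNIV. \<omega>' a $ s * (\<beta> ^ k * ?G x * q (a + nbr s)))"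
      by (simp add: avg_def sum_distrib_left mult_ac)
    also have "\<dots> \<le> (\<Sum>s\<in>UNIV. \<omega>' a $ s * T)"
      using pv(2) qb[OF that refl] by (intro sum_mono mult_left_mono) (auto simp: prob_vectors_def)
    also have "\<dots> = T" using pv(2) by (simp add: prob_vectors_def flip: sum_distrib_right)
    finally have 1: "\<beta> ^ k * ?G x * avg \<omega>' q a \<le> T" .
    have "r * (\<beta> ^ k * ?G x * avg \<omega>' q a) \<le> r * T" using r 1 by (intro mult_left_mono)
    also have "\<dots> \<le> T" using r T0 by (simp add: mult_left_le_one_le)
    finally have 2: "r * (\<beta> ^ k * ?G x * avg \<omega>' q a) \<le> T" .
    have "\<beta> ^ k * ((1 - r) * ?G x) \<le> 1 * ((1 - r) * ?G x)"
      using \<beta> \<beta>1 r G0 by (intro mult_right_mono power_le_one) auto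
    then show ?thesis using 2 Gx by (simp add: algebra_simps)
  qed
  \<comment> \<open>The decomposition of T in the new environment is multiplied by the old Green
    function at x, so that T occurs on both sides and cancels.\<close>
  have "\<beta> ^ k * ?G x * T = (\<Sum>a\<in>A. ?G' a * (\<beta> ^ k * ?G x * ((1 - r) + r * avg \<omega>' q a)))"
    unfolding T' by (simp add: sum_distrib_left mult_ac)
  also have "\<dots> \<le> (\<Sum>a\<in>A. ?G' a * (2 * T))"
    using e' G0(2) by (intro sum_mono mult_left_mono) auto
  finally have main: "\<beta> ^ k * ?G x * T \<le> (\<Sum>a\<in>A. ?G' a) * 2 * T" by (simp add: sum_distrib_left sum_distrib_right mult_ac)
  have sumG': "\<beta> ^ k * (\<Sum>a\<in>A. ?G' a) \<le> card A * ?G' x"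
  proof -
    have "\<beta> ^ k * ?G' a \<le> ?G' x" if aA: "a \<in> A" for a
    proof -
      obtain j where j: "j \<le> k" "(a, x) \<in> E ^^ j" using into[OF aA] by (auto simp: steps_def)
      have "\<beta> ^ k * ?G' a \<le> ?c ^ j * ?G' a" using \<beta>c[OF j(1)] G0 by (intro mult_right_mono) auto
      also have "\<dots> \<le> ?G' x" by (rule green_steps[OF pv(2) r \<alpha>(1) E(2) j(2)])
      finally show ?thesis .
    qed
    then show ?thesis unfolding sum_distrib_left using sum_bounded_above[of A "\<lambda>a. \<beta> ^ k * ?G' a" "?G' x"] by simp
  qed
  have "\<beta> ^ k * ?G x \<le> 2 * (\<Sum>a\<in>A. ?G' a)"
  \<comment> \<open>T may vanish, but then \<open>Gx\<close> makes the Green function at x vanish as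
    well.\<close>
  proof (cases "T = 0")
    case True
    then have "?G x \<le> 0" using Gx r by (simp add: mult_le_0_iff)
    then have "?G x = 0" using G0(1)[of x] by auto
    then show ?thesis using G0 by (auto intro!: mult_nonneg_nonneg sum_nonneg)
  next
    case False
    with T0 have "T > 0" by auto
    from mult_right_le_imp_le[OF main this] show ?thesis by simp
  qed
  then have "\<beta> ^ k * (\<beta> ^ k * ?G x) \<le> 2 * (\<beta> ^ k * (\<Sum>a\<in>A. ?G' a))"
    using mult_left_mono[of "\<beta> ^ k * ?G x" _ "\<beta> ^ k"] \<beta> by (simp add: algebra_simps)
  also have "\<dots> \<le> 2 * (card A * ?G' x)" using sumG' by simp
  finally have "?G x \<le> 2 * (card A * ?G' x) / (\<beta> ^ k * \<beta> ^ k)"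
    using \<beta> by (simp add: field_simps)
  moreover have "(1 / \<beta>) ^ (2 * k) = 1 / (\<beta> ^ k * \<beta> ^ k)"
    by (simp add: power_divide mult_2 power_add)
  ultimately show ?thesis by simp
qed

section \<open>Connectivity among sparse bad sites\<close>

definition axis_of :: "'d + 'd \<Rightarrow> 'd" where
  "axis_of s = (case s of Inl j \<Rightarrow> j | Inr j \<Rightarrow> j)"

definition orientation :: "'d + 'd \<Rightarrow> int" where
  "orientation s = (case s of Inl j \<Rightarrow> 1 | Inr j \<Rightarrow> -1)"

definition opposite :: "'d + 'd \<Rightarrow> 'd + 'd" where
  "opposite s = (case s of Inl j \<Rightarrow> Inr j | Inr j \<Rightarrow> Inl j)"

lemma nbr_nth: "nbr s $ j = (if j = axis_of s then orientation s else 0)"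
  by (cases s) (auto simp: nbr_def axis_of_def orientation_def axis_def)

lemma axis_of_opposite [simp]: "axis_of (opposite s) = axis_of s"
  and orientation_opposite [simp]: "orientation (opposite s) = - orientation s"
  and orientation_square [simp]: "orientation s * orientation s = 1"
  by (cases s; simp add: axis_of_def opposite_def orientation_def)+

lemma orientation_cases: "orientation s = 1 \<or> orientation s = -1"
  by (cases s) (simp_all add: orientation_def)

definition cube :: "int ^ 'd \<Rightarrow> nat \<Rightarrow> (int ^ 'd) set" where
  "cube x R = {y. \<forall>j. \<bar>y $ j - x $ j\<bar> \<le> int R}"

lemma cube_mono: "R \<le> R' \<Longrightarrow> cube x R \<subseteq> cube x R'"
  unfolding cube_def by (auto intro: order_trans)

lemma finite_cube: "finite (cube (x :: int ^ 'd::finite) R)"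
  and card_cube_le: "card (cube (x :: int ^ 'd::finite) R) \<le> (2 * R + 1) ^ CARD('d)"
proof -
  let ?F = "\<Pi>\<^sub>E j\<in>UNIV. {x $ j - int R .. x $ j + int R}"
  have abs: "\<bar>a - b\<bar> \<le> c \<longleftrightarrow> b - c \<le> a \<and> a \<le> b + c" for a b c :: int by auto
  have "cube x R = vec_lambda ` ?F"
  proof (intro equalityI subsetI)
    fix y assume "y \<in> cube x R"
    then show "y \<in> vec_lambda ` ?F"
      by (intro image_eqI[of _ _ "($) y"]) (auto simp: cube_def abs)
  next
    fix y assume "y \<in> vec_lambda ` ?F"
    then show "y \<in> cube x R" by (auto simp: cube_def abs PiE_iff)
  qed
  moreover have "finite ?F" by (intro finite_PiE) auto
  moreover have "card ?F = (2 * R + 1) ^ CARD('d)" by (subst card_PiE) (auto simp: nat_add_distrib nat_mult_distrib)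
  ultimately show "finite (cube x R)" "card (cube x R) \<le> (2 * R + 1) ^ CARD('d)"
    using card_image_le[of ?F vec_lambda] by auto
qed

section \<open>Detours and the sets of sites that obstruct them\<close>

primrec two_step_path :: "nat set \<Rightarrow> 'd::finite + 'd \<Rightarrow> 'd + 'd \<Rightarrow> int ^ 'd \<Rightarrow> nat \<Rightarrow> int ^ 'd" where
  "two_step_path D t s y 0 = y"
| "two_step_path D t s y (Suc k) = two_step_path D t s y k + nbr (if k \<in> D then s else t)"

text \<open>Unlike \<open>two_step_path\<close>, this motion depends on the random set S. But it
  agrees with a \<open>two_step_path\<close> whose times D are those spent in S, so S matters only
  through a subset of finitely many times, and a union bound over D is possible.\<close>

primrec detour :: "(int ^ 'd) set \<Rightarrow> 'd::finite + 'd \<Rightarrow> 'd + 'd \<Rightarrow> int ^ 'd \<Rightarrow> nat \<Rightarrow> int ^ 'd" where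
  "detour S t s y 0 = y"
| "detour S t s y (Suc k) = detour S t s y k + nbr (if detour S t s y k \<in> S then s else t)"

lemma two_step_path_cube: "two_step_path D t s y k \<in> cube y k"
proof (induction k)
  case (Suc k)
  show ?case unfolding cube_def mem_Collect_eq
  proof
    fix j
    have "\<bar>two_step_path D t s y k $ j - y $ j\<bar> \<le> int k" using Suc by (simp add: cube_def)
    moreover have "\<bar>nbr (if k \<in> D then s else t) $ j\<bar> \<le> 1"
      using orientation_cases[of s] orientation_cases[of t] by (auto simp: nbr_nth)
    ultimately show "\<bar>two_step_path D t s y (Suc k) $ j - y $ j\<bar> \<le> int (Suc k)"
      by simp
  qed
qed (simp add: cube_def)

text \<open>As the axes differ, the sum of the two oriented coordinates grows by 1 with each step.
  So n marked times give n different sites, and by independence the n-th power of the probability of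
  a bad site.\<close>

lemma inj_two_step_path:
  assumes "axis_of t \<noteq> axis_of s"
  shows "inj (two_step_path D t s y)"
proof -
  let ?\<mu> = "\<lambda>z. orientation t * z $ axis_of t + orientation s * z $ axis_of s"
  have "?\<mu> (two_step_path D t s y k) = ?\<mu> y + int k" for k
    using assms by (induction k) (auto simp: nbr_nth algebra_simps)
  then show ?thesis by (intro injI) (metis add_left_cancel of_nat_eq_iff)
qed

lemma detour_eq_two_step_path:
  "k \<le> m \<Longrightarrow> detour S t s y k = two_step_path {i. i < m \<and> detour S t s y i \<in> S} t s y k"
  by (induction k) auto

text \<open>If a detour of M * n steps meets S at least n times, then S contains one of these sets.
  Coding them by paths is essential for counting: their number is exponential in n, whereas the
  number of all n-element subsets of the cube grows faster than exponentially in dimension at least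
  2.\<close>

definition witnesses :: "nat \<Rightarrow> nat \<Rightarrow> int ^ 'd::finite \<Rightarrow> (int ^ 'd) set set" where
  "witnesses M n x = (\<lambda>(y, t, s, D). two_step_path D t s y ` D) `
     {(y, t, s, D). y \<in> cube x (M * n) \<and> axis_of t \<noteq> axis_of s \<and> D \<subseteq> {..<M * n} \<and> n \<le> card D}"

lemma witnesses_finite: "finite (witnesses M n (x :: int ^ 'd::finite))"
  and card_witnesses_le:
    "card (witnesses M n x) \<le> (2 * (M * n) + 1) ^ CARD('d) * (2 * CARD('d)) ^ 2 * 2 ^ (M * n)"
proof -
  let ?I = "{(y, t :: 'd + 'd, s, D). y \<in> cube x (M * n) \<and> axis_of t \<noteq> axis_of s \<and> D \<subseteq> {..<M * n} \<and> n \<le> card D}"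
  let ?J = "cube x (M * n) \<times> (UNIV :: ('d + 'd) set) \<times> (UNIV :: ('d + 'd) set) \<times> Pow {..<M * n}"
  have sub: "?I \<subseteq> ?J" by auto
  have fin: "finite ?J" by (intro finite_cartesian_product finite_cube) auto
  show "finite (witnesses M n x)"
    unfolding witnesses_def by (intro finite_imageI finite_subset[OF sub fin])
  have "card (witnesses M n x) \<le> card ?I"
    unfolding witnesses_def by (intro card_image_le finite_subset[OF sub fin])
  also have "\<dots> \<le> card ?J" by (intro card_mono sub fin)
  also have "\<dots> = card (cube x (M * n)) * (2 * CARD('d)) ^ 2 * 2 ^ (M * n)"
    by (simp add: card_cartesian_product card_Pow power2_eq_square algebra_simps)
  also have "\<dots> \<le> (2 * (M * n) + 1) ^ CARD('d) * (2 * CARD('d)) ^ 2 * 2 ^ (M * n)"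
    by (intro mult_right_mono card_cube_le) auto
  finally show "card (witnesses M n x) \<le> \<dots>" .
qed

lemma witnesses_props:
  assumes "Z \<in> witnesses M n x"
  shows "finite Z" "n \<le> card Z" "card Z \<le> M * n" "Z \<subseteq> cube x (2 * (M * n))"
proof -
  obtain y t s D where Z: "Z = two_step_path D t s y ` D" and y: "y \<in> cube x (M * n)"
    and ts: "axis_of t \<noteq> axis_of s" and D: "D \<subseteq> {..<M * n}" "n \<le> card D"
    using assms by (auto simp: witnesses_def)
  have fin: "finite D" using D(1) by (rule finite_subset) simp
  have card: "card Z = card D"
    unfolding Z by (intro card_image inj_on_subset[OF inj_two_step_path[OF ts]]) simp
  show "finite Z" using fin Z by simp
  show "n \<le> card Z" "card Z \<le> M * n" using card D card_mono[OF _ D(1)] by auto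
  show "Z \<subseteq> cube x (2 * (M * n))"
  proof
    fix z assume "z \<in> Z"
    then obtain k where k: "k < M * n" "z = two_step_path D t s y k" using Z D by auto
    show "z \<in> cube x (2 * (M * n))" unfolding cube_def mem_Collect_eq
    proof
      fix j
      have "\<bar>z $ j - y $ j\<bar> \<le> int k" using two_step_path_cube[of D t s y k] k(2) by (simp add: cube_def)
      moreover have "\<bar>y $ j - x $ j\<bar> \<le> int (M * n)" using y by (simp add: cube_def)
      ultimately show "\<bar>z $ j - x $ j\<bar> \<le> int (2 * (M * n))" using k(1) by linarith
    qed
  qed
qed

definition sparsely_bad :: "nat \<Rightarrow> nat \<Rightarrow> int ^ 'd::finite \<Rightarrow> (int ^ 'd) set \<Rightarrow> bool" where
  "sparsely_bad M n x S \<longleftrightarrow> (\<forall>Z\<in>witnesses M n x. \<not> Z \<subseteq> S)"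

lemma sparsely_bad_detour:
  assumes "sparsely_bad M n x S" "y \<in> cube x (M * n)" "axis_of t \<noteq> axis_of s"
  shows "card {k. k < M * n \<and> detour S t s y k \<in> S} < n"
proof (rule ccontr)
  let ?D = "{k. k < M * n \<and> detour S t s y k \<in> S}"
  assume "\<not> ?thesis"
  then have "two_step_path ?D t s y ` ?D \<in> witnesses M n x"
    using assms(2,3) unfolding witnesses_def by (intro image_eqI[of _ _ "(y, t, s, ?D)"]) auto
  moreover have "two_step_path ?D t s y ` ?D \<subseteq> S"
    using detour_eq_two_step_path[of _ "M * n" S t s y] by auto
  ultimately show False using assms(1) unfolding sparsely_bad_def by blast
qed

definition moves :: "'d::finite + 'd \<Rightarrow> 'd + 'd \<Rightarrow> (int ^ 'd) set \<Rightarrow> (int ^ 'd) rel" where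
  "moves s1 s2 S = {(a, b). b = a + nbr s1 \<or> b = a + nbr s2 \<or> a \<notin> S \<and> (\<exists>s. b = a + nbr s)}"

lemma detour_moves:
  assumes "s \<in> {s1, s2}"
  shows "(y, detour S t s y k) \<in> moves s1 s2 S ^^ k"
proof (induction k)
  case (Suc k)
  have "(detour S t s y k, detour S t s y (Suc k)) \<in> moves s1 s2 S"
    using assms by (auto simp: moves_def)
  with Suc show ?case by (auto simp del: detour.simps)
qed simp

text \<open>The number of steps t grows by 0 or 1 at a time and is at least m - (n - 1) after m
  steps, so it equals N at some time up to m. Thus the displacement along t can be prescribed
  exactly, and only the number j of detour steps remains uncontrolled.\<close>

lemma detour_run:
  assumes few: "card {k. k < m \<and> detour S t s y k \<in> S} < n" and m: "N + n \<le> m + 1" and s: "s \<in> {s1, s2}"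
  obtains j where "j < n" "(y, y + int N *s nbr t + int j *s nbr s) \<in> moves s1 s2 S ^^ (N + j)"
proof -
  define c where "c k = card {i. i < k \<and> detour S t s y i \<in> S}" for k
  have c_Suc: "c (Suc k) = (if detour S t s y k \<in> S then Suc (c k) else c k)" for k
  proof -
    have "{i. i < Suc k \<and> detour S t s y i \<in> S} =
        (if detour S t s y k \<in> S then insert k {i. i < k \<and> detour S t s y i \<in> S} else {i. i < k \<and> detour S t s y i \<in> S})"
      by (auto simp: less_Suc_eq)
    then show ?thesis by (simp add: c_def)
  qed
  have c0: "c 0 = 0" by (simp add: c_def)
  have form: "detour S t s y k = y + (int k - int (c k)) *s nbr t + int (c k) *s nbr s" for k
    by (induction k) (auto simp: c0 c_Suc vec_eq_iff algebra_simps)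
  have "\<exists>k\<le>m. int k - int (c k) = int N"
  proof (rule nat0_intermed_int_val)
    show "\<forall>i<m. \<bar>int (i + 1) - int (c (i + 1)) - (int i - int (c i))\<bar> \<le> 1" by (auto simp: c_Suc)
    show "int N \<le> int m - int (c m)" using few m by (simp add: c_def)
  qed (simp add: c0)
  then obtain k where k: "k \<le> m" "int k - int (c k) = int N" by blast
  have "c k \<le> c m" unfolding c_def using k(1) by (intro card_mono) auto
  then have "c k < n" using few by (simp add: c_def)
  moreover have "N + c k = k" using k(2) by linarith
  moreover have "detour S t s y k = y + int N *s nbr t + int (c k) *s nbr s" using form[of k] k(2) by simp
  ultimately show thesis
    using detour_moves[OF s, of y S t k] that[of "c k"] by simp
qed

lemma free_moves:
  assumes "s \<in> {s1, s2}"
  shows "(y, y + int j *s nbr s) \<in> moves s1 s2 S ^^ j"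
proof (induction j)
  case (Suc j)
  have "(y + int j *s nbr s, y + int (Suc j) *s nbr s) \<in> moves s1 s2 S"
    using assms by (auto simp: moves_def vec_eq_iff algebra_simps)
  with Suc show ?case by auto
qed (simp add: vec_eq_iff)

lemma cube_intro:
  assumes "\<And>j. \<bar>y $ j - x $ j\<bar> \<le> int R"
  shows "y \<in> cube x R"
  using assms by (simp add: cube_def)

text \<open>The walk can move in any direction as long as it meets no site of \<open>S\<close>, and gets past a
  site of \<open>S\<close> by a step \<open>s1\<close> or \<open>s2\<close>, which is possible everywhere.  The steps \<open>s1\<close> serve as
  detours for all directions but the one opposite to \<open>s1\<close>, for which \<open>s2\<close> is needed.\<close>

lemma sparsely_bad_connected:
  fixes x :: "int ^ 'd::finite"
  assumes sparsely_bad: "sparsely_bad M n x S" and M: "M = CARD('d) + 4" and s12: "axis_of s1 \<noteq> axis_of s2"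
    and a: "a \<in> cube x n" and z: "z \<in> cube x n"
  shows "steps (moves s1 s2 S) ((4 * CARD('d) + 12) * n) a z"
proof -
  let ?E = "moves s1 s2 S" and ?d = "CARD('d)"
  let ?i1 = "axis_of s1" and ?i2 = "axis_of s2"
  let ?h1 = "\<lambda>z::int^'d. orientation s1 * z $ ?i1" and ?h2 = "\<lambda>z::int^'d. orientation s2 * z $ ?i2"
  have run: thesis if "y \<in> cube x (M * n)" "axis_of t \<noteq> axis_of s" "N + n \<le> M * n + 1" "s \<in> {s1, s2}"
    "\<And>j. j < n \<Longrightarrow> (y, y + int N *s nbr t + int j *s nbr s) \<in> ?E ^^ (N + j) \<Longrightarrow> thesis" for y t s N thesis
    using detour_run[OF sparsely_bad_detour[OF sparsely_bad that(1,2)] that(3,4)] that(5) by blast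
  have az: "\<bar>a $ j - x $ j\<bar> \<le> int n" "\<bar>z $ j - x $ j\<bar> \<le> int n" for j using a z by (auto simp: cube_def)
  have h_az: "\<bar>?h1 a - ?h1 z\<bar> \<le> 2 * int n" "\<bar>?h2 a - ?h2 z\<bar> \<le> 2 * int n"
    using az[of ?i1] az[of ?i2] orientation_cases[of s1] orientation_cases[of s2] by auto
  \<comment> \<open>The coordinates other than those of s1 and s2 are corrected one by one, each
    with at most 2 * n proper steps and fewer than n detour steps s1. The rise of the s1-height that
    results is undone only afterwards.\<close>
  have lateral: "\<exists>y k. k \<le> card I * (3 * n) \<and> (a, y) \<in> ?E ^^ k \<and> (\<forall>i\<in>I. y $ i = z $ i) \<and>
      (\<forall>i. i \<notin> I \<longrightarrow> i \<noteq> ?i1 \<longrightarrow> y $ i = a $ i) \<and> ?h1 a \<le> ?h1 y \<and> ?h1 y \<le> ?h1 a + int (card I * n)"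
    if "I \<subseteq> UNIV - {?i1, ?i2}" for I
    using finite[of I] that
  proof (induction I rule: finite_induct)
    case (insert i I)
    then obtain y k where k: "k \<le> card I * (3 * n)" "(a, y) \<in> ?E ^^ k"
      and y: "\<forall>i\<in>I. y $ i = z $ i" "\<forall>i. i \<notin> I \<longrightarrow> i \<noteq> ?i1 \<longrightarrow> y $ i = a $ i"
        "?h1 a \<le> ?h1 y" "?h1 y \<le> ?h1 a + int (card I * n)" by auto
    have i: "i \<noteq> ?i1" "i \<noteq> ?i2" "i \<notin> I" using insert by auto
    have cI: "card I \<le> ?d" by (rule card_mono) auto
    have ycube: "y \<in> cube x (M * n)"
    proof (rule cube_intro)
      fix j
      have cn: "card I * n + n \<le> M * n" using mult_right_mono[of "card I + 1" M n] cI M by simp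
      have n1: "n \<le> M * n" using M by simp
      show "\<bar>y $ j - x $ j\<bar> \<le> int (M * n)"
      proof (cases "j = ?i1")
        case True
        have "\<bar>y $ ?i1 - a $ ?i1\<bar> \<le> int (card I * n)"
          using y(3,4) orientation_cases[of s1] by auto
        then show ?thesis using az(1)[of ?i1] cn unfolding True by linarith
      next
        case False
        then have "y $ j = z $ j \<or> y $ j = a $ j" using y(1,2) by auto
        then have "\<bar>y $ j - x $ j\<bar> \<le> int n" using az[of j] by auto
        then show ?thesis using n1 by linarith
      qed
    qed
    define t where "t = (if y $ i \<le> z $ i then Inl i else Inr i)"
    define N where "N = nat \<bar>z $ i - y $ i\<bar>"
    have t: "axis_of t = i" "int N * orientation t = z $ i - y $ i"
      by (auto simp: t_def axis_of_def orientation_def N_def)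
    have "y $ i = a $ i" using y(2) i by auto
    then have N: "N \<le> 2 * n" using az[of i] by (auto simp: N_def)
    have m: "N + n \<le> M * n + 1" using N mult_right_mono[of 3 M n] M by linarith
    obtain j where j: "j < n" "(y, y + int N *s nbr t + int j *s nbr s1) \<in> ?E ^^ (N + j)"
      by (rule run[of y t s1 N, OF ycube _ m]) (use i t in auto)
    define y' where "y' = y + int N *s nbr t + int j *s nbr s1"
    have "(a, y') \<in> ?E ^^ (k + (N + j))" using k(2) j(2) by (auto simp: relpow_add y'_def)
    moreover have "k + (N + j) \<le> card (insert i I) * (3 * n)" using k(1) N j(1) insert(1,2) by simp
    moreover have y'_nth: "y' $ i' = (if i' = i then z $ i else if i' = ?i1 then y $ i' + int j * orientation s1 else y $ i')" for i'
      using i t by (auto simp: nbr_nth y'_def)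
    moreover have "?i1 \<notin> I" using insert(4) by auto
    moreover have "?h1 y' = ?h1 y + int j" using i by (simp add: y'_nth algebra_simps)
    ultimately show ?case
      using y i j(1) insert(1,2) by (intro exI[of _ y'] exI[of _ "k + (N + j)"]) (auto simp: algebra_simps)
  qed simp
  obtain y1 k1 where k1: "k1 \<le> card (UNIV - {?i1, ?i2}) * (3 * n)" "(a, y1) \<in> ?E ^^ k1"
    and y1: "\<forall>i\<in>UNIV - {?i1, ?i2}. y1 $ i = z $ i" "\<forall>i. i \<notin> UNIV - {?i1, ?i2} \<longrightarrow> i \<noteq> ?i1 \<longrightarrow> y1 $ i = a $ i"
        "?h1 a \<le> ?h1 y1" "?h1 y1 \<le> ?h1 a + int (card (UNIV - {?i1, ?i2}) * n)"
    using lateral[of "UNIV - {?i1, ?i2}"] by auto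
  define D where "D = card (UNIV - {?i1, ?i2})"
  have D: "D \<le> ?d" unfolding D_def by (rule card_mono) auto
  have y1': "\<And>i. i \<noteq> ?i1 \<Longrightarrow> i \<noteq> ?i2 \<Longrightarrow> y1 $ i = z $ i" "y1 $ ?i2 = a $ ?i2"
    "?h1 y1 \<le> ?h1 a + int (?d * n)"
  proof -
    have "int (D * n) \<le> int (?d * n)" using mult_right_mono[OF D, of n] by (simp del: of_nat_mult)
    then show "?h1 y1 \<le> ?h1 a + int (?d * n)" using y1(4) unfolding D_def[symmetric] by linarith
  qed (use y1 s12 in auto)
  \<comment> \<open>The run opposite to s1 is the longest one: d * n to undo the lateral detours, 2
    * n for the distance between \<open>a\<close> and \<open>z\<close>, n as a reserve for the run
    after it, and n for its own detours. This is the origin of M = d + 4.\<close>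
  have Mn: "M * n = ?d * n + 4 * n" using M by (simp add: algebra_simps)
  then have n1: "int n \<le> int (M * n)" by (simp del: of_nat_mult)
  \<comment> \<open>The target height lies n below that of \<open>z\<close>, because the next run
    raises the height again by up to n - 1 detour steps s1. By truncation there is no step at all if
    the height is low enough already.\<close>
  define N1 where "N1 = nat (?h1 y1 - ?h1 z + int n)"
  have N1: "N1 \<le> ?d * n + 3 * n" using y1'(3) h_az unfolding N1_def by linarith
  have "y1 \<in> cube x (M * n)"
  proof (rule cube_intro)
    fix j
    show "\<bar>y1 $ j - x $ j\<bar> \<le> int (M * n)"
    proof (cases "j = ?i1")
      case True
      have "\<bar>y1 $ ?i1 - a $ ?i1\<bar> \<le> int (?d * n)"
        using y1(3) y1'(3) orientation_cases[of s1] by auto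
      then show ?thesis using az(1)[of ?i1] unfolding True Mn by linarith
    next
      case False
      then have "y1 $ j = z $ j \<or> y1 $ j = a $ j" using y1'(1)[of j] y1'(2) by (cases "j = ?i2") auto
      then have "\<bar>y1 $ j - x $ j\<bar> \<le> int n" using az[of j] by auto
      then show ?thesis using n1 by linarith
    qed
  qed
  then obtain j1 where j1: "j1 < n" "(y1, y1 + int N1 *s nbr (opposite s1) + int j1 *s nbr s2) \<in> ?E ^^ (N1 + j1)"
    by (rule run[of y1 "opposite s1" s2 N1]) (use N1 s12 in \<open>auto simp: Mn\<close>)
  define y2 where "y2 = y1 + int N1 *s nbr (opposite s1) + int j1 *s nbr s2"
  have y2: "\<And>i. i \<noteq> ?i1 \<Longrightarrow> i \<noteq> ?i2 \<Longrightarrow> y2 $ i = z $ i" "?h2 y2 = ?h2 a + int j1" "?h1 y2 = ?h1 y1 - int N1"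
    using y1' s12 by (auto simp: y2_def nbr_nth algebra_simps)
  have y2h: "?h1 y2 \<le> ?h1 z - int n" "?h1 z - 2 * int n \<le> ?h1 y2"
    using h_az y1(3) unfolding y2(3) N1_def by linarith+
  define N2 where "N2 = nat (?h2 y2 - ?h2 z)"
  have N2: "N2 \<le> 3 * n" using y2(2) h_az j1(1) unfolding N2_def by linarith
  have "y2 \<in> cube x (M * n)"
  proof (rule cube_intro)
    fix j
    show "\<bar>y2 $ j - x $ j\<bar> \<le> int (M * n)"
    proof (cases "j = ?i1")
      case True
      have "\<bar>y2 $ ?i1 - z $ ?i1\<bar> \<le> 2 * int n"
        using y2h orientation_cases[of s1] by auto
      then show ?thesis using az(2)[of ?i1] unfolding True Mn by linarith
    next
      case F: False
      show ?thesis
      proof (cases "j = ?i2")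
        case True
        have "\<bar>y2 $ ?i2 - a $ ?i2\<bar> \<le> int n"
          using y2(2) j1 orientation_cases[of s2] by auto
        then show ?thesis using az(1)[of ?i2] unfolding True Mn by linarith
      next
        case False
        then have "\<bar>y2 $ j - x $ j\<bar> \<le> int n" using az[of j] F y2(1) by auto
        then show ?thesis using n1 by linarith
      qed
    qed
  qed
  then obtain j2 where j2: "j2 < n" "(y2, y2 + int N2 *s nbr (opposite s2) + int j2 *s nbr s1) \<in> ?E ^^ (N2 + j2)"
    by (rule run[of y2 "opposite s2" s1 N2]) (use N2 s12 in \<open>auto simp: Mn\<close>)
  define y3 where "y3 = y2 + int N2 *s nbr (opposite s2) + int j2 *s nbr s1"
  have y3: "\<And>i. i \<noteq> ?i1 \<Longrightarrow> i \<noteq> ?i2 \<Longrightarrow> y3 $ i = z $ i" "?h2 y3 = ?h2 y2 - int N2" "?h1 y3 = ?h1 y2 + int j2"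
    using y2 s12 by (auto simp: y3_def nbr_nth algebra_simps)
  \<comment> \<open>Both heights are now at most those of \<open>z\<close>, and the steps s1 and s2
    are possible everywhere, so the remaining way needs no detours.\<close>
  define p q where "p = nat (?h1 z - ?h1 y3)" and "q = nat (?h2 z - ?h2 y3)"
  have p: "int p = ?h1 z - ?h1 y3" "p \<le> 2 * n" using y2h j2 unfolding p_def y3(3) by linarith+
  have q: "int q = ?h2 z - ?h2 y3" "q \<le> 2 * n"
    using h_az y2(2) unfolding q_def y3(2) N2_def by linarith+
  have "(y3, y3 + int p *s nbr s1) \<in> ?E ^^ p" by (rule free_moves) simp
  moreover have "(y3 + int p *s nbr s1, y3 + int p *s nbr s1 + int q *s nbr s2) \<in> ?E ^^ q" by (rule free_moves) simp
  moreover have "y3 + int p *s nbr s1 + int q *s nbr s2 = z"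
    unfolding vec_eq_iff
  proof
    fix i
    show "(y3 + int p *s nbr s1 + int q *s nbr s2) $ i = z $ i"
      using p(1) q(1) y3(1)[of i] s12 orientation_cases[of s1] orientation_cases[of s2]
      by (auto simp: nbr_nth)
  qed
  ultimately have "(y3, z) \<in> ?E ^^ (p + q)" by (auto simp: relpow_add)
  with j2(2) have "(y2, z) \<in> ?E ^^ ((N2 + j2) + (p + q))" unfolding y3_def[symmetric] by (auto simp: relpow_add)
  with j1(2) have "(y1, z) \<in> ?E ^^ ((N1 + j1) + ((N2 + j2) + (p + q)))" unfolding y2_def[symmetric] by (auto simp: relpow_add)
  with k1(2) have "(a, z) \<in> ?E ^^ (k1 + ((N1 + j1) + ((N2 + j2) + (p + q))))" by (auto simp: relpow_add)
  \<comment> \<open>The budget: 3 * d * n for the lateral runs, (d + 4) * n and 4 * n for the two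
    descents, and 4 * n for the final ascent.\<close>
  moreover have "k1 \<le> ?d * (3 * n)"
    using k1(1) mult_right_mono[OF D, of "3 * n"] unfolding D_def[symmetric] by linarith
  then have "k1 + ((N1 + j1) + ((N2 + j2) + (p + q))) \<le> (4 * ?d + 12) * n"
    using N1 N2 p(2) q(2) j1(1) j2(1) by (simp add: algebra_simps)
  ultimately show ?thesis unfolding steps_def by blast
qed

section \<open>Green functions at bad sites\<close>

lemma nn_integral_env_law_split:
  assumes "prob_space \<nu>" and f: "f \<in> borel_measurable (env_law \<nu>)"
  shows "(\<integral>\<^sup>+\<omega>. f \<omega> \<partial>env_law \<nu>) = (\<integral>\<^sup>+p. (\<integral>\<^sup>+\<omega>. f (fun_upd \<omega> a p) \<partial>env_law \<nu>) \<partial>\<nu>)"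
proof -
  interpret prob_space \<nu> by fact
  interpret E: prob_space "env_law \<nu>" unfolding env_law_def by (intro prob_space_PiM prob_space_axioms)
  have "distr (\<nu> \<Otimes>\<^sub>M env_law \<nu>) (env_law \<nu>) (\<lambda>(x, X). X(a := x)) = env_law \<nu>"
    using distr_pair_PiM_eq_PiM[of UNIV "\<lambda>_. \<nu>" a] by (simp add: env_law_def prob_space_axioms)
  then have "(\<integral>\<^sup>+\<omega>. f \<omega> \<partial>env_law \<nu>) = (\<integral>\<^sup>+\<omega>. f \<omega> \<partial>distr (\<nu> \<Otimes>\<^sub>M env_law \<nu>) (env_law \<nu>) (\<lambda>(x, X). X(a := x)))"
    by simp
  also have "\<dots> = (\<integral>\<^sup>+(p, \<omega>). f (fun_upd \<omega> a p) \<partial>(\<nu> \<Otimes>\<^sub>M env_law \<nu>))"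
  proof (subst nn_integral_distr)
    have "(\<lambda>(x, X). X(a := x)) \<in> \<nu> \<Otimes>\<^sub>M env_law \<nu> \<rightarrow>\<^sub>M env_law \<nu>"
      unfolding env_law_def by (simp add: case_prod_beta', rule measurable_fun_upd[where J = UNIV]) auto
    then show "(\<lambda>(x, X). X(a := x)) \<in> \<nu> \<Otimes>\<^sub>M env_law \<nu> \<rightarrow>\<^sub>M env_law \<nu>" .
  qed (use f in \<open>auto simp: case_prod_beta'\<close>)
  also have "\<dots> = (\<integral>\<^sup>+p. (\<integral>\<^sup>+\<omega>. f (fun_upd \<omega> a p) \<partial>env_law \<nu>) \<partial>\<nu>)"
  proof (subst E.nn_integral_fst[symmetric])
    have "(\<lambda>(x, X). X(a := x)) \<in> \<nu> \<Otimes>\<^sub>M env_law \<nu> \<rightarrow>\<^sub>M env_law \<nu>"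
      unfolding env_law_def by (simp add: case_prod_beta', rule measurable_fun_upd[where J = UNIV]) auto
    from measurable_compose[OF this f]
    show "(\<lambda>(p, \<omega>). f (fun_upd \<omega> a p)) \<in> borel_measurable (\<nu> \<Otimes>\<^sub>M env_law \<nu>)"
      by (simp add: case_prod_beta')
  qed simp
  finally show ?thesis .
qed

lemma sets_env_law_coordinates:
  assumes "finite A" "S \<in> sets \<nu>"
  shows "{\<omega> \<in> space (env_law \<nu>). \<forall>a\<in>A. \<omega> a \<in> S} \<in> sets (env_law \<nu>)"
proof -
  have "{\<omega> \<in> space (env_law \<nu>). \<omega> a \<in> S} \<in> sets (env_law \<nu>)" for a
    using measurable_sets[OF measurable_component_singleton[of a UNIV "\<lambda>_. \<nu>"] assms(2)]
    by (simp add: env_law_def vimage_def Int_def conj_commute)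
  then show ?thesis using assms(1) by (intro sets.sets_Collect_finite_All) auto
qed

text \<open>Resampling a site of A leaves H unchanged and splits off one factor of the product
  event. Doing this for one site after the other gives independence without decomposing the infinite
  product.\<close>

lemma nn_integral_env_law_indep:
  assumes "prob_space \<nu>" and "finite A" and S: "S \<in> sets \<nu>" and H: "H \<in> borel_measurable (env_law \<nu>)"
    and inv: "\<And>a \<omega> p. a \<in> A \<Longrightarrow> \<omega> \<in> space (env_law \<nu>) \<Longrightarrow> p \<in> space \<nu> \<Longrightarrow> H (fun_upd \<omega> a p) = H \<omega>"
  shows "(\<integral>\<^sup>+\<omega>. indicator {\<omega>. \<forall>a\<in>A. \<omega> a \<in> S} \<omega> * H \<omega> \<partial>env_law \<nu>) =
    emeasure \<nu> S ^ card A * (\<integral>\<^sup>+\<omega>. H \<omega> \<partial>env_law \<nu>)"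
  using \<open>finite A\<close> inv
proof (induction A rule: finite_induct)
  case empty
  then show ?case by simp
next
  case (insert a A)
  interpret prob_space \<nu> by fact
  interpret E: prob_space "env_law \<nu>" unfolding env_law_def by (intro prob_space_PiM prob_space_axioms)
  let ?K = "\<lambda>B \<omega>. indicator {\<omega>. \<forall>a\<in>B. \<omega> a \<in> S} \<omega> * H \<omega>"
  have meas: "?K B \<in> borel_measurable (env_law \<nu>)" if "finite B" for B
  proof -
    have "(\<lambda>\<omega>. indicator {\<omega> \<in> space (env_law \<nu>). \<forall>a\<in>B. \<omega> a \<in> S} \<omega> * H \<omega>) \<in> borel_measurable (env_law \<nu>)"
      by (intro borel_measurable_times_ennreal borel_measurable_indicator sets_env_law_coordinates that S H)
    then show ?thesis by (rule measurable_cong[THEN iffD1, rotated]) (auto simp: indicator_def)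
  qed
  have upd: "fun_upd \<omega> a p \<in> space (env_law \<nu>)" if "\<omega> \<in> space (env_law \<nu>)" "p \<in> space \<nu>" for \<omega> p
    using that by (auto simp: env_law_def space_PiM PiE_iff)
  have "(\<integral>\<^sup>+\<omega>. ?K (insert a A) \<omega> \<partial>env_law \<nu>) = (\<integral>\<^sup>+p. (\<integral>\<^sup>+\<omega>. ?K (insert a A) (fun_upd \<omega> a p) \<partial>env_law \<nu>) \<partial>\<nu>)"
    by (rule nn_integral_env_law_split[OF assms(1) meas]) (use insert in auto)
  also have "\<dots> = (\<integral>\<^sup>+p. (\<integral>\<^sup>+\<omega>. indicator S p * ?K A \<omega> \<partial>env_law \<nu>) \<partial>\<nu>)"
  proof (intro nn_integral_cong)
    fix p \<omega> assume p: "p \<in> space \<nu>" and \<omega>: "\<omega> \<in> space (env_law \<nu>)"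
    have "H (fun_upd \<omega> a p) = H \<omega>" by (rule insert.prems) (auto simp: p \<omega>)
    moreover have "(\<forall>b\<in>insert a A. (fun_upd \<omega> a p) b \<in> S) \<longleftrightarrow> p \<in> S \<and> (\<forall>b\<in>A. \<omega> b \<in> S)"
      using insert(2) by auto
    ultimately show "?K (insert a A) (fun_upd \<omega> a p) = indicator S p * ?K A \<omega>"
      by (simp only: indicator_def mem_Collect_eq) auto
  qed
  also have "\<dots> = (\<integral>\<^sup>+p. indicator S p * (\<integral>\<^sup>+\<omega>. ?K A \<omega> \<partial>env_law \<nu>) \<partial>\<nu>)"
    by (intro nn_integral_cong nn_integral_cmult meas insert)
  also have "\<dots> = emeasure \<nu> S * (\<integral>\<^sup>+\<omega>. ?K A \<omega> \<partial>env_law \<nu>)"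
    by (subst nn_integral_multc) (use S in auto)
  also have "(\<integral>\<^sup>+\<omega>. ?K A \<omega> \<partial>env_law \<nu>) = emeasure \<nu> S ^ card A * (\<integral>\<^sup>+\<omega>. H \<omega> \<partial>env_law \<nu>)"
    by (rule insert.IH) (use insert.prems in auto)
  finally show ?case using insert(1,2) by (simp add: mult.assoc)
qed

text \<open>The bound of \<open>card_witnesses_le\<close> for M = d + 4 and n = 1; its n-th power
  dominates the bound for n.\<close>

definition entropy_const :: "nat \<Rightarrow> real" where
  "entropy_const d = (2 * (d + 4) + 1) ^ d * (2 * d) ^ 2 * 2 ^ (d + 4)"

text \<open>The factor of \<open>green_comparison\<close> at n = 1: a cluster with x has at most (d
  + 4) * n + 1 sites, \<beta> is \<alpha> / 2 because r \<ge> 1/2, and the number of steps is that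
  of \<open>sparsely_bad_connected\<close> at scale (2 * d + 9) * n.\<close>

definition modification_const :: "nat \<Rightarrow> real \<Rightarrow> real" where
  "modification_const d \<alpha> = 2 * (d + 5) * (2 / \<alpha>) ^ (2 * ((4 * d + 12) * (2 * d + 9)))"

text \<open>The square is due to the two exchanges of the environment in a cluster, and the 2 to the
  odds \<epsilon> / (1 - \<epsilon>) \<le> 2 * \<epsilon> of a bad against a good site.\<close>

definition cluster_const :: "nat \<Rightarrow> real \<Rightarrow> real" where
  "cluster_const d \<alpha> = 2 * entropy_const d * (modification_const d \<alpha>)\<^sup>2"

text \<open>Bernoulli's inequality. It absorbs linear prefactors into n-th powers, so that one
  constant serves all scales.\<close>

lemma affine_le_power: "a * n + 1 \<le> (a + 1) ^ n" for a n :: nat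
proof (induction n)
  case (Suc n)
  have "a * Suc n + 1 \<le> (a + 1) * (a * n + 1)" by (simp add: algebra_simps)
  also have "\<dots> \<le> (a + 1) * (a + 1) ^ n" by (intro mult_left_mono Suc) simp
  finally show ?case by simp
qed simp

lemma card_witnesses_le_power:
  assumes "n \<ge> 1"
  shows "real (card (witnesses (CARD('d) + 4) n (x :: int ^ 'd::finite))) \<le> entropy_const CARD('d) ^ n"
proof -
  let ?d = "CARD('d)"
  have "card (witnesses (?d + 4) n x) \<le> (2 * ((?d + 4) * n) + 1) ^ ?d * (2 * ?d) ^ 2 * 2 ^ ((?d + 4) * n)"
    by (rule card_witnesses_le)
  also have "\<dots> \<le> ((2 * (?d + 4) + 1) ^ n) ^ ?d * ((2 * ?d) ^ 2) ^ n * 2 ^ ((?d + 4) * n)"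
  proof (intro mult_right_mono mult_mono power_mono)
    show "2 * ((?d + 4) * n) + 1 \<le> (2 * (?d + 4) + 1) ^ n"
      using affine_le_power[of "2 * (?d + 4)" n] by (simp only: mult.assoc)
    show "(2 * ?d)\<^sup>2 \<le> ((2 * ?d)\<^sup>2) ^ n" using assms by (intro self_le_power) auto
  qed auto
  also have "\<dots> = ((2 * (?d + 4) + 1) ^ ?d * (2 * ?d) ^ 2 * 2 ^ (?d + 4)) ^ n"
    by (simp only: power_mult_distrib power_mult[symmetric] mult.commute)
  finally have "real (card (witnesses (?d + 4) n x)) \<le> real (((2 * (?d + 4) + 1) ^ ?d * (2 * ?d) ^ 2 * 2 ^ (?d + 4)) ^ n)"
    by (rule of_nat_mono)
  then show ?thesis by (simp add: entropy_const_def)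
qed

lemma modification_const_power:
  assumes "0 < \<alpha>" "\<alpha> \<le> 1" "n \<ge> 1"
  shows "2 * real ((d + 4) * n + 1) * (2 / \<alpha>) ^ (2 * ((4 * d + 12) * ((2 * d + 9) * n))) \<le> modification_const d \<alpha> ^ n"
proof -
  have "2 * real ((d + 4) * n + 1) \<le> 2 ^ n * real ((d + 4 + 1) ^ n)"
    using self_le_power[of 2 n] assms(3) affine_le_power[of "d + 4" n] by (intro mult_mono of_nat_mono) auto
  also have "\<dots> = (2 * real (d + 5)) ^ n" unfolding power_mult_distrib by (simp add: add.commute)
  finally have "2 * real ((d + 4) * n + 1) * (2 / \<alpha>) ^ (2 * ((4 * d + 12) * ((2 * d + 9) * n)))
      \<le> (2 * real (d + 5)) ^ n * (2 / \<alpha>) ^ (2 * ((4 * d + 12) * ((2 * d + 9) * n)))"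
    using assms by (intro mult_right_mono) auto
  also have "\<dots> = modification_const d \<alpha> ^ n"
    unfolding modification_const_def power_mult_distrib power_mult[symmetric] by (simp add: mult.assoc)
  finally show ?thesis .
qed

lemma modification_const_ge_1:
  assumes "0 < \<alpha>" "\<alpha> \<le> 1"
  shows "1 \<le> modification_const d \<alpha>"
proof -
  have "1 * 1 \<le> 2 * real (d + 5) * (2 / \<alpha>) ^ (2 * ((4 * d + 12) * (2 * d + 9)))"
    using assms by (intro mult_mono one_le_power) auto
  then show ?thesis by (simp add: modification_const_def)
qed

lemma cluster_const_nonneg: "0 < \<alpha> \<Longrightarrow> \<alpha> \<le> 1 \<Longrightarrow> 0 \<le> cluster_const d \<alpha>"
  by (simp add: cluster_const_def entropy_const_def)

lemma entropy_le_cluster_const: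
  assumes "0 < \<alpha>" "\<alpha> \<le> 1"
  shows "entropy_const d \<le> cluster_const d \<alpha>"
proof -
  have "entropy_const d * 1 \<le> entropy_const d * (2 * (modification_const d \<alpha>)\<^sup>2)"
    using one_le_power[OF modification_const_ge_1[OF assms], of d 2] by (intro mult_left_mono) (auto simp: entropy_const_def)
  then show ?thesis by (simp add: cluster_const_def)
qed

text \<open>\<open>Bad\<close> is any measurable set outside which all entries are at least
  \<alpha>; closeness to \<xi> is added in \<open>random_walk\<close>. The vector \<xi> serves as a
  deterministic good vector that can be put in place of others.\<close>

locale perturbed_environment = prob_space \<nu>
  for \<nu> :: "(real ^ ('d::finite + 'd)) measure" +
  fixes s1 s2 :: "'d + 'd" and \<alpha> :: real and Bad :: "(real ^ ('d + 'd)) set" and \<xi> :: "real ^ ('d + 'd)"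
  assumes component_measurable: "\<And>s. (\<lambda>p. p $ s) \<in> borel_measurable \<nu>"
    and prob_vector: "\<And>p s. p \<in> space \<nu> \<Longrightarrow> 0 \<le> p $ s" "\<And>p. p \<in> space \<nu> \<Longrightarrow> (\<Sum>s\<in>UNIV. p $ s) = 1"
    and elliptic: "\<And>p. p \<in> space \<nu> \<Longrightarrow> \<alpha> \<le> p $ s1" "\<And>p. p \<in> space \<nu> \<Longrightarrow> \<alpha> \<le> p $ s2"
    and axes: "axis_of s1 \<noteq> axis_of s2"
    and \<alpha>: "0 < \<alpha>" "\<alpha> \<le> 1"
    and Bad: "Bad \<in> sets \<nu>" and good: "\<And>p s. p \<in> space \<nu> \<Longrightarrow> p \<notin> Bad \<Longrightarrow> \<alpha> \<le> p $ s"
    and \<xi>: "\<xi> \<in> space \<nu>" "\<xi> \<notin> Bad"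
begin

abbreviation "EL \<equiv> env_law \<nu>"

sublocale E: prob_space EL
  unfolding env_law_def by (intro prob_space_PiM prob_space_axioms)

definition bad_sites :: "'d environment \<Rightarrow> (int ^ 'd) set" where
  "bad_sites \<omega> = {z. \<omega> z \<in> Bad}"

lemma space_EL: "\<omega> \<in> space EL \<longleftrightarrow> (\<forall>z. \<omega> z \<in> space \<nu>)"
  by (auto simp: env_law_def space_PiM PiE_iff)

lemma prob_vectors_EL: "\<omega> \<in> space EL \<Longrightarrow> prob_vectors \<omega>"
  by (auto simp: space_EL prob_vectors_def prob_vector)

text \<open>S may exceed the set of bad sites, so that a single set of moves is likely in both
  environments of a comparison.\<close>

lemma admissible_moves:
  "\<omega> \<in> space EL \<Longrightarrow> bad_sites \<omega> \<subseteq> S \<Longrightarrow> admissible \<omega> \<alpha> (moves s1 s2 S)"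
  unfolding admissible_def moves_def bad_sites_def space_EL
  using elliptic good by (auto; blast)

lemma coordinate_measurable [measurable]: "(\<lambda>\<omega>. \<omega> z $ s) \<in> borel_measurable EL"
  unfolding env_law_def
  by (rule measurable_compose[OF _ component_measurable]) (rule measurable_component_singleton, simp)

lemma avg_pow_measurable:
  assumes "\<And>y. (\<lambda>\<omega>. \<phi> \<omega> y) \<in> borel_measurable EL"
  shows "(\<lambda>\<omega>. (avg \<omega> ^^ n) (\<phi> \<omega>) x) \<in> borel_measurable EL"
proof (induction n arbitrary: x)
  case (Suc n)
  then show ?case unfolding funpow.simps o_def avg_def[of _ _ x] by measurable
qed (use assms in simp)

lemma resolvent_measurable:
  assumes "\<And>y. (\<lambda>\<omega>. \<phi> \<omega> y) \<in> borel_measurable EL"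
  shows "(\<lambda>\<omega>. resolvent \<omega> r (\<phi> \<omega>) x) \<in> borel_measurable EL"
  unfolding resolvent_def
  by (intro borel_measurable_suminf borel_measurable_times borel_measurable_const avg_pow_measurable assms)

lemma green_measurable: "(\<lambda>\<omega>. green \<omega> r x y) \<in> borel_measurable EL"
  unfolding green_def by (rule resolvent_measurable) simp

definition heal :: "(int ^ 'd) set \<Rightarrow> 'd environment \<Rightarrow> 'd environment" where
  "heal A \<omega> = (\<lambda>z. if z \<in> A then \<xi> else \<omega> z)"

lemma heal_measurable: "heal A \<in> EL \<rightarrow>\<^sub>M EL"
proof -
  have "(\<lambda>\<omega>. if z \<in> A then \<xi> else \<omega> z) \<in> EL \<rightarrow>\<^sub>M \<nu>" for z
    using \<xi>(1) measurable_component_singleton[of z UNIV "\<lambda>_. \<nu>"] by (auto simp: env_law_def)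
  then show ?thesis
    unfolding heal_def env_law_def by (intro measurable_PiM_single') (use \<xi>(1) in \<open>auto simp: env_law_def space_PiM PiE_iff\<close>)
qed

lemma heal_space: "\<omega> \<in> space EL \<Longrightarrow> heal A \<omega> \<in> space EL"
  using \<xi> by (auto simp: space_EL heal_def)

lemma sparsely_bad_measurable:
  "{\<omega> \<in> space EL. sparsely_bad M n x (bad_sites \<omega> \<union> A)} \<in> sets EL"
proof -
  have "{\<omega> \<in> space EL. \<not> Z \<subseteq> bad_sites \<omega> \<union> A} \<in> sets EL" if "Z \<in> witnesses M n x" for Z
  proof -
    have "{\<omega> \<in> space EL. \<forall>a\<in>Z - A. \<omega> a \<in> Bad} \<in> sets EL"
      using witnesses_props(1)[OF that] Bad by (intro sets_env_law_coordinates) auto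
    then have "space EL - {\<omega> \<in> space EL. \<forall>a\<in>Z - A. \<omega> a \<in> Bad} \<in> sets EL" by (rule sets.compl_sets)
    also have "space EL - {\<omega> \<in> space EL. \<forall>a\<in>Z - A. \<omega> a \<in> Bad} = {\<omega> \<in> space EL. \<not> Z \<subseteq> bad_sites \<omega> \<union> A}"
      by (auto simp: bad_sites_def)
    finally show ?thesis .
  qed
  then show ?thesis
    unfolding sparsely_bad_def using witnesses_finite by (intro sets.sets_Collect_finite_All) auto
qed


text \<open>In the maximum norm, A lies within distance (2 * d + 8) * n of x, hence A and its
  neighbours lie within (2 * d + 9) * n. Sparseness at that scale, with the sites of A counted as
  bad, yields paths that are likely in both environments.\<close>

lemma green_heal_comparison:
  assumes \<omega>: "\<omega> \<in> space EL" "\<omega>' \<in> space EL" "\<And>z. z \<notin> A \<Longrightarrow> \<omega> z = \<omega>' z"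
    and A: "finite A" "x \<in> A" "A \<subseteq> cube x (2 * ((CARD('d) + 4) * n))" and n: "n \<ge> 1"
    and sparse: "sparsely_bad (CARD('d) + 4) ((2 * CARD('d) + 9) * n) x (bad_sites \<omega> \<union> A)" and r: "1 / 2 \<le> r" "r < 1"
  shows "green \<omega> r x0 x \<le> 2 * card A * (2 / \<alpha>) ^ (2 * ((4 * CARD('d) + 12) * ((2 * CARD('d) + 9) * n))) * green \<omega>' r x0 x"
proof -
  let ?S = "bad_sites \<omega> \<union> A"
  have sub: "bad_sites \<omega> \<subseteq> ?S" "bad_sites \<omega>' \<subseteq> ?S" using \<omega>(3) by (auto simp: bad_sites_def)
  have A': "a \<in> cube x ((2 * CARD('d) + 9) * n)" "a + nbr s \<in> cube x ((2 * CARD('d) + 9) * n)" if "a \<in> A" for a s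
  proof -
    have a: "\<bar>a $ j - x $ j\<bar> \<le> int (2 * ((CARD('d) + 4) * n))" for j using that A(3) by (auto simp: cube_def)
    have *: "int (2 * ((CARD('d) + 4) * n)) + 1 \<le> int ((2 * CARD('d) + 9) * n)" using n by (simp add: algebra_simps)
    have nb: "\<bar>nbr s $ j\<bar> \<le> 1" for j using orientation_cases[of s] by (auto simp: nbr_nth)
    show "a \<in> cube x ((2 * CARD('d) + 9) * n)"
    proof (rule cube_intro)
      show "\<bar>a $ j - x $ j\<bar> \<le> int ((2 * CARD('d) + 9) * n)" for j using a[of j] * by linarith
    qed
    show "a + nbr s \<in> cube x ((2 * CARD('d) + 9) * n)"
    proof (rule cube_intro)
      fix j
      show "\<bar>(a + nbr s) $ j - x $ j\<bar> \<le> int ((2 * CARD('d) + 9) * n)"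
        using a[of j] nb[of j] * unfolding vector_add_component by linarith
    qed
  qed
  have x: "x \<in> cube x ((2 * CARD('d) + 9) * n)" by (simp add: cube_def)
  have "green \<omega> r x0 x \<le> 2 * card A * (1 / (\<alpha> / 2)) ^ (2 * ((4 * CARD('d) + 12) * ((2 * CARD('d) + 9) * n))) * green \<omega>' r x0 x"
  proof (rule green_comparison[OF prob_vectors_EL[OF \<omega>(1)] prob_vectors_EL[OF \<omega>(2)] \<omega>(3) A(1,2)])
    show "\<alpha> / 2 \<le> r * \<alpha>" using r \<alpha> by (simp add: mult_right_mono)
    show "admissible \<omega> \<alpha> (moves s1 s2 ?S)" "admissible \<omega>' \<alpha> (moves s1 s2 ?S)"
      by (intro admissible_moves \<omega> sub)+
    show "steps (moves s1 s2 ?S) ((4 * CARD('d) + 12) * ((2 * CARD('d) + 9) * n)) x (a + nbr s)" if "a \<in> A" for a s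
      by (rule sparsely_bad_connected[OF sparse refl axes x A'(2)[OF that]])
    show "steps (moves s1 s2 ?S) ((4 * CARD('d) + 12) * ((2 * CARD('d) + 9) * n)) a x" if "a \<in> A" for a
      by (rule sparsely_bad_connected[OF sparse refl axes A'(1)[OF that] x])
  qed (use \<alpha> r in auto)
  then show ?thesis by simp
qed

text \<open>The environment in \<open>A\<close> is replaced twice: first by \<open>\<xi>\<close>, which decouples the event that all
  sites of \<open>A\<close> are bad from the Green function, then by independent good vectors.\<close>

lemma bad_cluster_estimate:
  assumes Z: "Z \<in> witnesses (CARD('d) + 4) n x" and n: "n \<ge> 1" and r: "1 / 2 \<le> r" "r < 1"
    and w: "w \<in> borel_measurable EL" "\<And>\<omega>. \<omega> \<in> space EL \<Longrightarrow> 0 \<le> w \<omega>"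
    and inv: "\<And>a \<omega> p. a \<in> cube x ((2 * CARD('d) + 9) * n) \<Longrightarrow> \<omega> \<in> space EL \<Longrightarrow> p \<in> space \<nu> \<Longrightarrow> w (fun_upd \<omega> a p) = w \<omega>"
    and \<epsilon>: "emeasure \<nu> Bad \<le> ennreal \<epsilon>" "0 \<le> \<epsilon>" "\<epsilon> \<le> 1 / 2"
  shows "(\<integral>\<^sup>+\<omega>. ennreal (w \<omega> * green \<omega> r x0 x) * indicator {\<omega>. insert x Z \<subseteq> bad_sites \<omega> \<and> sparsely_bad (CARD('d) + 4) ((2 * CARD('d) + 9) * n) x (bad_sites \<omega>)} \<omega> \<partial>EL)
    \<le> ennreal ((2 * ((CARD('d) + 4) * n + 1) * (2 / \<alpha>) ^ (2 * ((4 * CARD('d) + 12) * ((2 * CARD('d) + 9) * n))))\<^sup>2 * (2 * \<epsilon>) ^ n)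
      * (\<integral>\<^sup>+\<omega>. ennreal (w \<omega> * green \<omega> r x0 x) \<partial>EL)"
proof -
  define A where "A = insert x Z"
  define \<Lambda> where "\<Lambda> = 2 * ((CARD('d) + 4) * n + 1) * (2 / \<alpha>) ^ (2 * ((4 * CARD('d) + 12) * ((2 * CARD('d) + 9) * n)))"
  note Zp = witnesses_props[OF Z]
  have A: "finite A" "x \<in> A" "A \<subseteq> cube x (2 * ((CARD('d) + 4) * n))" "n \<le> card A" "card A \<le> (CARD('d) + 4) * n + 1"
    using Zp by (auto simp: A_def cube_def card_insert_if)
  have AB: "A \<subseteq> cube x ((2 * CARD('d) + 9) * n)" using A(3) cube_mono[of "2 * ((CARD('d) + 4) * n)" "(2 * CARD('d) + 9) * n" x] by (auto simp: algebra_simps)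
  let ?S = "\<lambda>\<omega>. sparsely_bad (CARD('d) + 4) ((2 * CARD('d) + 9) * n) x (bad_sites \<omega> \<union> A)"
  \<comment> \<open>The indicator counts all sites of A as bad whatever their vectors are, the Green
    function is that of the healed environment, and \<open>w\<close> ignores the cube around x. So H
    does not depend on the environment in A.\<close>
  define H where "H \<omega> = ennreal (w \<omega> * green (heal A \<omega>) r x0 x) * indicator {\<omega>. ?S \<omega>} \<omega>" for \<omega>
  have \<Lambda>0: "0 \<le> \<Lambda>" using \<alpha> by (simp add: \<Lambda>_def)
  have comp: "green \<omega> r x0 x \<le> \<Lambda> * green \<omega>' r x0 x"
    if "\<omega> \<in> space EL" "\<omega>' \<in> space EL" "\<And>z. z \<notin> A \<Longrightarrow> \<omega> z = \<omega>' z" "?S \<omega>" for \<omega> \<omega>'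
  proof -
    have "2 * real (card A) * (2 / \<alpha>) ^ (2 * ((4 * CARD('d) + 12) * ((2 * CARD('d) + 9) * n))) \<le> \<Lambda>"
      unfolding \<Lambda>_def using A(5) \<alpha> by (intro mult_right_mono) (auto simp del: of_nat_add of_nat_mult)
    then have "2 * real (card A) * (2 / \<alpha>) ^ (2 * ((4 * CARD('d) + 12) * ((2 * CARD('d) + 9) * n))) * green \<omega>' r x0 x \<le> \<Lambda> * green \<omega>' r x0 x"
      using r \<alpha> by (intro mult_right_mono green_nonneg[OF prob_vectors_EL[OF that(2)] _ _ _ admissible_moves[OF that(2) order_refl]]) auto
    with green_heal_comparison[OF that(1,2,3) A(1-3) n that(4) r] show ?thesis by (auto intro: order_trans)
  qed
  have H_meas: "H \<in> borel_measurable EL"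
  proof -
    have "(\<lambda>\<omega>. green (heal A \<omega>) r x0 x) \<in> borel_measurable EL"
      by (rule measurable_compose[OF heal_measurable green_measurable])
    then have "(\<lambda>\<omega>. ennreal (w \<omega> * green (heal A \<omega>) r x0 x) * indicator {\<omega> \<in> space EL. ?S \<omega>} \<omega>) \<in> borel_measurable EL"
      using w(1) by (intro borel_measurable_times_ennreal borel_measurable_indicator sparsely_bad_measurable measurable_compose[OF _ measurable_ennreal] borel_measurable_times)
    then show ?thesis
      by (rule measurable_cong[THEN iffD1, rotated]) (auto simp: indicator_def H_def)
  qed
  have H_inv: "H (fun_upd \<omega> a p) = H \<omega>" if "a \<in> A" "\<omega> \<in> space EL" "p \<in> space \<nu>" for a \<omega> p
  proof -
    have "heal A (fun_upd \<omega> a p) = heal A \<omega>" "bad_sites (fun_upd \<omega> a p) \<union> A = bad_sites \<omega> \<union> A"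
      using that(1) by (auto simp: heal_def bad_sites_def)
    then show ?thesis unfolding H_def using inv[OF _ that(2,3), of a] that(1) AB by (auto simp: indicator_def)
  qed
  let ?bad = "{\<omega>. \<forall>a\<in>A. \<omega> a \<in> Bad}" and ?good = "{\<omega>. \<forall>a\<in>A. \<omega> a \<in> space \<nu> - Bad}"
  have "(\<integral>\<^sup>+\<omega>. ennreal (w \<omega> * green \<omega> r x0 x) * indicator {\<omega>. insert x Z \<subseteq> bad_sites \<omega> \<and> sparsely_bad (CARD('d) + 4) ((2 * CARD('d) + 9) * n) x (bad_sites \<omega>)} \<omega> \<partial>EL)
    \<le> (\<integral>\<^sup>+\<omega>. ennreal \<Lambda> * (indicator ?bad \<omega> * H \<omega>) \<partial>EL)"
  proof (intro nn_integral_mono)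
    fix \<omega> assume \<omega>: "\<omega> \<in> space EL"
    show "ennreal (w \<omega> * green \<omega> r x0 x) * indicator {\<omega>. insert x Z \<subseteq> bad_sites \<omega> \<and> sparsely_bad (CARD('d) + 4) ((2 * CARD('d) + 9) * n) x (bad_sites \<omega>)} \<omega>
        \<le> ennreal \<Lambda> * (indicator ?bad \<omega> * H \<omega>)"
    proof (cases "insert x Z \<subseteq> bad_sites \<omega> \<and> sparsely_bad (CARD('d) + 4) ((2 * CARD('d) + 9) * n) x (bad_sites \<omega>)")
      case True
      then have *: "A \<subseteq> bad_sites \<omega>" "bad_sites \<omega> \<union> A = bad_sites \<omega>" by (auto simp: A_def)
      have "green \<omega> r x0 x \<le> \<Lambda> * green (heal A \<omega>) r x0 x"
        by (rule comp[OF \<omega> heal_space[OF \<omega>]]) (use * True in \<open>auto simp: heal_def\<close>)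
      from mult_left_mono[OF this w(2)[OF \<omega>]]
      have "w \<omega> * green \<omega> r x0 x \<le> \<Lambda> * (w \<omega> * green (heal A \<omega>) r x0 x)"
        by (simp add: mult.left_commute)
      then have "ennreal (w \<omega> * green \<omega> r x0 x) \<le> ennreal \<Lambda> * ennreal (w \<omega> * green (heal A \<omega>) r x0 x)"
        using \<Lambda>0 by (simp add: ennreal_mult'[symmetric] ennreal_leI)
      moreover have "\<omega> \<in> ?bad" using * by (auto simp: bad_sites_def)
      moreover have "?S \<omega>" using * True by simp
      ultimately show ?thesis using True by (simp add: H_def indicator_def)
    qed simp
  qed
  also have "\<dots> = ennreal \<Lambda> * (emeasure \<nu> Bad ^ card A * (\<integral>\<^sup>+\<omega>. H \<omega> \<partial>EL))"
  proof (subst nn_integral_cmult)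
    have "(\<lambda>\<omega>. indicator {\<omega> \<in> space EL. \<forall>a\<in>A. \<omega> a \<in> Bad} \<omega> * H \<omega>) \<in> borel_measurable EL"
      by (intro borel_measurable_times_ennreal borel_measurable_indicator sets_env_law_coordinates A Bad H_meas)
    then show "(\<lambda>\<omega>. indicator ?bad \<omega> * H \<omega>) \<in> borel_measurable EL"
      by (rule measurable_cong[THEN iffD1, rotated]) (auto simp: indicator_def)
  qed (simp add: nn_integral_env_law_indep[OF prob_space_axioms A(1) Bad H_meas H_inv])
  finally have 1: "(\<integral>\<^sup>+\<omega>. ennreal (w \<omega> * green \<omega> r x0 x) * indicator {\<omega>. insert x Z \<subseteq> bad_sites \<omega> \<and> sparsely_bad (CARD('d) + 4) ((2 * CARD('d) + 9) * n) x (bad_sites \<omega>)} \<omega> \<partial>EL)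
    \<le> ennreal \<Lambda> * (emeasure \<nu> Bad ^ card A * (\<integral>\<^sup>+\<omega>. H \<omega> \<partial>EL))" .
  have Good: "space \<nu> - Bad \<in> sets \<nu>" using Bad by auto
  \<comment> \<open>The way back: on the event that A is good, the healed Green function is bounded
    by the original one. Independence of H and A turns the event into a factor.\<close>
  have "emeasure \<nu> (space \<nu> - Bad) ^ card A * (\<integral>\<^sup>+\<omega>. H \<omega> \<partial>EL) = (\<integral>\<^sup>+\<omega>. indicator ?good \<omega> * H \<omega> \<partial>EL)"
    by (rule nn_integral_env_law_indep[OF prob_space_axioms A(1) Good H_meas H_inv, symmetric])
  also have "\<dots> \<le> (\<integral>\<^sup>+\<omega>. ennreal \<Lambda> * ennreal (w \<omega> * green \<omega> r x0 x) \<partial>EL)"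
  proof (intro nn_integral_mono)
    fix \<omega> assume \<omega>: "\<omega> \<in> space EL"
    show "indicator ?good \<omega> * H \<omega> \<le> ennreal \<Lambda> * ennreal (w \<omega> * green \<omega> r x0 x)"
    proof (cases "\<omega> \<in> ?good \<and> ?S \<omega>")
      case True
      have eq: "bad_sites (heal A \<omega>) \<union> A = bad_sites \<omega> \<union> A" by (auto simp: bad_sites_def heal_def)
      have "green (heal A \<omega>) r x0 x \<le> \<Lambda> * green \<omega> r x0 x"
        by (rule comp[OF heal_space[OF \<omega>] \<omega>]) (use True in \<open>auto simp: eq\<close>, auto simp: heal_def)
      from mult_left_mono[OF this w(2)[OF \<omega>]]
      have "w \<omega> * green (heal A \<omega>) r x0 x \<le> \<Lambda> * (w \<omega> * green \<omega> r x0 x)"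
        by (simp add: mult.left_commute)
      then have "ennreal (w \<omega> * green (heal A \<omega>) r x0 x) \<le> ennreal \<Lambda> * ennreal (w \<omega> * green \<omega> r x0 x)"
        using \<Lambda>0 by (simp add: ennreal_mult'[symmetric] ennreal_leI)
      then show ?thesis using True by (simp add: H_def indicator_def)
    next
      case False
      then have "indicator ?good \<omega> = (0 :: ennreal) \<or> H \<omega> = 0"
        unfolding H_def indicator_def by (cases "\<omega> \<in> ?good") simp_all
      then show ?thesis by auto
    qed
  qed
  also have "\<dots> = ennreal \<Lambda> * (\<integral>\<^sup>+\<omega>. ennreal (w \<omega> * green \<omega> r x0 x) \<partial>EL)"
    using w(1) by (intro nn_integral_cmult measurable_compose[OF _ measurable_ennreal] borel_measurable_times green_measurable)
  finally have 2: "emeasure \<nu> (space \<nu> - Bad) ^ card A * (\<integral>\<^sup>+\<omega>. H \<omega> \<partial>EL)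
    \<le> ennreal \<Lambda> * (\<integral>\<^sup>+\<omega>. ennreal (w \<omega> * green \<omega> r x0 x) \<partial>EL)" .
  have b: "measure \<nu> Bad \<le> \<epsilon>" using \<epsilon> by (simp add: emeasure_eq_measure)
  have g: "emeasure \<nu> (space \<nu> - Bad) = ennreal (1 - measure \<nu> Bad)"
    using Bad by (simp add: emeasure_eq_measure prob_compl)
  \<comment> \<open>Exchanging bad for good sites leaves the odds, at most 2 * \<epsilon> per site.
    As 2 * \<epsilon> \<le> 1 and \<open>card A\<close> \<ge> n, keeping n of these factors gives an
    upper bound.\<close>
  have "emeasure \<nu> Bad ^ card A \<le> ennreal ((2 * \<epsilon>) ^ n) * emeasure \<nu> (space \<nu> - Bad) ^ card A"
  proof -
    have "measure \<nu> Bad \<le> 2 * \<epsilon> * (1 - measure \<nu> Bad)"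
      using b \<epsilon> mult_left_mono[of "1 / 2" "1 - measure \<nu> Bad" "2 * \<epsilon>"] by simp
    then have "measure \<nu> Bad ^ card A \<le> (2 * \<epsilon> * (1 - measure \<nu> Bad)) ^ card A"
      by (intro power_mono) auto
    also have "\<dots> \<le> (2 * \<epsilon>) ^ n * (1 - measure \<nu> Bad) ^ card A"
      unfolding power_mult_distrib[of "2 * \<epsilon>" "1 - measure \<nu> Bad"] using A(4) \<epsilon> by (intro mult_right_mono power_decreasing) auto
    finally show ?thesis
      unfolding g using \<epsilon> by (simp add: emeasure_eq_measure ennreal_power ennreal_mult'[symmetric] ennreal_leI)
  qed
  then have "emeasure \<nu> Bad ^ card A * (\<integral>\<^sup>+\<omega>. H \<omega> \<partial>EL) \<le>
      ennreal ((2 * \<epsilon>) ^ n) * emeasure \<nu> (space \<nu> - Bad) ^ card A * (\<integral>\<^sup>+\<omega>. H \<omega> \<partial>EL)"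
    by (rule mult_right_mono) simp
  also have "\<dots> \<le> ennreal ((2 * \<epsilon>) ^ n) * (ennreal \<Lambda> * (\<integral>\<^sup>+\<omega>. ennreal (w \<omega> * green \<omega> r x0 x) \<partial>EL))"
    unfolding mult.assoc by (intro mult_left_mono 2) simp
  finally have "ennreal \<Lambda> * (emeasure \<nu> Bad ^ card A * (\<integral>\<^sup>+\<omega>. H \<omega> \<partial>EL)) \<le>
      ennreal \<Lambda> * (ennreal ((2 * \<epsilon>) ^ n) * (ennreal \<Lambda> * (\<integral>\<^sup>+\<omega>. ennreal (w \<omega> * green \<omega> r x0 x) \<partial>EL)))"
    by (rule mult_left_mono) simp
  also have "\<dots> = ennreal (\<Lambda>\<^sup>2 * (2 * \<epsilon>) ^ n) * (\<integral>\<^sup>+\<omega>. ennreal (w \<omega> * green \<omega> r x0 x) \<partial>EL)"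
    using \<Lambda>0 \<epsilon> by (simp add: ennreal_mult'' ennreal_mult power2_eq_square mult_ac)
  finally show ?thesis using 1 unfolding \<Lambda>_def by (rule order_trans[rotated])
qed

lemma bad_sites_measurable:
  "finite A \<Longrightarrow> {\<omega> \<in> space EL. A \<subseteq> bad_sites \<omega>} \<in> sets EL"
  using sets_env_law_coordinates[of A Bad \<nu>] Bad by (simp add: bad_sites_def subset_iff Ball_def)

text \<open>A union bound: there are at most \<open>entropy_const\<close>^n witnesses, each with at
  least n independent sites. It takes care of environments that fail to be sparse even at the
  largest scale considered.\<close>

lemma not_sparse_prob:
  assumes n: "n \<ge> 1" and \<epsilon>: "emeasure \<nu> Bad \<le> ennreal \<epsilon>" "0 \<le> \<epsilon>" "cluster_const CARD('d) \<alpha> * \<epsilon> \<le> 1 / 2"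
  shows "emeasure EL {\<omega> \<in> space EL. \<not> sparsely_bad (CARD('d) + 4) n x (bad_sites \<omega>)} \<le> ennreal ((1 / 2) ^ n)"
proof -
  have \<epsilon>1: "entropy_const CARD('d) * \<epsilon> \<le> 1 / 2"
    using \<epsilon> mult_right_mono[OF entropy_le_cluster_const[OF \<alpha>, of "CARD('d)"] \<epsilon>(2)] by simp
  let ?W = "witnesses (CARD('d) + 4) n x"
  have "{\<omega> \<in> space EL. \<not> sparsely_bad (CARD('d) + 4) n x (bad_sites \<omega>)} = (\<Union>Z\<in>?W. {\<omega> \<in> space EL. Z \<subseteq> bad_sites \<omega>})"
    by (auto simp: sparsely_bad_def)
  then have "emeasure EL {\<omega> \<in> space EL. \<not> sparsely_bad (CARD('d) + 4) n x (bad_sites \<omega>)} \<le> (\<Sum>Z\<in>?W. emeasure EL {\<omega> \<in> space EL. Z \<subseteq> bad_sites \<omega>})"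
    using witnesses_finite bad_sites_measurable[OF witnesses_props(1)]
    by (auto intro!: emeasure_subadditive_finite)
  also have "\<dots> \<le> (\<Sum>Z\<in>?W. ennreal (\<epsilon> ^ n))"
  proof (intro sum_mono)
    fix Z assume Z: "Z \<in> ?W"
    note Zp = witnesses_props[OF Z]
    have "emeasure EL {\<omega> \<in> space EL. Z \<subseteq> bad_sites \<omega>} = (\<integral>\<^sup>+\<omega>. indicator {\<omega> \<in> space EL. Z \<subseteq> bad_sites \<omega>} \<omega> \<partial>EL)"
      by (rule nn_integral_indicator[symmetric]) (rule bad_sites_measurable[OF Zp(1)])
    also have "\<dots> = (\<integral>\<^sup>+\<omega>. indicator {\<omega>. \<forall>a\<in>Z. \<omega> a \<in> Bad} \<omega> * 1 \<partial>EL)"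
      by (intro nn_integral_cong) (auto simp: indicator_def bad_sites_def)
    also have "\<dots> = emeasure \<nu> Bad ^ card Z * (\<integral>\<^sup>+\<omega>. 1 \<partial>EL)"
      by (rule nn_integral_env_law_indep[OF prob_space_axioms Zp(1) Bad]) auto
    also have "\<dots> = emeasure \<nu> Bad ^ card Z" by (simp add: E.emeasure_space_1)
    also have "\<dots> \<le> emeasure \<nu> Bad ^ n"
      using Zp(2) by (simp add: emeasure_eq_measure ennreal_power power_decreasing ennreal_leI)
    also have "\<dots> \<le> ennreal \<epsilon> ^ n" by (intro power_mono \<epsilon>) auto
    finally show "emeasure EL {\<omega> \<in> space EL. Z \<subseteq> bad_sites \<omega>} \<le> ennreal (\<epsilon> ^ n)" using \<epsilon> by (simp add: ennreal_power)
  qed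
  also have "\<dots> = ennreal (real (card ?W) * \<epsilon> ^ n)" using \<epsilon> by (simp add: ennreal_mult ennreal_of_nat_eq_real_of_nat)
  also have "\<dots> \<le> ennreal (entropy_const CARD('d) ^ n * \<epsilon> ^ n)"
    using card_witnesses_le_power[OF n, of x] \<epsilon> by (intro ennreal_leI mult_right_mono) auto
  also have "\<dots> \<le> ennreal ((1 / 2) ^ n)"
    unfolding power_mult_distrib[symmetric] using \<epsilon> \<epsilon>1
    by (intro ennreal_leI power_mono mult_nonneg_nonneg) (auto simp: entropy_const_def)
  finally show ?thesis .
qed

text \<open>If \<open>x\<close> is bad then the environment fails to be sparsely bad at scale 1.  The sum runs over the
  last scale at which it fails.\<close>

lemma bad_site_estimate:
  assumes r: "1 / 2 \<le> r" "r < 1"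
    and w: "w \<in> borel_measurable EL" "\<And>\<omega>. \<omega> \<in> space EL \<Longrightarrow> 0 \<le> w \<omega>"
    and inv: "\<And>a \<omega> p. a \<in> cube x ((2 * CARD('d) + 9) ^ I) \<Longrightarrow> \<omega> \<in> space EL \<Longrightarrow> p \<in> space \<nu> \<Longrightarrow> w (fun_upd \<omega> a p) = w \<omega>"
    and \<epsilon>: "emeasure \<nu> Bad \<le> ennreal \<epsilon>" "0 \<le> \<epsilon>" "\<epsilon> \<le> 1 / 2" "cluster_const CARD('d) \<alpha> * \<epsilon> \<le> 1 / 2"
  shows "(\<integral>\<^sup>+\<omega>. ennreal (w \<omega> * green \<omega> r x0 x) * indicator {\<omega>. x \<in> bad_sites \<omega>} \<omega> \<partial>EL)
    \<le> ennreal (2 * (cluster_const CARD('d) \<alpha> * \<epsilon>)) * (\<integral>\<^sup>+\<omega>. ennreal (w \<omega> * green \<omega> r x0 x) \<partial>EL)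
      + (\<integral>\<^sup>+\<omega>. ennreal (w \<omega> * green \<omega> r x0 x) * indicator {\<omega>. \<not> sparsely_bad (CARD('d) + 4) ((2 * CARD('d) + 9) ^ I) x (bad_sites \<omega>)} \<omega> \<partial>EL)"
proof -
  let ?b = "2 * CARD('d) + 9" and ?M = "CARD('d) + 4"
  let ?g = "\<lambda>\<omega>. ennreal (w \<omega> * green \<omega> r x0 x)"
  let ?V = "\<lambda>i Z. {\<omega>. insert x Z \<subseteq> bad_sites \<omega> \<and> sparsely_bad ?M (?b * ?b ^ i) x (bad_sites \<omega>)}"
  let ?q = "cluster_const CARD('d) \<alpha> * \<epsilon>"
  define G where "G = (\<integral>\<^sup>+\<omega>. ?g \<omega> \<partial>EL)"
  have g_meas: "?g \<in> borel_measurable EL"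
    by (intro measurable_compose[OF _ measurable_ennreal] borel_measurable_times green_measurable w)
  have V_meas: "(\<lambda>\<omega>. ?g \<omega> * indicator (?V i Z) \<omega>) \<in> borel_measurable EL" if "Z \<in> witnesses ?M (?b ^ i) x" for i Z
  proof (intro borel_measurable_times_ennreal g_meas borel_measurable_indicator')
    have "{\<omega> \<in> space EL. \<omega> \<in> ?V i Z} = {\<omega> \<in> space EL. insert x Z \<subseteq> bad_sites \<omega>} \<inter> {\<omega> \<in> space EL. sparsely_bad ?M (?b * ?b ^ i) x (bad_sites \<omega> \<union> {})}"
      by auto
    also have "\<dots> \<in> sets EL"
      using witnesses_props(1)[OF that] by (intro sets.Int bad_sites_measurable sparsely_bad_measurable) auto
    finally show "{\<omega> \<in> space EL. \<omega> \<in> ?V i Z} \<in> sets EL" .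
  qed
  have N_meas: "(\<lambda>\<omega>. ?g \<omega> * indicator {\<omega>. \<not> sparsely_bad ?M (?b ^ I) x (bad_sites \<omega>)} \<omega>) \<in> borel_measurable EL"
  proof (intro borel_measurable_times_ennreal g_meas borel_measurable_indicator')
    have "space EL - {\<omega> \<in> space EL. sparsely_bad ?M (?b ^ I) x (bad_sites \<omega> \<union> {})} \<in> sets EL"
      by (intro sets.compl_sets sparsely_bad_measurable)
    also have "space EL - {\<omega> \<in> space EL. sparsely_bad ?M (?b ^ I) x (bad_sites \<omega> \<union> {})} = {\<omega> \<in> space EL. \<omega> \<in> {\<omega>. \<not> sparsely_bad ?M (?b ^ I) x (bad_sites \<omega>)}}"
      by auto
    finally show "{\<omega> \<in> space EL. \<omega> \<in> {\<omega>. \<not> sparsely_bad ?M (?b ^ I) x (bad_sites \<omega>)}} \<in> sets EL" .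
  qed
  have pointwise: "?g \<omega> * indicator {\<omega>. x \<in> bad_sites \<omega>} \<omega> \<le>
      (\<Sum>i<I. \<Sum>Z\<in>witnesses ?M (?b ^ i) x. ?g \<omega> * indicator (?V i Z) \<omega>)
       + ?g \<omega> * indicator {\<omega>. \<not> sparsely_bad ?M (?b ^ I) x (bad_sites \<omega>)} \<omega>" for \<omega>
  proof (cases "x \<in> bad_sites \<omega> \<and> sparsely_bad ?M (?b ^ I) x (bad_sites \<omega>)")
    case True
    \<comment> \<open>A bad site is itself a witness at scale 1, for a path with the single marked
      time 0.\<close>
    have "{x} \<in> witnesses ?M 1 x"
      unfolding witnesses_def using axes
      by (intro image_eqI[of _ _ "(x, s1, s2, {0})"]) (auto simp: cube_def)
    then have "\<not> sparsely_bad ?M (?b ^ 0) x (bad_sites \<omega>)" using True by (auto simp: sparsely_bad_def)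
    then have "\<exists>i<I. (\<forall>j\<le>i. \<not> sparsely_bad ?M (?b ^ j) x (bad_sites \<omega>)) \<and> sparsely_bad ?M (?b ^ Suc i) x (bad_sites \<omega>)"
      using True by (intro ex_least_nat_less) auto
    then obtain i where i: "i < I" "\<not> sparsely_bad ?M (?b ^ i) x (bad_sites \<omega>)" "sparsely_bad ?M (?b * ?b ^ i) x (bad_sites \<omega>)"
      by auto
    then obtain Z where Z: "Z \<in> witnesses ?M (?b ^ i) x" "Z \<subseteq> bad_sites \<omega>" by (auto simp: sparsely_bad_def)
    have "?g \<omega> = ?g \<omega> * indicator (?V i Z) \<omega>" using Z i True by (simp add: indicator_def)
    also have "\<dots> \<le> (\<Sum>Z\<in>witnesses ?M (?b ^ i) x. ?g \<omega> * indicator (?V i Z) \<omega>)"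
      using Z(1) witnesses_finite by (intro member_le_sum) auto
    also have "\<dots> \<le> (\<Sum>i<I. \<Sum>Z\<in>witnesses ?M (?b ^ i) x. ?g \<omega> * indicator (?V i Z) \<omega>)"
      using i(1) by (intro member_le_sum[of i "{..<I}"]) auto
    finally show ?thesis using True by (simp add: indicator_def)
  qed (auto simp: indicator_def)
  have "(\<integral>\<^sup>+\<omega>. ?g \<omega> * indicator {\<omega>. x \<in> bad_sites \<omega>} \<omega> \<partial>EL)
    \<le> (\<integral>\<^sup>+\<omega>. (\<Sum>i<I. \<Sum>Z\<in>witnesses ?M (?b ^ i) x. ?g \<omega> * indicator (?V i Z) \<omega>)
       + ?g \<omega> * indicator {\<omega>. \<not> sparsely_bad ?M (?b ^ I) x (bad_sites \<omega>)} \<omega> \<partial>EL)"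
    by (intro nn_integral_mono pointwise)
  also have "\<dots> = (\<Sum>i<I. \<Sum>Z\<in>witnesses ?M (?b ^ i) x. \<integral>\<^sup>+\<omega>. ?g \<omega> * indicator (?V i Z) \<omega> \<partial>EL)
       + (\<integral>\<^sup>+\<omega>. ?g \<omega> * indicator {\<omega>. \<not> sparsely_bad ?M (?b ^ I) x (bad_sites \<omega>)} \<omega> \<partial>EL)"
    using V_meas N_meas by (subst nn_integral_add) (auto simp: nn_integral_sum)
  also have "(\<Sum>i<I. \<Sum>Z\<in>witnesses ?M (?b ^ i) x. \<integral>\<^sup>+\<omega>. ?g \<omega> * indicator (?V i Z) \<omega> \<partial>EL) \<le> (\<Sum>i<I. ennreal (?q ^ (Suc i)) * G)"
  proof (intro sum_mono)
    fix i assume i: "i \<in> {..<I}"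
    define n where "n = ?b ^ i"
    have n: "n \<ge> 1" by (simp add: n_def)
    have "(2 * CARD('d) + 9) * n \<le> ?b ^ I"
      using power_increasing[of "Suc i" I ?b] i by (auto simp: n_def)
    note sub = cube_mono[OF this, of x]
    let ?\<Lambda> = "2 * (?M * n + 1) * (2 / \<alpha>) ^ (2 * ((4 * CARD('d) + 12) * (?b * n)))"
    have "(\<Sum>Z\<in>witnesses ?M n x. \<integral>\<^sup>+\<omega>. ?g \<omega> * indicator (?V i Z) \<omega> \<partial>EL)
        \<le> (\<Sum>Z\<in>witnesses ?M n x. ennreal (?\<Lambda>\<^sup>2 * (2 * \<epsilon>) ^ n) * G)"
    proof (intro sum_mono)
      fix Z assume Z: "Z \<in> witnesses ?M n x"
      have inv': "w (fun_upd \<omega> a p) = w \<omega>" if "a \<in> cube x (?b * n)" "\<omega> \<in> space EL" "p \<in> space \<nu>" for a \<omega> p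
        using inv that sub by blast
      show "(\<integral>\<^sup>+\<omega>. ?g \<omega> * indicator (?V i Z) \<omega> \<partial>EL) \<le> ennreal (?\<Lambda>\<^sup>2 * (2 * \<epsilon>) ^ n) * G"
        unfolding G_def n_def[symmetric]
        by (rule bad_cluster_estimate[OF Z n r w inv' \<epsilon>(1-3)])
    qed
    also have "\<dots> = ennreal (real (card (witnesses ?M n x)) * (?\<Lambda>\<^sup>2 * (2 * \<epsilon>) ^ n)) * G"
      using \<epsilon> \<alpha> by (simp add: ennreal_mult ennreal_of_nat_eq_real_of_nat mult.assoc)
    also have "\<dots> \<le> ennreal (?q ^ n) * G"
    proof (intro mult_right_mono ennreal_leI)
      have "?\<Lambda> \<le> modification_const CARD('d) \<alpha> ^ n" using modification_const_power[OF \<alpha> n, of "CARD('d)"] by (simp only: of_nat_mult of_nat_numeral)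
      moreover have "0 \<le> ?\<Lambda>" using \<alpha> by simp
      ultimately have "?\<Lambda>\<^sup>2 \<le> (modification_const CARD('d) \<alpha> ^ n)\<^sup>2" by (intro power_mono)
      then have "real (card (witnesses ?M n x)) * (?\<Lambda>\<^sup>2 * (2 * \<epsilon>) ^ n)
          \<le> entropy_const CARD('d) ^ n * ((modification_const CARD('d) \<alpha> ^ n)\<^sup>2 * (2 * \<epsilon>) ^ n)"
        using \<epsilon> card_witnesses_le_power[OF n, of x]
        by (intro mult_mono mult_right_mono) (auto simp: entropy_const_def)
      also have "\<dots> = ?q ^ n"
        by (simp add: cluster_const_def power_mult_distrib mult_ac flip: power_mult)
      finally show "real (card (witnesses ?M n x)) * (?\<Lambda>\<^sup>2 * (2 * \<epsilon>) ^ n) \<le> ?q ^ n" .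
    qed simp
    \<comment> \<open>The exponent n = ?b^i is much larger than i + 1, but i + 1 already gives a
      geometric series whose first term is \<open>?q\<close>.\<close>
    also have "\<dots> \<le> ennreal (?q ^ Suc i) * G"
    proof (intro mult_right_mono ennreal_leI power_decreasing)
      have "Suc i \<le> 2 ^ i" by (induction i) auto
      also have "\<dots> \<le> n" unfolding n_def by (intro power_mono) auto
      finally show "Suc i \<le> n" .
    qed (use \<epsilon> cluster_const_nonneg[OF \<alpha>] in auto)
    finally show "(\<Sum>Z\<in>witnesses ?M (?b ^ i) x. \<integral>\<^sup>+\<omega>. ?g \<omega> * indicator (?V i Z) \<omega> \<partial>EL) \<le> ennreal (?q ^ Suc i) * G"
      unfolding n_def .
  qed
  also have "(\<Sum>i<I. ennreal (?q ^ (Suc i)) * G) = ennreal (\<Sum>i<I. ?q ^ Suc i) * G"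
    using \<epsilon> cluster_const_nonneg[OF \<alpha>, of "CARD('d)"] by (simp add: sum_ennreal flip: sum_distrib_right)
  also have "ennreal (\<Sum>i<I. ?q ^ Suc i) * G \<le> ennreal (2 * ?q) * G"
  proof (intro mult_right_mono ennreal_leI)
    have q: "0 \<le> ?q" "?q \<le> 1 / 2" using \<epsilon> cluster_const_nonneg[OF \<alpha>, of "CARD('d)"] by auto
    have "(\<Sum>i<I. ?q ^ i) \<le> 2"
    proof -
      have "(\<Sum>i<I. ?q ^ i) = (1 - ?q ^ I) / (1 - ?q)" using q by (subst sum_gp_strict) auto
      also have "\<dots> \<le> 1 / (1 - ?q)" using q by (intro divide_right_mono) auto
      also have "\<dots> \<le> 2" using q by (simp add: field_simps)
      finally show ?thesis .
    qed
    then have "?q * (\<Sum>i<I. ?q ^ i) \<le> ?q * 2" using q by (intro mult_left_mono)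
    then show "(\<Sum>i<I. ?q ^ Suc i) \<le> 2 * ?q" by (simp add: sum_distrib_left)
  qed simp
  finally show ?thesis unfolding G_def by (simp add: add_right_mono)
qed

end

section \<open>Cylinder probabilities of the walk\<close>

lemma inj_nbr: "nbr s = nbr t \<longleftrightarrow> s = (t :: 'd::finite + 'd)"
proof
  assume eq: "nbr s = nbr t"
  have "axis_of s = axis_of t"
    using arg_cong[OF eq, of "\<lambda>v. v $ axis_of s"] orientation_cases[of s] by (auto simp: nbr_nth split: if_splits)
  moreover have "orientation s = orientation t"
    using arg_cong[OF eq, of "\<lambda>v. v $ axis_of s"] \<open>axis_of s = axis_of t\<close> by (simp add: nbr_nth)
  ultimately show "s = t" by (cases s; cases t) (auto simp: axis_of_def orientation_def)
qed simp

abbreviation paths :: "(nat \<Rightarrow> int ^ 'd::finite) measure" where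
  "paths \<equiv> \<Pi>\<^sub>M n\<in>UNIV. count_space UNIV"

definition cylinder :: "nat \<Rightarrow> (nat \<Rightarrow> int ^ 'd) \<Rightarrow> (nat \<Rightarrow> int ^ 'd) set" where
  "cylinder n x = {X. \<forall>k\<le>n. X k = x k}"

text \<open>A real-valued form of \<open>quenched_law_cylinder\<close>. As a function of the
  environment it involves only the sites at times before n: no step has been made from x n
  yet.\<close>

definition prefix_weight :: "'d::finite environment \<Rightarrow> nat \<Rightarrow> (nat \<Rightarrow> int ^ 'd) \<Rightarrow> real" where
  "prefix_weight \<omega> n x = (if x 0 = 0 then \<Prod>k<n. \<Sum>s | x k + nbr s = x (Suc k). \<omega> (x k) $ s else 0)"

lemma space_paths [simp]: "space paths = UNIV"
  by (simp add: space_PiM)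

lemma path_component_measurable [measurable]: "(\<lambda>X. X n) \<in> paths \<rightarrow>\<^sub>M count_space UNIV"
  by (rule measurable_component_singleton) simp

lemma sets_cylinder: "cylinder n x \<in> sets (paths :: (nat \<Rightarrow> int ^ 'd::finite) measure)"
proof -
  have "{X \<in> space paths. \<forall>k\<le>n. X k = x k} \<in> sets (paths :: (nat \<Rightarrow> int ^ 'd) measure)" by measurable
  then show ?thesis by (simp add: cylinder_def)
qed

lemma prefix_weight_bounds:
  assumes "prob_vectors \<omega>"
  shows "0 \<le> prefix_weight \<omega> n x" "prefix_weight \<omega> n x \<le> 1"
proof -
  have "0 \<le> (\<Sum>s | y + nbr s = z. \<omega> y $ s)" "(\<Sum>s | y + nbr s = z. \<omega> y $ s) \<le> 1" for y z
  proof -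
    show "0 \<le> (\<Sum>s | y + nbr s = z. \<omega> y $ s)" using assms by (intro sum_nonneg) (auto simp: prob_vectors_def)
    have "(\<Sum>s | y + nbr s = z. \<omega> y $ s) \<le> (\<Sum>s\<in>UNIV. \<omega> y $ s)"
      using assms by (intro sum_mono2) (auto simp: prob_vectors_def)
    then show "(\<Sum>s | y + nbr s = z. \<omega> y $ s) \<le> 1" using assms by (simp add: prob_vectors_def)
  qed
  then show "0 \<le> prefix_weight \<omega> n x" "prefix_weight \<omega> n x \<le> 1"
    unfolding prefix_weight_def by (auto intro!: prod_nonneg prod_le_1)
qed

lemma prefix_weight_extend:
  "prefix_weight \<omega> (Suc n) (x(Suc n := x n + nbr s)) = prefix_weight \<omega> n x * \<omega> (x n) $ s"
proof -
  have "(\<Prod>k<n. \<Sum>s' | (x(Suc n := x n + nbr s)) k + nbr s' = (x(Suc n := x n + nbr s)) (Suc k). \<omega> ((x(Suc n := x n + nbr s)) k) $ s')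
      = (\<Prod>k<n. \<Sum>s | x k + nbr s = x (Suc k). \<omega> (x k) $ s)"
    by (intro prod.cong) auto
  moreover have "{s'. x n + nbr s' = x n + nbr s} = {s}" by (auto simp: inj_nbr)
  ultimately show ?thesis by (simp add: prefix_weight_def)
qed

context
  fixes \<omega> :: "'d::finite environment"
  assumes pv: "prob_vectors \<omega>"
begin

lemma emeasure_quenched_cylinder:
  "emeasure (quenched_law \<omega>) (cylinder n x) = ennreal (prefix_weight \<omega> n x)"
proof -
  have "(\<Sum>s | y + nbr s = z. ennreal (\<omega> y $ s)) = ennreal (\<Sum>s | y + nbr s = z. \<omega> y $ s)" for y z
    using pv by (intro sum_ennreal) (auto simp: prob_vectors_def)
  moreover have "(\<Prod>k<n. ennreal (\<Sum>s | x k + nbr s = x (Suc k). \<omega> (x k) $ s)) = ennreal (\<Prod>k<n. \<Sum>s | x k + nbr s = x (Suc k). \<omega> (x k) $ s)"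
    using pv by (intro prod_ennreal sum_nonneg) (auto simp: prob_vectors_def)
  ultimately show ?thesis
    unfolding cylinder_def quenched_law_cylinder[OF pv] by (simp add: prefix_weight_def)
qed

text \<open>The extensions by one nearest-neighbour step are disjoint and carry the whole mass of
  the cylinder, because transition vectors sum to 1. Other extensions exist as paths but form a null
  set.\<close>

lemma cylinder_split_AE:
  "AE X in quenched_law \<omega>. indicator (cylinder n x) X =
     (\<Sum>s\<in>UNIV. indicator (cylinder (Suc n) (x(Suc n := x n + nbr s))) X :: ennreal)"
proof -
  let ?Q = "quenched_law \<omega>"
  let ?C = "\<lambda>s. cylinder (Suc n) (x(Suc n := x n + nbr s))"
  have sets: "cylinder n x \<in> sets ?Q" "?C s \<in> sets ?Q" for n x s
    by (simp_all add: sets_quenched_law[OF pv] sets_cylinder)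
  have disj: "disjoint_family ?C" by (auto simp: disjoint_family_on_def cylinder_def inj_nbr)
  have sub: "(\<Union>s. ?C s) \<subseteq> cylinder n x" by (auto simp: cylinder_def)
  have sum1: "(\<Sum>s\<in>UNIV. prefix_weight \<omega> n x * \<omega> (x n) $ s) = prefix_weight \<omega> n x"
    using pv by (simp add: prob_vectors_def flip: sum_distrib_left)
  have "emeasure ?Q (\<Union>s. ?C s) = (\<Sum>s\<in>UNIV. emeasure ?Q (?C s))"
    by (rule sum_emeasure[symmetric]) (use sets disj in auto)
  also have "\<dots> = ennreal (\<Sum>s\<in>UNIV. prefix_weight \<omega> n x * \<omega> (x n) $ s)"
    unfolding emeasure_quenched_cylinder prefix_weight_extend
    using pv prefix_weight_bounds[OF pv, of n x] by (intro sum_ennreal mult_nonneg_nonneg) (auto simp: prob_vectors_def)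
  also have "\<dots> = emeasure ?Q (cylinder n x)" unfolding sum1 emeasure_quenched_cylinder ..
  finally have "emeasure ?Q (\<Union>s. ?C s) = emeasure ?Q (cylinder n x)" .
  then have "emeasure ?Q (cylinder n x - (\<Union>s. ?C s)) = 0"
    using sets sub by (subst emeasure_Diff) (auto simp: emeasure_quenched_cylinder)
  then have "AE X in ?Q. X \<notin> cylinder n x - (\<Union>s. ?C s)"
    using sets by (intro AE_not_in) (auto simp: null_sets_def)
  then show ?thesis
  proof eventually_elim
    case (elim X)
    show ?case
    proof (cases "X \<in> cylinder n x")
      case True
      with elim obtain s where s: "X \<in> ?C s" by auto
      have "(\<Sum>s\<in>UNIV. indicator (?C s) X :: ennreal) = (\<Sum>s'\<in>UNIV. if s' = s then 1 else 0)"
        using s disj by (intro sum.cong) (auto simp: indicator_def disjoint_family_on_def)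
      then show ?thesis using True by simp
    next
      case False
      then have "X \<notin> ?C s" for s using sub by auto
      then show ?thesis using False by simp
    qed
  qed
qed

lemma path_pair_measurable:
  "(\<lambda>X. \<psi> (X m) (X m')) \<in> quenched_law \<omega> \<rightarrow>\<^sub>M N" if "\<And>u u'. \<psi> u u' \<in> space N"
proof -
  have "(\<lambda>X. \<psi> (X m) (X m')) \<in> paths \<rightarrow>\<^sub>M N"
    by (rule measurable_compose_countable[OF _ path_component_measurable, of "\<lambda>u X. \<psi> u (X m')"])
       (rule measurable_compose[OF path_component_measurable], use that in auto)
  then show ?thesis by (simp cong: measurable_cong_sets add: sets_quenched_law[OF pv])
qed

text \<open>The Markov property at time n without a shift of paths: the induction on j lengthens the
  cylinder by one step and averages over the extensions, which is why n and x vary. Two consecutive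
  positions are needed to treat increments.\<close>

lemma quenched_two_times:
  assumes \<psi>: "\<And>u u'. 0 \<le> \<psi> u u'"
  shows "(\<integral>\<^sup>+X. indicator (cylinder n x) X * ennreal (\<psi> (X (n + j)) (X (Suc (n + j)))) \<partial>quenched_law \<omega>) =
    ennreal (prefix_weight \<omega> n x * (avg \<omega> ^^ j) (\<lambda>u. \<Sum>s\<in>UNIV. \<omega> u $ s * \<psi> u (u + nbr s)) (x n))"
proof (induction j arbitrary: n x)
  case 0
  let ?C = "\<lambda>s. cylinder (Suc n) (x(Suc n := x n + nbr s))"
  have sets: "?C s \<in> sets (quenched_law \<omega>)" for s by (simp add: sets_quenched_law[OF pv] sets_cylinder)
  have "(\<integral>\<^sup>+X. indicator (cylinder n x) X * ennreal (\<psi> (X n) (X (Suc n))) \<partial>quenched_law \<omega>)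
      = (\<integral>\<^sup>+X. (\<Sum>s\<in>UNIV. ennreal (\<psi> (x n) (x n + nbr s)) * indicator (?C s) X) \<partial>quenched_law \<omega>)"
  proof (intro nn_integral_cong_AE, use cylinder_split_AE[of n x] in eventually_elim)
    case (elim X)
    show ?case unfolding elim sum_distrib_right by (intro sum.cong) (auto simp: indicator_def cylinder_def)
  qed
  also have "\<dots> = (\<Sum>s\<in>UNIV. ennreal (\<psi> (x n) (x n + nbr s)) * ennreal (prefix_weight \<omega> n x * \<omega> (x n) $ s))"
    using sets by (subst nn_integral_sum) (auto simp: nn_integral_cmult emeasure_quenched_cylinder prefix_weight_extend)
  also have "\<dots> = ennreal (\<Sum>s\<in>UNIV. \<psi> (x n) (x n + nbr s) * (prefix_weight \<omega> n x * \<omega> (x n) $ s))"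
    using \<psi> prefix_weight_bounds[OF pv, of n x] pv
    by (subst sum_ennreal[symmetric]) (auto simp: ennreal_mult prob_vectors_def)
  finally show ?case by (simp add: sum_distrib_left mult_ac)
next
  case (Suc j)
  let ?C = "\<lambda>s. cylinder (Suc n) (x(Suc n := x n + nbr s))"
  let ?\<phi> = "\<lambda>u. \<Sum>s\<in>UNIV. \<omega> u $ s * \<psi> u (u + nbr s)"
  let ?h = "\<lambda>X. ennreal (\<psi> (X (Suc n + j)) (X (Suc (Suc n + j))))"
  have sets: "?C s \<in> sets (quenched_law \<omega>)" for s by (simp add: sets_quenched_law[OF pv] sets_cylinder)
  have h: "?h \<in> borel_measurable (quenched_law \<omega>)" by (rule path_pair_measurable) simp
  have \<phi>0: "0 \<le> ?\<phi> u" for u using \<psi> pv by (intro sum_nonneg mult_nonneg_nonneg) (auto simp: prob_vectors_def)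
  have "(\<integral>\<^sup>+X. indicator (cylinder n x) X * ennreal (\<psi> (X (n + Suc j)) (X (Suc (n + Suc j)))) \<partial>quenched_law \<omega>)
      = (\<integral>\<^sup>+X. (\<Sum>s\<in>UNIV. indicator (?C s) X * ?h X) \<partial>quenched_law \<omega>)"
  proof (intro nn_integral_cong_AE, use cylinder_split_AE[of n x] in eventually_elim)
    case (elim X)
    show ?case unfolding elim sum_distrib_right by simp
  qed
  also have "\<dots> = (\<Sum>s\<in>UNIV. \<integral>\<^sup>+X. indicator (?C s) X * ?h X \<partial>quenched_law \<omega>)"
    using sets h by (intro nn_integral_sum) auto
  also have "\<dots> = (\<Sum>s\<in>UNIV. ennreal (prefix_weight \<omega> n x * \<omega> (x n) $ s * (avg \<omega> ^^ j) ?\<phi> (x n + nbr s)))"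
    unfolding Suc.IH prefix_weight_extend by simp
  also have "\<dots> = ennreal (\<Sum>s\<in>UNIV. prefix_weight \<omega> n x * \<omega> (x n) $ s * (avg \<omega> ^^ j) ?\<phi> (x n + nbr s))"
    using prefix_weight_bounds[OF pv, of n x] pv avg_pow_nonneg[OF prob_imp_subprob_vectors[OF pv] \<phi>0, of j]
    by (intro sum_ennreal mult_nonneg_nonneg) (auto simp: prob_vectors_def)
  finally show ?case by (simp add: avg_def[of \<omega> "(avg \<omega> ^^ j) ?\<phi>"] sum_distrib_left mult_ac)
qed

text \<open>Term by term this is \<open>quenched_two_times\<close>. The past enters through its
  weight and its endpoint only, so what remains is a resolvent at x n.\<close>

lemma quenched_occupation:
  assumes \<phi>: "\<And>u. 0 \<le> \<phi> u" "\<And>u. \<phi> u \<le> c" and r: "0 \<le> r" "r < 1"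
  shows "(\<integral>\<^sup>+X. indicator (cylinder n x) X * (\<Sum>k. ennreal (r ^ k * \<phi> (X (n + k)))) \<partial>quenched_law \<omega>) =
    ennreal (prefix_weight \<omega> n x * resolvent \<omega> r \<phi> (x n))"
proof -
  note sub = prob_imp_subprob_vectors[OF pv]
  note w0 = prefix_weight_bounds(1)[OF pv, of n x]
  have b: "\<bar>\<phi> u\<bar> \<le> c" for u using \<phi>[of u] by auto
  have avg0: "(\<lambda>u. \<Sum>s\<in>UNIV. \<omega> u $ s * \<phi> u) = \<phi>"
    using pv by (simp add: fun_eq_iff prob_vectors_def flip: sum_distrib_right)
  have C: "cylinder n x \<in> sets (quenched_law \<omega>)" by (simp add: sets_quenched_law[OF pv] sets_cylinder)
  have meas: "(\<lambda>X. ennreal (\<phi> (X m))) \<in> borel_measurable (quenched_law \<omega>)" for m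
    by (rule path_pair_measurable[of "\<lambda>u u'. ennreal (\<phi> u)"]) simp
  have "(\<integral>\<^sup>+X. indicator (cylinder n x) X * (\<Sum>k. ennreal (r ^ k * \<phi> (X (n + k)))) \<partial>quenched_law \<omega>)
      = (\<integral>\<^sup>+X. (\<Sum>k. ennreal (r ^ k) * (indicator (cylinder n x) X * ennreal (\<phi> (X (n + k))))) \<partial>quenched_law \<omega>)"
    using r \<phi> by (intro nn_integral_cong) (simp add: ennreal_mult flip: ennreal_suminf_cmult, simp add: mult_ac)
  also have "\<dots> = (\<Sum>k. ennreal (r ^ k) * (\<integral>\<^sup>+X. indicator (cylinder n x) X * ennreal (\<phi> (X (n + k))) \<partial>quenched_law \<omega>))"
    using C meas by (subst nn_integral_suminf) (auto simp: nn_integral_cmult)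
  also have "\<dots> = (\<Sum>k. ennreal (prefix_weight \<omega> n x * (r ^ k * (avg \<omega> ^^ k) \<phi> (x n))))"
  proof (intro suminf_cong)
    fix k
    have "(\<integral>\<^sup>+X. indicator (cylinder n x) X * ennreal (\<phi> (X (n + k))) \<partial>quenched_law \<omega>)
        = ennreal (prefix_weight \<omega> n x * (avg \<omega> ^^ k) \<phi> (x n))"
      using quenched_two_times[of "\<lambda>u u'. \<phi> u" n x k] \<phi>(1) by (simp only: avg0)
    then show "ennreal (r ^ k) * (\<integral>\<^sup>+X. indicator (cylinder n x) X * ennreal (\<phi> (X (n + k))) \<partial>quenched_law \<omega>)
        = ennreal (prefix_weight \<omega> n x * (r ^ k * (avg \<omega> ^^ k) \<phi> (x n)))"
      using r by (simp add: ennreal_mult'[symmetric] mult_ac)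
  qed
  also have "\<dots> = ennreal (\<Sum>k. prefix_weight \<omega> n x * (r ^ k * (avg \<omega> ^^ k) \<phi> (x n)))"
    using w0 r \<phi> avg_pow_nonneg[where \<phi> = \<phi>, OF sub \<phi>(1)]
    by (intro suminf_ennreal2 summable_mult resolvent_summable[where \<phi> = \<phi>, OF sub r b]) auto
  also have "\<dots> = ennreal (prefix_weight \<omega> n x * resolvent \<omega> r \<phi> (x n))"
    unfolding resolvent_def by (subst suminf_mult[OF resolvent_summable[where \<phi> = \<phi>, OF sub r b]]) simp
  finally show ?thesis .
qed

end

section \<open>From a fixed environment to the joint law\<close>

lemma nn_integral_joint_law:
  fixes \<nu> :: "(real ^ ('d::finite + 'd)) measure"
  assumes \<nu>: "\<nu> \<in> prob_measures (Sigma_N \<kappa> \<eta> \<theta>)" and f: "f \<in> borel_measurable (env_law \<nu> \<Otimes>\<^sub>M paths)"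
  shows "(\<integral>\<^sup>+p. f p \<partial>joint_law \<nu>) = (\<integral>\<^sup>+\<omega>. (\<integral>\<^sup>+X. f (\<omega>, X) \<partial>quenched_law \<omega>) \<partial>env_law \<nu>)"
proof -
  have Q: "quenched_law \<in> env_law \<nu> \<rightarrow>\<^sub>M subprob_algebra paths"
    using measurable_quenched_law[OF \<nu>] by (rule measurable_prob_algebraD)
  have K: "(\<lambda>\<omega>. distr (quenched_law \<omega>) (env_law \<nu> \<Otimes>\<^sub>M paths) (\<lambda>X. (\<omega>, X)))
      \<in> env_law \<nu> \<rightarrow>\<^sub>M subprob_algebra (env_law \<nu> \<Otimes>\<^sub>M paths)"
    by (rule measurable_distr2[OF _ Q]) simp
  have "(\<integral>\<^sup>+p. f p \<partial>joint_law \<nu>) =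
      (\<integral>\<^sup>+\<omega>. (\<integral>\<^sup>+p. f p \<partial>distr (quenched_law \<omega>) (env_law \<nu> \<Otimes>\<^sub>M paths) (\<lambda>X. (\<omega>, X))) \<partial>env_law \<nu>)"
    unfolding joint_law_def by (rule nn_integral_bind[OF f K])
  also have "\<dots> = (\<integral>\<^sup>+\<omega>. (\<integral>\<^sup>+X. f (\<omega>, X) \<partial>quenched_law \<omega>) \<partial>env_law \<nu>)"
  proof (intro nn_integral_cong nn_integral_distr)
    fix \<omega> assume \<omega>: "\<omega> \<in> space (env_law \<nu>)"
    show "(\<lambda>X. (\<omega>, X)) \<in> quenched_law \<omega> \<rightarrow>\<^sub>M env_law \<nu> \<Otimes>\<^sub>M paths"
      unfolding measurable_cong_sets[OF sets_quenched_law[OF prob_vectors_env[OF \<nu> \<omega>]] refl]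
      using \<omega> by simp
  qed (use f in simp)
  finally show ?thesis .
qed

lemma neighbour_path_sets:
  "{X. X 0 = 0 \<and> (\<forall>k. \<exists>s. X (Suc k) = X k + nbr s)} \<in> sets (paths :: (nat \<Rightarrow> int ^ 'd::finite) measure)"
proof -
  have "{X \<in> space paths. X (Suc k) = X k + nbr s} \<in> sets (paths :: (nat \<Rightarrow> int ^ 'd) measure)" for k s
    by measurable
  then have "{X \<in> space paths. X 0 = 0 \<and> (\<forall>k. \<exists>s. X (Suc k) = X k + nbr s)} \<in> sets (paths :: (nat \<Rightarrow> int ^ 'd) measure)"
    by (intro sets.sets_Collect_conj sets.sets_Collect_countable_All sets.sets_Collect_finite_Ex) measurable
  then show ?thesis by simp
qed

text \<open>Apply \<open>quenched_two_times\<close> to the indicator of a jump to a non-neighbour: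
  its average over the possible steps is 0.\<close>

lemma AE_quenched_neighbour:
  fixes \<omega> :: "'d::finite environment"
  assumes pv: "prob_vectors \<omega>" and ps: "prob_space (quenched_law \<omega>)"
  shows "AE X in quenched_law \<omega>. X 0 = 0 \<and> (\<forall>k. \<exists>s. X (Suc k) = X k + nbr s)"
proof -
  interpret Q: prob_space "quenched_law \<omega>" by fact
  have C: "cylinder 0 (\<lambda>_. 0) \<in> sets (quenched_law \<omega>)" by (simp add: sets_quenched_law[OF pv] sets_cylinder)
  have "emeasure (quenched_law \<omega>) (cylinder 0 (\<lambda>_. 0)) = 1"
    by (simp add: emeasure_quenched_cylinder[OF pv] prefix_weight_def)
  then have C1: "AE X in quenched_law \<omega>. X \<in> cylinder 0 (\<lambda>_. 0)"
    using C by (intro Q.AE_prob_1) (simp add: Q.emeasure_eq_measure)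
  have "AE X in quenched_law \<omega>. X 0 = 0 \<and> (\<exists>s. X (Suc k) = X k + nbr s)" for k
  proof -
    define \<psi> :: "int ^ 'd \<Rightarrow> int ^ 'd \<Rightarrow> real" where "\<psi> u u' = of_bool (\<not> (\<exists>s. u' = u + nbr s))" for u u'
    let ?f = "\<lambda>X. indicator (cylinder 0 (\<lambda>_. 0)) X * ennreal (\<psi> (X (0 + k)) (X (Suc (0 + k))))"
    have "\<psi> u (u + nbr s) = 0" for u s by (auto simp: \<psi>_def)
    then have zero: "(\<lambda>u. \<Sum>s\<in>UNIV. \<omega> u $ s * \<psi> u (u + nbr s)) = (\<lambda>u. 0)" by simp
    have "(\<integral>\<^sup>+X. ?f X \<partial>quenched_law \<omega>) =
        ennreal (prefix_weight \<omega> 0 (\<lambda>_. 0) * (avg \<omega> ^^ k) (\<lambda>u. \<Sum>s\<in>UNIV. \<omega> u $ s * \<psi> u (u + nbr s)) 0)"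
      by (rule quenched_two_times[OF pv]) (simp add: \<psi>_def)
    also have "\<dots> = 0" unfolding zero by (simp add: avg_pow_const[OF pv])
    finally have "(\<integral>\<^sup>+X. ?f X \<partial>quenched_law \<omega>) = 0" .
    moreover have "?f \<in> borel_measurable (quenched_law \<omega>)"
      using C by (intro borel_measurable_times_ennreal path_pair_measurable[OF pv, of "\<lambda>u u'. ennreal (\<psi> u u')"]) auto
    ultimately have "AE X in quenched_law \<omega>. ?f X = 0" by (simp add: nn_integral_0_iff_AE)
    with C1 show ?thesis
      by eventually_elim (auto simp: \<psi>_def cylinder_def split: if_splits)
  qed
  then have "AE X in quenched_law \<omega>. \<forall>k. X 0 = 0 \<and> (\<exists>s. X (Suc k) = X k + nbr s)" by (simp add: AE_all_countable)
  then show ?thesis by simp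
qed

lemma AE_joint_law_neighbour:
  fixes \<nu> :: "(real ^ ('d::finite + 'd)) measure"
  assumes \<nu>: "\<nu> \<in> prob_measures (Sigma_N \<kappa> \<eta> \<theta>)"
  shows "AE p in joint_law \<nu>. snd p 0 = 0 \<and> (\<forall>k. \<exists>s. snd p (Suc k) = snd p k + nbr s)"
proof -
  let ?S = "{X :: nat \<Rightarrow> int ^ 'd. X 0 = 0 \<and> (\<forall>k. \<exists>s. X (Suc k) = X k + nbr s)}"
  have S: "- ?S \<in> sets paths" using sets.compl_sets[OF neighbour_path_sets] by (simp add: Compl_eq_Diff_UNIV)
  have f: "(\<lambda>p. indicator (- ?S) (snd p) :: ennreal) \<in> borel_measurable (env_law \<nu> \<Otimes>\<^sub>M paths)"
    using S by (intro measurable_compose[OF measurable_snd borel_measurable_indicator])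
  have "(\<integral>\<^sup>+p. indicator (- ?S) (snd p) \<partial>joint_law \<nu>) = (\<integral>\<^sup>+\<omega>. (\<integral>\<^sup>+X. indicator (- ?S) (snd (\<omega>, X)) \<partial>quenched_law \<omega>) \<partial>env_law \<nu>)"
    by (rule nn_integral_joint_law[OF \<nu> f])
  also have "\<dots> = (\<integral>\<^sup>+\<omega>. 0 \<partial>env_law \<nu>)"
  proof (intro nn_integral_cong)
    fix \<omega> assume \<omega>: "\<omega> \<in> space (env_law \<nu>)"
    note pv = prob_vectors_env[OF \<nu> \<omega>]
    have "prob_space (quenched_law \<omega>)"
      using measurable_space[OF measurable_quenched_law[OF \<nu>] \<omega>] by (simp add: space_prob_algebra)
    from AE_quenched_neighbour[OF pv this]
    have "AE X in quenched_law \<omega>. indicator (- ?S) X = (0 :: ennreal)" by eventually_elim (simp add: indicator_def)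
    then have "(\<integral>\<^sup>+X. indicator (- ?S) X \<partial>quenched_law \<omega>) = (\<integral>\<^sup>+X. 0 \<partial>quenched_law \<omega>)" by (rule nn_integral_cong_AE)
    then show "(\<integral>\<^sup>+X. indicator (- ?S) (snd (\<omega>, X)) \<partial>quenched_law \<omega>) = 0" by simp
  qed
  finally have "(\<integral>\<^sup>+p. indicator (- ?S) (snd p) \<partial>joint_law \<nu>) = 0" by simp
  moreover have "(\<lambda>p. indicator (- ?S) (snd p) :: ennreal) \<in> borel_measurable (joint_law \<nu>)"
    using f by (simp add: measurable_cong_sets[OF prob_space_joint_law(2)[OF \<nu>] refl])
  ultimately have "AE p in joint_law \<nu>. indicator (- ?S) (snd p) = (0 :: ennreal)"
    by (simp add: nn_integral_0_iff_AE)
  then show ?thesis by eventually_elim (simp add: indicator_def split: if_splits)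
qed

section \<open>Occupation of bad sites\<close>

definition rescaled :: "(nat \<Rightarrow> int ^ 'd::finite) \<Rightarrow> nat \<Rightarrow> real ^ 'd" where
  "rescaled X n = (1 / real n) *\<^sub>R (\<chi> j. real_of_int (X n $ j))"

lemma has_velocity_iff_rescaled: "has_velocity X v \<longleftrightarrow> rescaled X \<longlonglongrightarrow> v"
  by (simp add: has_velocity_def rescaled_def[abs_def])

lemma has_velocity_sets: "{X. has_velocity X v} \<in> sets (paths :: (nat \<Rightarrow> int ^ 'd::finite) measure)"
proof -
  have "{X \<in> space paths. \<forall>m::nat. \<exists>N. \<forall>n. n \<ge> N \<longrightarrow> dist (rescaled X n) v < inverse (real (Suc m))} \<in> sets (paths :: (nat \<Rightarrow> int ^ 'd) measure)"
  proof (intro sets.sets_Collect_countable_All sets.sets_Collect_countable_Ex sets.sets_Collect_imp)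
    fix n m :: nat
    have "(\<lambda>X. dist (rescaled X n) v) \<in> borel_measurable paths"
      unfolding rescaled_def
      by (rule measurable_compose[OF path_component_measurable[of n],
          where g = "\<lambda>u. dist ((1 / real n) *\<^sub>R (\<chi> j. real_of_int (u $ j))) v"]) simp
    then show "{X \<in> space paths. dist (rescaled X n) v < inverse (real (Suc m))} \<in> sets paths"
      by measurable
  qed (use sets.top[of paths] in auto)
  moreover have "has_velocity X v \<longleftrightarrow> (\<forall>m::nat. \<exists>N. \<forall>n. n \<ge> N \<longrightarrow> dist (rescaled X n) v < inverse (real (Suc m)))" for X
    unfolding has_velocity_iff_rescaled lim_sequentially
  proof (intro iffI allI impI)
    fix e :: real assume e: "0 < e" and *: "\<forall>m::nat. \<exists>N. \<forall>n\<ge>N. dist (rescaled X n) v < inverse (real (Suc m))"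
    obtain m where "inverse (real (Suc m)) < e" using reals_Archimedean[OF e] by blast
    with * show "\<exists>N. \<forall>n\<ge>N. dist (rescaled X n) v < e" by (meson order.strict_trans)
  qed auto
  ultimately show ?thesis by simp
qed

lemma has_velocity_unique: "has_velocity X v \<Longrightarrow> has_velocity X w \<Longrightarrow> v = w"
  unfolding has_velocity_iff_rescaled by (rule LIMSEQ_unique)

lemma has_velocity_nth:
  assumes "has_velocity X v"
  shows "(\<lambda>n. X n $ j / n) \<longlonglongrightarrow> v $ j"
  using tendsto_vec_nth[OF assms[unfolded has_velocity_def], of j] by simp

text \<open>Dominated convergence for the positive part of h N - g. The index from which h N \<le> g
  holds varies with the point, hence the error term a N.\<close>

lemma (in prob_space) expectation_eventually_le:
  fixes h :: "nat \<Rightarrow> 'a \<Rightarrow> real"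
  assumes h: "\<And>N. h N \<in> borel_measurable M" and g: "g \<in> borel_measurable M"
    and bound: "\<And>N. AE p in M. \<bar>h N p\<bar> \<le> K" "AE p in M. \<bar>g p\<bar> \<le> K"
    and ev: "AE p in M. eventually (\<lambda>N. h N p \<le> g p) sequentially"
  obtains a where "a \<longlonglongrightarrow> 0" "\<And>N. expectation (h N) \<le> expectation g + a N"
proof
  let ?f = "\<lambda>N p. max 0 (h N p - g p)"
  have "(\<lambda>N. expectation (?f N)) \<longlonglongrightarrow> expectation (\<lambda>p. 0)"
  proof (rule integral_dominated_convergence[where w = "\<lambda>_. 2 * K"])
    show "AE p in M. (\<lambda>N. ?f N p) \<longlonglongrightarrow> 0"
      using ev
    proof eventually_elim
      case (elim p)
      then show ?case by (intro tendsto_eventually) (auto elim: eventually_mono)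
    qed
    show "AE p in M. norm (?f N p) \<le> 2 * K" for N
      using bound(1)[of N] bound(2) by eventually_elim auto
  qed (use h g in auto)
  then show "(\<lambda>N. expectation (?f N)) \<longlonglongrightarrow> 0" by simp
  show "expectation (h N) \<le> expectation g + expectation (?f N)" for N
  proof -
    have i: "integrable M (h N)" "integrable M g"
      using h g bound(1)[of N] bound(2) by (auto intro!: integrable_const_bound[where B = K])
    then have "integrable M (?f N)" by auto
    with i have "expectation g + expectation (?f N) = expectation (\<lambda>p. g p + ?f N p)" by simp
    moreover have "expectation (h N) \<le> expectation (\<lambda>p. g p + ?f N p)"
      using i \<open>integrable M (?f N)\<close> by (intro integral_mono) auto
    ultimately show ?thesis by simp
  qed
qed

text \<open>The power with exponent N - 1 is at least 1/e, and e \<le> 3. So before time N the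
  discount 1 - 1/N loses at most a factor 3.\<close>

lemma one_minus_inverse_power_ge:
  assumes "N \<ge> 2" "k < N"
  shows "1 / 3 \<le> (1 - 1 / real N) ^ k"
proof -
  have N: "real N - 1 > 0" using assms by simp
  have "(1 + 1 / (real N - 1)) ^ (N - 1) \<le> exp (1 / (real N - 1)) ^ (N - 1)"
    using N by (intro power_mono exp_ge_add_one_self) auto
  also have "\<dots> = exp 1" using N assms by (simp add: of_nat_diff flip: exp_of_nat_mult)
  also have "\<dots> \<le> 3" by (rule exp_le)
  finally have "1 / 3 \<le> 1 / (1 + 1 / (real N - 1)) ^ (N - 1)"
    using N by (intro divide_left_mono mult_pos_pos zero_less_power add_pos_pos) auto
  also have "\<dots> = (1 - 1 / real N) ^ (N - 1)"
    using N by (simp add: field_simps flip: power_one_over)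
  also have "\<dots> \<le> (1 - 1 / real N) ^ k" using assms by (intro power_decreasing) auto
  finally show ?thesis .
qed

locale random_walk = perturbed_environment \<nu> s1 s2 \<alpha> Bad \<xi>
  for \<nu> :: "(real ^ ('d::finite + 'd)) measure" and s1 s2 \<alpha> Bad \<xi> +
  fixes \<kappa> :: real and \<eta> \<theta> :: nat and \<epsilon> :: real
  assumes in_prob_measures: "\<nu> \<in> prob_measures (Sigma_N \<kappa> \<eta> \<theta>)"
    and close: "\<And>p s. p \<in> space \<nu> \<Longrightarrow> p \<notin> Bad \<Longrightarrow> \<bar>p $ s - \<xi> $ s\<bar> \<le> \<epsilon>"
    and \<epsilon>: "emeasure \<nu> Bad \<le> ennreal \<epsilon>" "0 \<le> \<epsilon>" "\<epsilon> \<le> 1 / 2" "cluster_const CARD('d) \<alpha> * \<epsilon> \<le> 1 / 2"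
begin

abbreviation "J \<equiv> joint_law \<nu>"

sublocale J: prob_space J
  by (rule prob_space_joint_law(1)[OF in_prob_measures])

lemma sets_J: "sets J = sets (EL \<Otimes>\<^sub>M paths)"
  by (rule prob_space_joint_law(2)[OF in_prob_measures])

lemma measurable_J: "f \<in> J \<rightarrow>\<^sub>M N \<longleftrightarrow> f \<in> EL \<Otimes>\<^sub>M paths \<rightarrow>\<^sub>M N"
  using measurable_cong_sets[OF sets_J refl] by auto

lemma space_J: "space J = space EL \<times> UNIV"
  using sets_eq_imp_space_eq[OF sets_J] by (simp add: space_pair_measure)

lemma path_measurable_J [measurable]: "(\<lambda>p. snd p m) \<in> J \<rightarrow>\<^sub>M count_space UNIV"
  unfolding measurable_J by (rule measurable_compose[OF measurable_snd path_component_measurable])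

lemma path_event_J: "A \<in> sets paths \<Longrightarrow> {p. snd p \<in> A} \<inter> space J \<in> sets J"
  using measurable_sets[of snd J paths A] by (simp add: measurable_J vimage_def)

lemma path_indicator_J: "A \<in> sets paths \<Longrightarrow> (\<lambda>p. indicator A (snd p) :: 'b::{real_normed_algebra_1,second_countable_topology}) \<in> borel_measurable J"
  by (rule measurable_compose[where f = snd, OF _ borel_measurable_indicator]) (simp_all add: measurable_J)

lemma site_pair_measurable_J:
  assumes "\<And>u u'. (\<lambda>\<omega>. \<psi> \<omega> u u') \<in> EL \<rightarrow>\<^sub>M N"
  shows "(\<lambda>p. \<psi> (fst p) (snd p m) (snd p m')) \<in> J \<rightarrow>\<^sub>M N"
proof -
  have f: "(\<lambda>p. \<psi> (fst p) u u') \<in> J \<rightarrow>\<^sub>M N" for u u'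
    unfolding measurable_J by (rule measurable_compose[OF measurable_fst assms])
  have "(\<lambda>p. \<psi> (fst p) u (snd p m')) \<in> J \<rightarrow>\<^sub>M N" for u
    by (rule measurable_compose_countable[OF f path_measurable_J])
  then show ?thesis
    by (rule measurable_compose_countable[OF _ path_measurable_J, of "\<lambda>u p. \<psi> (fst p) u (snd p m')"])
qed

lemma bad_site_measurable: "(\<lambda>\<omega>. indicator (bad_sites \<omega>) u :: real) \<in> borel_measurable EL"
proof -
  have "{\<omega> \<in> space EL. u \<in> bad_sites \<omega>} \<in> sets EL" using bad_sites_measurable[of "{u}"] by simp
  then show ?thesis by (rule borel_measurable_indicator')
qed

lemma prefix_weight_measurable: "(\<lambda>\<omega>. prefix_weight \<omega> n x) \<in> borel_measurable EL"
  unfolding prefix_weight_def by measurable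

lemma two_times:
  assumes \<psi>: "\<And>\<omega> u u'. \<omega> \<in> space EL \<Longrightarrow> 0 \<le> \<psi> \<omega> u u'" "\<And>u u'. (\<lambda>\<omega>. \<psi> \<omega> u u') \<in> borel_measurable EL"
  shows "(\<integral>p. indicator (cylinder n x) (snd p) * \<psi> (fst p) (snd p (n + j)) (snd p (Suc (n + j))) \<partial>J) =
    (\<integral>\<omega>. prefix_weight \<omega> n x * (avg \<omega> ^^ j) (\<lambda>u. \<Sum>s\<in>UNIV. \<omega> u $ s * \<psi> \<omega> u (u + nbr s)) (x n) \<partial>EL)"
proof -
  let ?f = "\<lambda>p. indicator (cylinder n x) (snd p) * \<psi> (fst p) (snd p (n + j)) (snd p (Suc (n + j)))"
  let ?g = "\<lambda>\<omega>. prefix_weight \<omega> n x * (avg \<omega> ^^ j) (\<lambda>u. \<Sum>s\<in>UNIV. \<omega> u $ s * \<psi> \<omega> u (u + nbr s)) (x n)"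
  have f: "?f \<in> borel_measurable J"
    by (intro borel_measurable_times path_indicator_J sets_cylinder site_pair_measurable_J \<psi>(2))
  have g: "?g \<in> borel_measurable EL"
    using \<psi>(2) by (intro borel_measurable_times prefix_weight_measurable avg_pow_measurable borel_measurable_sum coordinate_measurable)
  have g0: "0 \<le> ?g \<omega>" if "\<omega> \<in> space EL" for \<omega>
    using prob_vectors_EL[OF that] \<psi>(1)[OF that]
    by (intro mult_nonneg_nonneg prefix_weight_bounds avg_pow_nonneg prob_imp_subprob_vectors sum_nonneg)
       (auto simp: prob_vectors_def)
  have "(\<integral>\<^sup>+p. ennreal (?f p) \<partial>J) = (\<integral>\<^sup>+\<omega>. (\<integral>\<^sup>+X. ennreal (?f (\<omega>, X)) \<partial>quenched_law \<omega>) \<partial>EL)"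
    using f by (intro nn_integral_joint_law[OF in_prob_measures]) (simp add: measurable_J[symmetric])
  also have "\<dots> = (\<integral>\<^sup>+\<omega>. ennreal (?g \<omega>) \<partial>EL)"
  proof (intro nn_integral_cong)
    fix \<omega> assume \<omega>: "\<omega> \<in> space EL"
    have "(\<integral>\<^sup>+X. ennreal (?f (\<omega>, X)) \<partial>quenched_law \<omega>) =
        (\<integral>\<^sup>+X. indicator (cylinder n x) X * ennreal (\<psi> \<omega> (X (n + j)) (X (Suc (n + j)))) \<partial>quenched_law \<omega>)"
      by (intro nn_integral_cong) (simp add: indicator_def)
    then show "(\<integral>\<^sup>+X. ennreal (?f (\<omega>, X)) \<partial>quenched_law \<omega>) = ennreal (?g \<omega>)"
      using quenched_two_times[where \<psi> = "\<psi> \<omega>", OF prob_vectors_EL[OF \<omega>] \<psi>(1)[OF \<omega>]] by simp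
  qed
  finally show ?thesis
    using f g g0 \<psi>(1) by (subst (1 2) integral_eq_nn_integral) (auto simp: space_J)
qed

lemma occupation:
  assumes \<phi>: "\<And>\<omega> u. 0 \<le> \<phi> \<omega> u" "\<And>\<omega> u. \<phi> \<omega> u \<le> 1" "\<And>u. (\<lambda>\<omega>. \<phi> \<omega> u) \<in> borel_measurable EL"
    and r: "0 \<le> r" "r < 1"
  shows "(\<integral>\<^sup>+p. indicator (cylinder n x) (snd p) * (\<Sum>k. ennreal (r ^ k * \<phi> (fst p) (snd p (n + k)))) \<partial>J) =
    (\<integral>\<^sup>+\<omega>. ennreal (prefix_weight \<omega> n x * resolvent \<omega> r (\<phi> \<omega>) (x n)) \<partial>EL)"
proof -
  let ?f = "\<lambda>p. indicator (cylinder n x) (snd p) * (\<Sum>k. ennreal (r ^ k * \<phi> (fst p) (snd p (n + k))))"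
  have "(\<lambda>p. indicator (cylinder n x) (snd p) :: ennreal) \<in> borel_measurable J"
    by (rule measurable_compose[where f = snd and N = paths, OF _ borel_measurable_indicator]) (simp_all add: measurable_J sets_cylinder)
  moreover have "(\<lambda>p. \<phi> (fst p) (snd p m)) \<in> borel_measurable J" for m
    by (rule site_pair_measurable_J[of "\<lambda>\<omega> u u'. \<phi> \<omega> u"]) (rule \<phi>(3))
  ultimately have f: "?f \<in> borel_measurable J"
    by (intro borel_measurable_times_ennreal borel_measurable_suminf_order measurable_compose[OF _ measurable_ennreal]
        borel_measurable_times borel_measurable_const) simp_all
  have "(\<integral>\<^sup>+p. ?f p \<partial>J) = (\<integral>\<^sup>+\<omega>. (\<integral>\<^sup>+X. ?f (\<omega>, X) \<partial>quenched_law \<omega>) \<partial>EL)"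
    using f by (intro nn_integral_joint_law[OF in_prob_measures]) (simp add: measurable_J[symmetric])
  also have "\<dots> = (\<integral>\<^sup>+\<omega>. ennreal (prefix_weight \<omega> n x * resolvent \<omega> r (\<phi> \<omega>) (x n)) \<partial>EL)"
  proof (intro nn_integral_cong)
    fix \<omega> assume \<omega>: "\<omega> \<in> space EL"
    show "(\<integral>\<^sup>+X. ?f (\<omega>, X) \<partial>quenched_law \<omega>) = ennreal (prefix_weight \<omega> n x * resolvent \<omega> r (\<phi> \<omega>) (x n))"
      using quenched_occupation[where \<phi> = "\<phi> \<omega>", OF prob_vectors_EL[OF \<omega>] \<phi>(1,2) r] by simp
  qed
  finally show ?thesis .
qed

text \<open>\<open>bad_site_estimate\<close> is summed over the sites of F, with the weight of the
  path x as \<open>w\<close>. By \<open>avoid\<close> this weight does not involve the environment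
  in the cubes around F. The last term accounts for sites that are not sparsely surrounded even at
  scale I, with the trivial bound 1 / (1 - r) for their Green function.\<close>

lemma bad_occupation_le:
  assumes F: "finite F" and r: "1 / 2 \<le> r" "r < 1"
    and avoid: "\<And>y k. y \<in> F \<Longrightarrow> k < n \<Longrightarrow> x k \<notin> cube y ((2 * CARD('d) + 9) ^ I)"
  shows "(\<integral>\<^sup>+p. indicator (cylinder n x) (snd p) * (\<Sum>k. ennreal (r ^ k * indicator (F \<inter> bad_sites (fst p)) (snd p (n + k)))) \<partial>J)
    \<le> ennreal (2 * (cluster_const CARD('d) \<alpha> * \<epsilon>)) *
        (\<integral>\<^sup>+p. indicator (cylinder n x) (snd p) * (\<Sum>k. ennreal (r ^ k * indicator F (snd p (n + k)))) \<partial>J)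
      + ennreal (card F * (1 / 2) ^ ((2 * CARD('d) + 9) ^ I) / (1 - r))"
proof -
  let ?b = "(2 * CARD('d) + 9) ^ I" and ?C = "2 * (cluster_const CARD('d) \<alpha> * \<epsilon>)"
  let ?w = "\<lambda>\<omega>. prefix_weight \<omega> n x" and ?g = "\<lambda>\<omega> y. green \<omega> r (x n) y"
  have r': "0 \<le> r" using r by simp
  have res: "resolvent \<omega> r (indicator (F \<inter> B)) (x n) = (\<Sum>y\<in>F. indicator B y * ?g \<omega> y)"
    if \<omega>: "\<omega> \<in> space EL" for \<omega> B
  proof -
    note sub = prob_imp_subprob_vectors[OF prob_vectors_EL[OF \<omega>]]
    have "indicator (F \<inter> B) = (\<lambda>z. \<Sum>y\<in>F. indicator B y * indicator {y} z :: real)"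
      using F by (auto simp: fun_eq_iff indicator_def sum.delta if_distrib cong: if_cong)
    then have "resolvent \<omega> r (indicator (F \<inter> B)) (x n) = (\<Sum>y\<in>F. resolvent \<omega> r (\<lambda>z. indicator B y * indicator {y} z) (x n))"
      using resolvent_sum[OF sub r' r(2), of "\<lambda>y z. indicator B y * indicator {y} z" "\<lambda>_. 1" F "x n"] by (simp add: indicator_def)
    also have "\<dots> = (\<Sum>y\<in>F. indicator B y * ?g \<omega> y)"
      unfolding green_def by (intro sum.cong refl resolvent_cmult[OF sub r' r(2), of _ 1]) (simp add: indicator_def)
    finally show ?thesis .
  qed
  have w: "?w \<in> borel_measurable EL" "\<And>\<omega>. \<omega> \<in> space EL \<Longrightarrow> 0 \<le> ?w \<omega>" "\<And>\<omega>. \<omega> \<in> space EL \<Longrightarrow> ?w \<omega> \<le> 1"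
    using prefix_weight_measurable prefix_weight_bounds[OF prob_vectors_EL] by auto
  have g: "0 \<le> ?g \<omega> y" "?g \<omega> y \<le> 1 / (1 - r)" if "\<omega> \<in> space EL" for \<omega> y
    using resolvent_nonneg[OF prob_imp_subprob_vectors[OF prob_vectors_EL[OF that]] r' r(2), of "indicator {y}" 1 "x n"]
      resolvent_le[OF prob_imp_subprob_vectors[OF prob_vectors_EL[OF that]] r' r(2), of "indicator {y}" 1 "x n"]
    by (auto simp: green_def indicator_def)
  have wg: "(\<lambda>\<omega>. ennreal (?w \<omega> * ?g \<omega> y)) \<in> borel_measurable EL" for y
    by (intro measurable_compose[OF _ measurable_ennreal] borel_measurable_times w green_measurable)
  have N: "{\<omega> \<in> space EL. \<not> sparsely_bad (CARD('d) + 4) ?b y (bad_sites \<omega>)} \<in> sets EL" for y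
  proof -
    have "space EL - {\<omega> \<in> space EL. sparsely_bad (CARD('d) + 4) ?b y (bad_sites \<omega> \<union> {})} \<in> sets EL"
      by (intro sets.compl_sets sparsely_bad_measurable)
    also have "space EL - {\<omega> \<in> space EL. sparsely_bad (CARD('d) + 4) ?b y (bad_sites \<omega> \<union> {})} = {\<omega> \<in> space EL. \<not> sparsely_bad (CARD('d) + 4) ?b y (bad_sites \<omega>)}"
      by auto
    finally show ?thesis .
  qed
  have "(\<integral>\<^sup>+p. indicator (cylinder n x) (snd p) * (\<Sum>k. ennreal (r ^ k * indicator (F \<inter> bad_sites (fst p)) (snd p (n + k)))) \<partial>J)
      = (\<integral>\<^sup>+\<omega>. ennreal (?w \<omega> * resolvent \<omega> r (indicator (F \<inter> bad_sites \<omega>)) (x n)) \<partial>EL)"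
  proof (rule occupation[OF _ _ _ r' r(2)])
    have "(\<lambda>\<omega>. indicator F u * indicator (bad_sites \<omega>) u :: real) \<in> borel_measurable EL" for u
      using bad_site_measurable by measurable
    then show "(\<lambda>\<omega>. indicator (F \<inter> bad_sites \<omega>) u :: real) \<in> borel_measurable EL" for u
      by (simp add: indicator_inter_arith)
  qed (auto simp: indicator_def)
  also have "\<dots> = (\<integral>\<^sup>+\<omega>. (\<Sum>y\<in>F. ennreal (?w \<omega> * ?g \<omega> y) * indicator {\<omega>. y \<in> bad_sites \<omega>} \<omega>) \<partial>EL)"
  proof (intro nn_integral_cong)
    fix \<omega> assume \<omega>: "\<omega> \<in> space EL"
    have "?w \<omega> * resolvent \<omega> r (indicator (F \<inter> bad_sites \<omega>)) (x n) = (\<Sum>y\<in>F. (?w \<omega> * ?g \<omega> y) * indicator (bad_sites \<omega>) y)"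
      unfolding res[OF \<omega>] by (simp add: sum_distrib_left mult_ac)
    also have "ennreal \<dots> = (\<Sum>y\<in>F. ennreal ((?w \<omega> * ?g \<omega> y) * indicator (bad_sites \<omega>) y))"
      using w g \<omega> by (intro sum_ennreal[symmetric]) simp
    also have "\<dots> = (\<Sum>y\<in>F. ennreal (?w \<omega> * ?g \<omega> y) * indicator {\<omega>. y \<in> bad_sites \<omega>} \<omega>)"
      by (intro sum.cong) (auto simp: indicator_def)
    finally show "ennreal (?w \<omega> * resolvent \<omega> r (indicator (F \<inter> bad_sites \<omega>)) (x n)) = \<dots>" .
  qed
  also have "\<dots> = (\<Sum>y\<in>F. \<integral>\<^sup>+\<omega>. ennreal (?w \<omega> * ?g \<omega> y) * indicator {\<omega>. y \<in> bad_sites \<omega>} \<omega> \<partial>EL)"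
    using wg bad_sites_measurable[of "{_}"]
    by (intro nn_integral_sum borel_measurable_times_ennreal borel_measurable_indicator') auto
  also have "\<dots> \<le> (\<Sum>y\<in>F. ennreal ?C * (\<integral>\<^sup>+\<omega>. ennreal (?w \<omega> * ?g \<omega> y) \<partial>EL) + ennreal ((1 / 2) ^ ?b / (1 - r)))"
  proof (intro sum_mono)
    fix y assume y: "y \<in> F"
    have "(\<integral>\<^sup>+\<omega>. ennreal (?w \<omega> * ?g \<omega> y) * indicator {\<omega>. \<not> sparsely_bad (CARD('d) + 4) ?b y (bad_sites \<omega>)} \<omega> \<partial>EL)
        \<le> (\<integral>\<^sup>+\<omega>. ennreal (1 / (1 - r)) * indicator {\<omega> \<in> space EL. \<not> sparsely_bad (CARD('d) + 4) ?b y (bad_sites \<omega>)} \<omega> \<partial>EL)"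
    proof (intro nn_integral_mono)
      fix \<omega> assume \<omega>: "\<omega> \<in> space EL"
      have "?w \<omega> * ?g \<omega> y \<le> 1 * (1 / (1 - r))" using w g \<omega> by (intro mult_mono) auto
      then show "ennreal (?w \<omega> * ?g \<omega> y) * indicator {\<omega>. \<not> sparsely_bad (CARD('d) + 4) ?b y (bad_sites \<omega>)} \<omega>
          \<le> ennreal (1 / (1 - r)) * indicator {\<omega> \<in> space EL. \<not> sparsely_bad (CARD('d) + 4) ?b y (bad_sites \<omega>)} \<omega>"
        using \<omega> by (auto simp: indicator_def intro: ennreal_leI)
    qed
    also have "\<dots> = ennreal (1 / (1 - r)) * emeasure EL {\<omega> \<in> space EL. \<not> sparsely_bad (CARD('d) + 4) ?b y (bad_sites \<omega>)}"
      using N by (rule nn_integral_cmult_indicator)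
    also have "\<dots> \<le> ennreal (1 / (1 - r)) * ennreal ((1 / 2) ^ ?b)"
      by (intro mult_left_mono not_sparse_prob[OF _ \<epsilon>(1,2,4)]) auto
    also have "\<dots> = ennreal ((1 / 2) ^ ?b / (1 - r))" using r by (simp add: ennreal_mult'[symmetric])
    finally have err: "(\<integral>\<^sup>+\<omega>. ennreal (?w \<omega> * ?g \<omega> y) * indicator {\<omega>. \<not> sparsely_bad (CARD('d) + 4) ?b y (bad_sites \<omega>)} \<omega> \<partial>EL)
        \<le> ennreal ((1 / 2) ^ ?b / (1 - r))" .
    have inv: "?w (fun_upd \<omega> a p) = ?w \<omega>" if "a \<in> cube y ?b" for a \<omega> p
    proof -
      have "x k \<noteq> a" if "k < n" for k using avoid[OF y that] \<open>a \<in> cube y ?b\<close> by auto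
      then show ?thesis by (simp add: prefix_weight_def)
    qed
    show "(\<integral>\<^sup>+\<omega>. ennreal (?w \<omega> * ?g \<omega> y) * indicator {\<omega>. y \<in> bad_sites \<omega>} \<omega> \<partial>EL)
        \<le> ennreal ?C * (\<integral>\<^sup>+\<omega>. ennreal (?w \<omega> * ?g \<omega> y) \<partial>EL) + ennreal ((1 / 2) ^ ?b / (1 - r))"
      by (rule order_trans[OF bad_site_estimate[OF r w(1,2) inv \<epsilon>] add_left_mono[OF err]])
  qed
  also have "\<dots> = ennreal ?C * (\<Sum>y\<in>F. \<integral>\<^sup>+\<omega>. ennreal (?w \<omega> * ?g \<omega> y) \<partial>EL) + ennreal (card F * (1 / 2) ^ ?b / (1 - r))"
    using r by (simp add: sum.distrib sum_distrib_left ennreal_of_nat_eq_real_of_nat ennreal_mult'[symmetric])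
  also have "(\<Sum>y\<in>F. \<integral>\<^sup>+\<omega>. ennreal (?w \<omega> * ?g \<omega> y) \<partial>EL) = (\<integral>\<^sup>+\<omega>. (\<Sum>y\<in>F. ennreal (?w \<omega> * ?g \<omega> y)) \<partial>EL)"
    using wg by (intro nn_integral_sum[symmetric])
  also have "\<dots> = (\<integral>\<^sup>+\<omega>. ennreal (?w \<omega> * resolvent \<omega> r (indicator F) (x n)) \<partial>EL)"
  proof (intro nn_integral_cong)
    fix \<omega> assume \<omega>: "\<omega> \<in> space EL"
    have "(\<Sum>y\<in>F. ennreal (?w \<omega> * ?g \<omega> y)) = ennreal (\<Sum>y\<in>F. ?w \<omega> * ?g \<omega> y)"
      using w g \<omega> by (intro sum_ennreal) simp
    then show "(\<Sum>y\<in>F. ennreal (?w \<omega> * ?g \<omega> y)) = ennreal (?w \<omega> * resolvent \<omega> r (indicator F) (x n))"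
      using res[OF \<omega>, of UNIV] by (simp add: sum_distrib_left)
  qed
  also have "\<dots> = (\<integral>\<^sup>+p. indicator (cylinder n x) (snd p) * (\<Sum>k. ennreal (r ^ k * indicator F (snd p (n + k)))) \<partial>J)"
    by (rule occupation[OF _ _ _ r' r(2), symmetric]) (auto simp: indicator_def)
  finally show ?thesis .
qed

end

section \<open>Drift estimates\<close>

lemma neighbour_path_bound:
  fixes X :: "nat \<Rightarrow> int ^ 'd::finite"
  assumes "\<forall>k. \<exists>s. X (Suc k) = X k + nbr s"
  shows "\<bar>X (Suc k) $ i - X k $ i\<bar> \<le> 1" "\<bar>X (m + k) $ i - X m $ i\<bar> \<le> int k" "X (m + k) \<in> cube (X m) k"
proof -
  show 1: "\<bar>X (Suc k) $ i - X k $ i\<bar> \<le> 1" for k i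
  proof -
    obtain s where "X (Suc k) = X k + nbr s" using assms by blast
    then show ?thesis using orientation_cases[of s] by (auto simp: nbr_nth)
  qed
  show 2: "\<bar>X (m + k) $ i - X m $ i\<bar> \<le> int k" for i
  proof (induction k)
    case (Suc k)
    then show ?case using 1[of "m + k" i] by simp
  qed simp
  show "X (m + k) \<in> cube (X m) k" using 2 by (simp add: cube_def)
qed

context random_walk
begin

lemma AE_neighbour: "AE p in J. snd p 0 = 0 \<and> (\<forall>k. \<exists>s. snd p (Suc k) = snd p k + nbr s)"
  by (rule AE_joint_law_neighbour[OF in_prob_measures])

lemma site_measurable_J:
  "(\<And>u. (\<lambda>\<omega>. \<phi> \<omega> u) \<in> borel_measurable EL) \<Longrightarrow> (\<lambda>p. \<phi> (fst p) (snd p m) :: real) \<in> borel_measurable J"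
  by (rule site_pair_measurable_J[of "\<lambda>\<omega> u u'. \<phi> \<omega> u"]) simp

lemma bad_indicator_measurable: "(\<lambda>\<omega>. indicator (F \<inter> bad_sites \<omega>) u :: real) \<in> borel_measurable EL"
proof -
  have "(\<lambda>\<omega>. indicator F u * indicator (bad_sites \<omega>) u :: real) \<in> borel_measurable EL"
    using bad_site_measurable by measurable
  then show ?thesis by (simp add: indicator_inter_arith)
qed

lemma AE_in_space: "AE p in J. fst p \<in> space EL"
  by (rule AE_I2) (auto simp: space_J)

text \<open>Up to time N the discount r = 1 - 1/N is at least 1/3, so undiscounted visits are at
  most 3 times the discounted ones. On the right-hand side the discounted visits of F at all times
  remain; therefore late visits of F have to be controlled later on as well.\<close>

lemma bad_fraction_le:
  assumes F: "finite F" and N: "N \<ge> 2"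
    and avoid: "\<And>y k. y \<in> F \<Longrightarrow> k < n \<Longrightarrow> x k \<notin> cube y ((2 * CARD('d) + 9) ^ I)"
  shows "(\<integral>p. indicator (cylinder n x) (snd p) * (\<Sum>k<N. indicator (F \<inter> bad_sites (fst p)) (snd p (n + k))) \<partial>J)
    \<le> 3 * (2 * (cluster_const CARD('d) \<alpha> * \<epsilon>) *
        (\<integral>p. indicator (cylinder n x) (snd p) * (\<Sum>k. (1 - 1 / N) ^ k * indicator F (snd p (n + k))) \<partial>J)
      + N * (card F * (1 / 2) ^ ((2 * CARD('d) + 9) ^ I)))"
proof -
  let ?b = "(2 * CARD('d) + 9) ^ I"
  define r where "r = 1 - 1 / real N"
  have r: "1 / 2 \<le> r" "r < 1" "0 \<le> r" "1 - r = 1 / N" using N by (auto simp: r_def field_simps)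
  define C where "C = 2 * (cluster_const CARD('d) \<alpha> * \<epsilon>)"
  have C0: "0 \<le> C" using \<epsilon> cluster_const_nonneg[OF \<alpha>] by (simp add: C_def)
  let ?I = "\<lambda>p. indicator (cylinder n x) (snd p) :: real"
  let ?bad = "\<lambda>p k. indicator (F \<inter> bad_sites (fst p)) (snd p (n + k)) :: real"
  let ?vis = "\<lambda>p k. indicator F (snd p (n + k)) :: real"
  let ?o = "\<lambda>p. ?I p * (\<Sum>k. r ^ k * ?vis p k)"
  have sum: "summable (\<lambda>k. r ^ k * ?vis p k)" for p
    by (rule summable_comparison_test'[of "\<lambda>k. r ^ k" 0]) (use r in \<open>auto simp: indicator_def intro!: summable_geometric\<close>)
  have o_bounds: "0 \<le> ?o p" "?o p \<le> N" for p
  proof -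
    show "0 \<le> ?o p" using r by (intro mult_nonneg_nonneg suminf_nonneg sum) auto
    have "(\<Sum>k. r ^ k * ?vis p k) \<le> (\<Sum>k. r ^ k)"
      by (intro suminf_le sum summable_geometric) (use r in \<open>auto simp: indicator_def\<close>)
    also have "\<dots> = N" using r by (simp add: suminf_geometric)
    finally show "?o p \<le> N" using N by (auto simp: indicator_def)
  qed
  have meas_bad: "(\<lambda>p. ?bad p k) \<in> borel_measurable J" for k
    by (rule site_measurable_J) (rule bad_indicator_measurable)
  have meas_vis: "(\<lambda>p. ?vis p k) \<in> borel_measurable J" for k
    by (rule site_measurable_J) simp
  have meas_I: "?I \<in> borel_measurable J" by (intro path_indicator_J sets_cylinder)
  have meas_o: "?o \<in> borel_measurable J"
    by (intro borel_measurable_times borel_measurable_suminf meas_I meas_vis borel_measurable_const)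
  have int_o: "integrable J ?o"
    by (rule J.integrable_const_bound[where B = "real N"]) (use o_bounds meas_o in \<open>auto simp: abs_of_nonneg\<close>)
  have Occ: "(\<integral>\<^sup>+p. indicator (cylinder n x) (snd p) * (\<Sum>k. ennreal (r ^ k * ?vis p k)) \<partial>J) = ennreal (\<integral>p. ?o p \<partial>J)"
  proof -
    have "indicator (cylinder n x) (snd p) * (\<Sum>k. ennreal (r ^ k * ?vis p k)) = ennreal (?o p)" for p
    proof -
      have "(\<Sum>k. ennreal (r ^ k * ?vis p k)) = ennreal (\<Sum>k. r ^ k * ?vis p k)"
        by (intro suminf_ennreal2 sum) (use r in auto)
      then show ?thesis by (auto simp: indicator_def)
    qed
    then have "(\<integral>\<^sup>+p. indicator (cylinder n x) (snd p) * (\<Sum>k. ennreal (r ^ k * ?vis p k)) \<partial>J) = (\<integral>\<^sup>+p. ennreal (?o p) \<partial>J)"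
      by (intro nn_integral_cong)
    also have "\<dots> = ennreal (\<integral>p. ?o p \<partial>J)"
      by (rule nn_integral_eq_integral[OF int_o]) (use o_bounds in auto)
    finally show ?thesis .
  qed
  have "ennreal (\<integral>p. ?I p * (\<Sum>k<N. ?bad p k) \<partial>J) = (\<integral>\<^sup>+p. ennreal (?I p * (\<Sum>k<N. ?bad p k)) \<partial>J)"
  proof (intro nn_integral_eq_integral[symmetric] J.integrable_const_bound[where B = "real N"])
    have "(\<Sum>k<N. ?bad p k) \<le> (\<Sum>k<N. 1)" for p by (intro sum_mono) (simp add: indicator_def)
    then show "AE p in J. norm (?I p * (\<Sum>k<N. ?bad p k)) \<le> real N"
      by (intro AE_I2) (auto simp: indicator_def abs_of_nonneg sum_nonneg)
    show "(\<lambda>p. ?I p * (\<Sum>k<N. ?bad p k)) \<in> borel_measurable J"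
      by (intro borel_measurable_times borel_measurable_sum meas_I meas_bad)
  qed (auto intro!: AE_I2 mult_nonneg_nonneg sum_nonneg)
  also have "\<dots> \<le> (\<integral>\<^sup>+p. 3 * (indicator (cylinder n x) (snd p) * (\<Sum>k. ennreal (r ^ k * ?bad p k))) \<partial>J)"
  proof (intro nn_integral_mono)
    fix p
    have "ennreal (\<Sum>k<N. ?bad p k) = (\<Sum>k<N. ennreal (?bad p k))" by (rule sum_ennreal[symmetric]) simp
    also have "\<dots> \<le> (\<Sum>k<N. 3 * ennreal (r ^ k * ?bad p k))"
    proof (intro sum_mono)
      fix k assume "k \<in> {..<N}"
      then have "1 / 3 \<le> r ^ k" using one_minus_inverse_power_ge[OF N, of k] by (simp add: r_def)
      then have "?bad p k \<le> 3 * (r ^ k * ?bad p k)" by (auto simp: indicator_def)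
      then have "ennreal (?bad p k) \<le> ennreal (3 * (r ^ k * ?bad p k))" by (rule ennreal_leI)
      also have "\<dots> = 3 * ennreal (r ^ k * ?bad p k)" using r by (subst ennreal_mult) auto
      finally show "ennreal (?bad p k) \<le> 3 * ennreal (r ^ k * ?bad p k)" .
    qed
    also have "\<dots> = 3 * (\<Sum>k<N. ennreal (r ^ k * ?bad p k))" by (simp add: sum_distrib_left)
    also have "\<dots> \<le> 3 * (\<Sum>k. ennreal (r ^ k * ?bad p k))" by (intro mult_left_mono sum_le_suminf) auto
    finally show "ennreal (?I p * (\<Sum>k<N. ?bad p k)) \<le> 3 * (indicator (cylinder n x) (snd p) * (\<Sum>k. ennreal (r ^ k * ?bad p k)))"
      by (auto simp: indicator_def[of "cylinder n x"])
  qed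
  also have "\<dots> = 3 * (\<integral>\<^sup>+p. indicator (cylinder n x) (snd p) * (\<Sum>k. ennreal (r ^ k * ?bad p k)) \<partial>J)"
  proof (rule nn_integral_cmult)
    have "(\<lambda>p. indicator (cylinder n x) (snd p) :: ennreal) \<in> borel_measurable J"
      by (rule measurable_compose[where f = snd and N = paths, OF _ borel_measurable_indicator]) (simp_all add: measurable_J sets_cylinder)
    then show "(\<lambda>p. indicator (cylinder n x) (snd p) * (\<Sum>k. ennreal (r ^ k * ?bad p k))) \<in> borel_measurable J"
      by (intro borel_measurable_times_ennreal borel_measurable_suminf_order measurable_compose[OF _ measurable_ennreal]
        borel_measurable_times borel_measurable_const meas_bad)
  qed
  also have "\<dots> \<le> 3 * (ennreal C * ennreal (\<integral>p. ?o p \<partial>J) + ennreal (card F * (1 / 2) ^ ?b / (1 - r)))"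
    unfolding Occ[symmetric] C_def by (intro mult_left_mono bad_occupation_le F r avoid) auto
  also have "\<dots> = ennreal (3 * (C * (\<integral>p. ?o p \<partial>J) + N * (card F * (1 / 2) ^ ?b)))"
  proof -
    have "ennreal C * ennreal (\<integral>p. ?o p \<partial>J) + ennreal (card F * (1 / 2) ^ ?b / (1 - r)) = ennreal (C * (\<integral>p. ?o p \<partial>J) + N * (card F * (1 / 2) ^ ?b))"
      using C0 o_bounds r(4) by (subst ennreal_mult[symmetric]) (auto simp: ennreal_plus[symmetric] mult_ac simp del: ennreal_plus)
    then show ?thesis using C0 o_bounds by (simp only:) (subst ennreal_mult, auto)
  qed
  finally have "(\<integral>p. ?I p * (\<Sum>k<N. ?bad p k) \<partial>J) \<le> 3 * (C * (\<integral>p. ?o p \<partial>J) + N * (card F * (1 / 2) ^ ?b))"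
    using C0 o_bounds by (subst (asm) ennreal_le_iff) (auto intro!: mult_nonneg_nonneg add_nonneg_nonneg)
  then show ?thesis by (simp only: C_def r_def)
qed

text \<open>By \<open>two_times\<close> a step may be replaced by its probability at the present
  site. At good sites this probability is within \<epsilon> of the entry of \<xi>, at bad sites
  within 1, and an increment of coordinate i involves two opposite directions: hence the factors
  2.\<close>

lemma drift_estimate:
  shows "\<bar>(\<integral>p. indicator (cylinder n x) (snd p) * (\<Sum>k<N. indicator F (snd p (n + k)) * real_of_int (snd p (Suc (n + k)) $ i - snd p (n + k) $ i)) \<partial>J)
      - (\<xi> $ Inl i - \<xi> $ Inr i) * (\<integral>p. indicator (cylinder n x) (snd p) * (\<Sum>k<N. indicator F (snd p (n + k))) \<partial>J)\<bar>
    \<le> 2 * \<epsilon> * (\<integral>p. indicator (cylinder n x) (snd p) * (\<Sum>k<N. indicator F (snd p (n + k))) \<partial>J)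
      + 2 * (\<integral>p. indicator (cylinder n x) (snd p) * (\<Sum>k<N. indicator (F \<inter> bad_sites (fst p)) (snd p (n + k))) \<partial>J)"
proof -
  let ?I = "\<lambda>p. indicator (cylinder n x) (snd p) :: real"
  let ?bad = "\<lambda>p k. indicator (F \<inter> bad_sites (fst p)) (snd p (n + k)) :: real"
  let ?vis = "\<lambda>p k. indicator F (snd p (n + k)) :: real"
  let ?\<Delta> = "\<lambda>p k. real_of_int (snd p (Suc (n + k)) $ i - snd p (n + k) $ i)"
  let ?st = "\<lambda>s p k. of_bool (snd p (Suc (n + k)) = snd p (n + k) + nbr s) :: real"
  let ?om = "\<lambda>s p k. fst p (snd p (n + k)) $ s"
  let ?v = "\<xi> $ Inl i - \<xi> $ Inr i"
  have meas_I: "?I \<in> borel_measurable J" by (intro path_indicator_J sets_cylinder)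
  have meas_bad: "(\<lambda>p. ?bad p k) \<in> borel_measurable J" for k
    by (rule site_measurable_J) (rule bad_indicator_measurable)
  have meas_vis: "(\<lambda>p. ?vis p k) \<in> borel_measurable J" for k by (rule site_measurable_J) simp
  have meas_om: "(\<lambda>p. ?om s p k) \<in> borel_measurable J" for s k by (rule site_measurable_J) (rule coordinate_measurable)
  have meas_st: "(\<lambda>p. ?st s p k) \<in> borel_measurable J" for s k
    by (rule site_pair_measurable_J[of "\<lambda>\<omega> u u'. of_bool (u' = u + nbr s)"]) simp
  have om01: "0 \<le> p $ s" "p $ s \<le> 1" if "p \<in> space \<nu>" for p s
    using prob_vector[OF that] member_le_sum[of s UNIV "($) p"] by auto
  have AE_om: "AE p in J. \<forall>s k. 0 \<le> ?om s p k \<and> ?om s p k \<le> 1"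
    using AE_in_space by eventually_elim (auto simp: space_EL om01)
  have step: "(\<integral>p. ?I p * (?vis p k * ?st s p k) \<partial>J) = (\<integral>p. ?I p * (?vis p k * ?om s p k) \<partial>J)" for s k
  proof -
    have "(\<integral>p. ?I p * (?vis p k * ?st s p k) \<partial>J) =
      (\<integral>\<omega>. prefix_weight \<omega> n x * (avg \<omega> ^^ k) (\<lambda>u. \<Sum>s'\<in>UNIV. \<omega> u $ s' * (indicator F u * of_bool (u + nbr s' = u + nbr s))) (x n) \<partial>EL)"
      by (rule two_times[of "\<lambda>\<omega> u u'. indicator F u * of_bool (u' = u + nbr s)"]) auto
    also have "\<dots> = (\<integral>\<omega>. prefix_weight \<omega> n x * (avg \<omega> ^^ k) (\<lambda>u. \<Sum>s'\<in>UNIV. \<omega> u $ s' * (indicator F u * \<omega> u $ s)) (x n) \<partial>EL)"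
    proof (intro Bochner_Integration.integral_cong refl)
      fix \<omega> assume "\<omega> \<in> space EL"
      then have pv: "prob_vectors \<omega>" by (rule prob_vectors_EL)
      have "(\<Sum>s'\<in>UNIV. \<omega> u $ s' * (indicator F u * of_bool (u + nbr s' = u + nbr s))) = (\<Sum>s'\<in>UNIV. if s' = s then \<omega> u $ s * indicator F u else 0)" for u
        by (intro sum.cong) (auto simp: inj_nbr)
      moreover have "(\<Sum>s'\<in>UNIV. \<omega> u $ s' * (indicator F u * \<omega> u $ s)) = indicator F u * \<omega> u $ s" for u
        using pv by (simp add: prob_vectors_def flip: sum_distrib_right)
      ultimately show "prefix_weight \<omega> n x * (avg \<omega> ^^ k) (\<lambda>u. \<Sum>s'\<in>UNIV. \<omega> u $ s' * (indicator F u * of_bool (u + nbr s' = u + nbr s))) (x n)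
          = prefix_weight \<omega> n x * (avg \<omega> ^^ k) (\<lambda>u. \<Sum>s'\<in>UNIV. \<omega> u $ s' * (indicator F u * \<omega> u $ s)) (x n)"
        by (simp add: mult.commute)
    qed
    also have "\<dots> = (\<integral>p. ?I p * (?vis p k * ?om s p k) \<partial>J)"
      by (rule two_times[of "\<lambda>\<omega> u u'. indicator F u * \<omega> u $ s", symmetric]) (auto simp: space_EL om01)
    finally show ?thesis .
  qed
  have int1: "integrable J (\<lambda>p. ?I p * (?vis p k * ?st s p k))" for s k
  proof (rule J.integrable_const_bound[where B = 1])
    show "(\<lambda>p. ?I p * (?vis p k * ?st s p k)) \<in> borel_measurable J"
      by (intro borel_measurable_times meas_I meas_vis meas_st)
  qed (auto simp: indicator_def)
  have int2: "integrable J (\<lambda>p. ?I p * (?vis p k * ?om s p k))" for s k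
  proof (rule J.integrable_const_bound[where B = 1])
    show "AE p in J. norm (?I p * (?vis p k * ?om s p k)) \<le> 1"
      using AE_om by eventually_elim (auto simp: indicator_def)
  qed (intro borel_measurable_times meas_I meas_vis meas_om)
  have int3: "integrable J (\<lambda>p. ?I p * ?vis p k)" "integrable J (\<lambda>p. ?I p * ?bad p k)" for k
  proof -
    have "(\<lambda>p. ?I p * ?vis p k) \<in> borel_measurable J" "(\<lambda>p. ?I p * ?bad p k) \<in> borel_measurable J"
      by (intro borel_measurable_times meas_I meas_vis meas_bad)+
    note m = this
    show "integrable J (\<lambda>p. ?I p * ?vis p k)"
      by (rule J.integrable_const_bound[OF _ m(1), where B = 1]) (simp add: indicator_def)
    show "integrable J (\<lambda>p. ?I p * ?bad p k)"
      by (rule J.integrable_const_bound[OF _ m(2), where B = 1]) (simp add: indicator_def)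
  qed
  have "(\<integral>p. ?I p * (\<Sum>k<N. ?vis p k * ?\<Delta> p k) \<partial>J) = (\<integral>p. (\<Sum>k<N. ?I p * (?vis p k * ?st (Inl i) p k) - ?I p * (?vis p k * ?st (Inr i) p k)) \<partial>J)"
  proof (rule integral_cong_AE)
    show "AE p in J. ?I p * (\<Sum>k<N. ?vis p k * ?\<Delta> p k) = (\<Sum>k<N. ?I p * (?vis p k * ?st (Inl i) p k) - ?I p * (?vis p k * ?st (Inr i) p k))"
      using AE_neighbour
    proof eventually_elim
      case (elim p)
      have "?\<Delta> p k = ?st (Inl i) p k - ?st (Inr i) p k" for k
      proof -
        obtain s where s: "snd p (Suc (n + k)) = snd p (n + k) + nbr s" using elim by blast
        show ?thesis unfolding s by (cases s) (auto simp: inj_nbr, auto simp: nbr_nth axis_of_def orientation_def)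
      qed
      note \<Delta> = this
      show ?case unfolding \<Delta> sum_distrib_left by (intro sum.cong) (simp_all only: right_diff_distrib)
    qed
    show "(\<lambda>p. ?I p * (\<Sum>k<N. ?vis p k * ?\<Delta> p k)) \<in> borel_measurable J"
    proof (intro borel_measurable_times borel_measurable_sum meas_I meas_vis)
      show "(\<lambda>p. ?\<Delta> p k) \<in> borel_measurable J" for k
        by (rule site_pair_measurable_J[of "\<lambda>\<omega> u u'. real_of_int (u' $ i - u $ i)"]) simp
    qed
    show "(\<lambda>p. \<Sum>k<N. ?I p * (?vis p k * ?st (Inl i) p k) - ?I p * (?vis p k * ?st (Inr i) p k)) \<in> borel_measurable J"
      using int1 by (intro borel_measurable_sum borel_measurable_diff) auto
  qed
  also have "\<dots> = (\<Sum>k<N. (\<integral>p. ?I p * (?vis p k * ?om (Inl i) p k) \<partial>J) - (\<integral>p. ?I p * (?vis p k * ?om (Inr i) p k) \<partial>J))"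
    using int1 by (simp add: step)
  finally have 1: "(\<integral>p. ?I p * (\<Sum>k<N. ?vis p k * ?\<Delta> p k) \<partial>J) = \<dots>" .
  have 2: "(\<integral>p. ?I p * (\<Sum>k<N. ?vis p k) \<partial>J) = (\<Sum>k<N. \<integral>p. ?I p * ?vis p k \<partial>J)"
    unfolding sum_distrib_left by (rule Bochner_Integration.integral_sum) (rule int3)
  have 3: "(\<integral>p. ?I p * (\<Sum>k<N. ?bad p k) \<partial>J) = (\<Sum>k<N. \<integral>p. ?I p * ?bad p k \<partial>J)"
    unfolding sum_distrib_left by (rule Bochner_Integration.integral_sum) (rule int3)
  have increment: "\<bar>(\<integral>p. ?I p * (?vis p k * ?om (Inl i) p k) \<partial>J) - (\<integral>p. ?I p * (?vis p k * ?om (Inr i) p k) \<partial>J) - ?v * (\<integral>p. ?I p * ?vis p k \<partial>J)\<bar>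
      \<le> 2 * \<epsilon> * (\<integral>p. ?I p * ?vis p k \<partial>J) + 2 * (\<integral>p. ?I p * ?bad p k \<partial>J)" for k
  proof -
    let ?h = "\<lambda>p. ?I p * (?vis p k * ?om (Inl i) p k) - ?I p * (?vis p k * ?om (Inr i) p k) - ?v * (?I p * ?vis p k)"
    have "\<bar>(\<integral>p. ?h p \<partial>J)\<bar> \<le> (\<integral>p. \<bar>?h p\<bar> \<partial>J)" by (rule integral_abs_bound)
    also have "\<dots> \<le> (\<integral>p. 2 * \<epsilon> * (?I p * ?vis p k) + 2 * (?I p * ?bad p k) \<partial>J)"
    proof (rule integral_mono_AE)
      show "AE p in J. \<bar>?h p\<bar> \<le> 2 * \<epsilon> * (?I p * ?vis p k) + 2 * (?I p * ?bad p k)"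
        using AE_in_space
      proof eventually_elim
        case (elim p)
        let ?u = "snd p (n + k)"
        have u: "fst p ?u \<in> space \<nu>" using elim by (simp add: space_EL)
        have "\<bar>?om s p k - \<xi> $ s\<bar> \<le> \<epsilon> + indicator (bad_sites (fst p)) ?u" for s
          using close[OF u, of s] om01[OF u, of s] om01[OF \<xi>(1), of s] \<epsilon>(2) by (auto simp: indicator_def bad_sites_def)
        from this[of "Inl i"] this[of "Inr i"]
        show ?case by (auto simp: indicator_def)
      qed
    qed (use int2 int3 in auto)
    finally show ?thesis using int2 int3 by simp
  qed
  have "\<bar>(\<Sum>k<N. (\<integral>p. ?I p * (?vis p k * ?om (Inl i) p k) \<partial>J) - (\<integral>p. ?I p * (?vis p k * ?om (Inr i) p k) \<partial>J) - ?v * (\<integral>p. ?I p * ?vis p k \<partial>J))\<bar>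
      \<le> (\<Sum>k<N. 2 * \<epsilon> * (\<integral>p. ?I p * ?vis p k \<partial>J) + 2 * (\<integral>p. ?I p * ?bad p k \<partial>J))"
    by (intro order_trans[OF sum_abs] sum_mono increment)
  then show ?thesis unfolding 1 2 3 by (simp add: sum_subtractf sum.distrib sum_distrib_left)
qed

end

section \<open>Conditioning on a finite path\<close>

lemma abs_sum_nth_diff_le:
  fixes a :: "nat \<Rightarrow> real"
  assumes "\<And>k. \<bar>a k\<bar> \<le> 1" "finite S" "real (card {k\<in>S. P k}) \<le> c"
  shows "\<bar>(\<Sum>k\<in>S. of_bool (P k) * a k)\<bar> \<le> c"
proof -
  have "\<bar>(\<Sum>k\<in>S. of_bool (P k) * a k)\<bar> \<le> (\<Sum>k\<in>S. of_bool (P k))"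
    using assms(1) by (intro order_trans[OF sum_abs] sum_mono) (auto simp: abs_mult)
  also have "\<dots> = real (card {k\<in>S. P k})"
    using assms(2) by (simp add: of_bool_def sum.If_cases Int_def)
  finally show ?thesis using assms(3) by simp
qed

context random_walk
begin

text \<open>On the event \<open>C\<close> that the walk follows the path \<open>x\<close> up to time \<open>n\<close> and has velocity \<open>z\<close>, it
  spends most of its time in \<open>F N\<close>.  The sites of \<open>F N\<close> are visited rarely on the rest of \<open>C\<close>, and they
  are far from the path \<open>x\<close>, so that conditioning on \<open>C\<close> does not affect the environment there.\<close>

lemma velocity_close:
  fixes F :: "nat \<Rightarrow> (int ^ 'd) set" and I :: "nat \<Rightarrow> nat" and z :: "real ^ 'd" and n :: nat and x :: "nat \<Rightarrow> int ^ 'd"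
  defines "C \<equiv> cylinder n x" and "E \<equiv> {X. has_velocity X z}"
  assumes c: "0 < c" and F: "\<And>N. finite (F N)"
    and avoid: "\<And>N y k. y \<in> F N \<Longrightarrow> k < n \<Longrightarrow> x k \<notin> cube y ((2 * CARD('d) + 9) ^ I N)"
    and err: "(\<lambda>N. card (F N) * (1 / 2) ^ ((2 * CARD('d) + 9) ^ I N)) \<longlonglongrightarrow> 0"
    and U: "U \<in> sets paths"
    and main: "AE p in J. snd p \<in> C \<inter> E \<longrightarrow> (\<forall>\<^sub>F N in sequentially. real (card {k. k < N \<and> snd p (n + k) \<notin> F N}) \<le> c * real N)"
    and rest: "AE p in J. snd p \<in> C - E \<longrightarrow> snd p \<in> U \<or>
      (\<forall>\<^sub>F N in sequentially. finite {k. snd p (n + k) \<in> F N} \<and> real (card {k. snd p (n + k) \<in> F N}) \<le> c * real N)"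
    and \<sigma>: "J.prob {p \<in> space J. snd p \<in> C \<inter> U} \<le> \<sigma>"
  defines "pE \<equiv> J.prob {p \<in> space J. snd p \<in> C \<inter> E}"
  shows "pE * \<bar>z $ i - (\<xi> $ Inl i - \<xi> $ Inr i)\<bar> \<le>
    4 * c + 2 * \<sigma> + (2 * \<epsilon> + 12 * (cluster_const CARD('d) \<alpha> * \<epsilon>)) * (pE + c + \<sigma>)"
proof -
  let ?I = "\<lambda>p. indicator C (snd p) :: real" and ?E = "\<lambda>p. indicator E (snd p) :: real" and ?U = "\<lambda>p. indicator U (snd p) :: real"
  let ?v = "\<xi> $ Inl i - \<xi> $ Inr i"
  let ?\<Delta> = "\<lambda>p k. real_of_int (snd p (Suc (n + k)) $ i - snd p (n + k) $ i)"
  let ?vis = "\<lambda>N p k. indicator (F N) (snd p (n + k)) :: real"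
  \<comment> \<open>After time n: \<open>kk\<close> is the fraction of N steps that start in F N,
    \<open>yy\<close> the displacement made by these steps per unit time, and \<open>occ\<close> the
    discounted occupation of F N per unit time. For N < 2 the discount is outside [1/2, 1), and
    \<open>occ\<close> is set to 0.\<close>
  define kk where "kk N p = (\<Sum>k<N. ?vis N p k) / N" for N and p :: "'d environment \<times> (nat \<Rightarrow> int ^ 'd)"
  define yy where "yy N p = (\<Sum>k<N. ?vis N p k * ?\<Delta> p k) / N" for N and p :: "'d environment \<times> (nat \<Rightarrow> int ^ 'd)"
  define occ where "occ N p = (if N < 2 then 0 else (\<Sum>k. (1 - 1 / N) ^ k * ?vis N p k) / N)" for N and p :: "'d environment \<times> (nat \<Rightarrow> int ^ 'd)"
  have CS: "C \<in> sets paths" "E \<in> sets paths" unfolding C_def E_def by (rule sets_cylinder has_velocity_sets)+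
  have mI: "?I \<in> borel_measurable J" "?E \<in> borel_measurable J" "?U \<in> borel_measurable J"
    by (intro path_indicator_J CS U)+
  have mvis: "(\<lambda>p. ?vis N p k) \<in> borel_measurable J" for N k by (rule site_measurable_J) simp
  have m\<Delta>: "(\<lambda>p. ?\<Delta> p k) \<in> borel_measurable J" for k
    by (rule site_pair_measurable_J[of "\<lambda>\<omega> u u'. real_of_int (u' $ i - u $ i)"]) simp
  have mk: "kk N \<in> borel_measurable J" and my: "yy N \<in> borel_measurable J" and mo: "occ N \<in> borel_measurable J" for N
  proof -
    have "(\<lambda>p. (\<Sum>k. (1 - 1 / N) ^ k * ?vis N p k)) \<in> borel_measurable J"
      by (intro borel_measurable_suminf borel_measurable_times mvis borel_measurable_const)
    then show "occ N \<in> borel_measurable J" unfolding occ_def by auto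
    show "kk N \<in> borel_measurable J" "yy N \<in> borel_measurable J"
      unfolding kk_def yy_def by (intro borel_measurable_divide borel_measurable_sum borel_measurable_times mvis m\<Delta> borel_measurable_const)+
  qed
  have r: "0 \<le> 1 - 1 / real N" "1 - 1 / real N < 1" "1 / (1 - (1 - 1 / real N)) = N" if "N \<ge> 2" for N
    using that by (auto simp: field_simps)
  have osum: "summable (\<lambda>k. (1 - 1 / real N) ^ k * ?vis N p k)" if "N \<ge> 2" for N p
    by (rule summable_comparison_test'[of "\<lambda>k. (1 - 1 / real N) ^ k" 0])
       (use r[OF that] in \<open>auto simp: indicator_def intro!: summable_geometric\<close>)
  have k_bounds: "0 \<le> kk N p" "kk N p \<le> 1" for N p
  proof -
    show "0 \<le> kk N p" by (simp add: kk_def sum_nonneg)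
    have "(\<Sum>k<N. ?vis N p k) \<le> (\<Sum>k<N. 1)" by (intro sum_mono) (simp add: indicator_def)
    then show "kk N p \<le> 1" by (cases "N = 0") (simp_all add: kk_def divide_le_eq)
  qed
  have o_bounds: "0 \<le> occ N p" "occ N p \<le> 1" for N p
  proof -
    have "N \<ge> 2 \<Longrightarrow> 0 \<le> (\<Sum>k. (1 - 1 / real N) ^ k * ?vis N p k)"
      using r by (intro suminf_nonneg osum mult_nonneg_nonneg) auto
    then show "0 \<le> occ N p" by (auto simp: occ_def)
    have "(\<Sum>k. (1 - 1 / real N) ^ k * ?vis N p k) \<le> real N" if "N \<ge> 2"
    proof -
      have "(\<Sum>k. (1 - 1 / real N) ^ k * ?vis N p k) \<le> (\<Sum>k. (1 - 1 / real N) ^ k)"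
        using r[OF that] by (intro suminf_le osum that summable_geometric) (auto simp: indicator_def)
      also have "\<dots> = N" using r[OF that] by (subst suminf_geometric) auto
      finally show ?thesis .
    qed
    then show "occ N p \<le> 1" by (auto simp: occ_def divide_le_eq)
  qed
  have y_bound: "\<bar>yy N p\<bar> \<le> 1" and \<Delta>_bound: "\<bar>?\<Delta> p k\<bar> \<le> 1" if "\<forall>k. \<exists>s. snd p (Suc k) = snd p k + nbr s" for N p k
  proof -
    show *: "\<bar>?\<Delta> p k\<bar> \<le> 1" for k
      using neighbour_path_bound(1)[OF that, of "n + k" i] by linarith
    have "\<bar>\<Sum>k<N. ?vis N p k * ?\<Delta> p k\<bar> \<le> (\<Sum>k<N. 1)"
      by (intro order_trans[OF sum_abs] sum_mono) (use * in \<open>auto simp: indicator_def\<close>)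
    then show "\<bar>yy N p\<bar> \<le> 1" by (cases "N = 0") (simp_all add: yy_def abs_divide divide_le_eq)
  qed
  let ?K = "3 * c + 3 + \<bar>z $ i\<bar>"
  have Kc: "0 \<le> c" using c by simp
  have vis_eq: "?vis N p k = of_bool (snd p (n + k) \<in> F N)" for N p k by (simp add: indicator_def)
  have kk_eq: "kk N p = 1 - real (card {k. k < N \<and> snd p (n + k) \<notin> F N}) / N" if "N > 0" for N p
  proof -
    have "(\<Sum>k<N. ?vis N p k) = real (card {k\<in>{..<N}. snd p (n + k) \<in> F N})"
      by (simp add: indicator_def sum.If_cases Int_def)
    moreover have "card {k\<in>{..<N}. snd p (n + k) \<in> F N} + card {k. k < N \<and> snd p (n + k) \<notin> F N} = N"
      by (subst card_Un_disjoint[symmetric]) (auto intro!: arg_cong[where f = card, of _ "{..<N}", simplified])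
    ultimately show ?thesis using that by (simp add: kk_def field_simps)
  qed
  \<comment> \<open>In the bound 2 * c, one c is for the convergence to the velocity, the other for
    the increments outside F N, each at most 1 in absolute value.\<close>
  have ev_main: "AE p in J. snd p \<in> C \<inter> E \<longrightarrow> (\<forall>\<^sub>F N in sequentially. \<bar>kk N p - 1\<bar> \<le> c \<and> \<bar>yy N p - z $ i\<bar> \<le> 2 * c)"
    using main AE_neighbour
  proof eventually_elim
    case (elim p)
    show ?case
    proof
      assume p: "snd p \<in> C \<inter> E"
      let ?X = "snd p"
      have step: "\<forall>k. \<exists>s. ?X (Suc k) = ?X k + nbr s" using elim(2) by blast
      have "(\<lambda>N. ?X N $ i / N) \<longlonglongrightarrow> z $ i" using p has_velocity_nth by (auto simp: E_def)
      then have "(\<lambda>N. ?X (N + n) $ i / (N + n)) \<longlonglongrightarrow> z $ i" by (rule LIMSEQ_ignore_initial_segment)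
      \<comment> \<open>The velocity is measured from time 0 with divisor N + n; this is its form
        for the displacement after time n with divisor N.\<close>
      then have "(\<lambda>N. (?X (N + n) $ i / (N + n)) * (1 + n * (1 / N)) - ?X n $ i * (1 / N)) \<longlonglongrightarrow> z $ i * (1 + real n * (0 :: real)) - real_of_int (?X n $ i) * (0 :: real)"
        by (intro tendsto_intros lim_1_over_n)
      then have "\<forall>\<^sub>F N in sequentially. \<bar>(?X (N + n) $ i / (N + n)) * (1 + n * (1 / N)) - ?X n $ i * (1 / N) - z $ i\<bar> < c"
        using c by (auto simp: tendsto_iff dist_real_def)
      moreover have "\<forall>\<^sub>F N in sequentially. real (card {k. k < N \<and> ?X (n + k) \<notin> F N}) \<le> c * real N"
        using elim(1) p by blast
      ultimately show "\<forall>\<^sub>F N in sequentially. \<bar>kk N p - 1\<bar> \<le> c \<and> \<bar>yy N p - z $ i\<bar> \<le> 2 * c"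
        using eventually_gt_at_top[of 0]
      proof eventually_elim
        case (elim N)
        then have N: "N > 0" by simp
        have cN: "real (card {k. k < N \<and> ?X (n + k) \<notin> F N}) / N \<le> c" using elim N by (simp add: divide_le_eq)
        have tel: "(\<Sum>k<N. ?\<Delta> p k) = real_of_int (?X (n + N) $ i - ?X n $ i)" for N
          by (induction N) auto
        have "yy N p = (\<Sum>k<N. ?\<Delta> p k) / N - (\<Sum>k<N. of_bool (?X (n + k) \<notin> F N) * ?\<Delta> p k) / N"
          unfolding yy_def diff_divide_distrib[symmetric] sum_subtractf[symmetric] vis_eq
          by (intro arg_cong2[where f = "(/)"] sum.cong) (auto simp: of_bool_def)
        moreover have "\<bar>(\<Sum>k<N. of_bool (?X (n + k) \<notin> F N) * ?\<Delta> p k)\<bar> \<le> c * N"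
          using elim \<Delta>_bound[OF step] by (intro abs_sum_nth_diff_le) auto
        then have "\<bar>(\<Sum>k<N. of_bool (?X (n + k) \<notin> F N) * ?\<Delta> p k) / N\<bar> \<le> c"
          using N by (simp add: abs_divide divide_le_eq)
        moreover have "(\<Sum>k<N. ?\<Delta> p k) / N = (?X (N + n) $ i / (N + n)) * (1 + n * (1 / N)) - ?X n $ i * (1 / N)"
        proof -
          have "1 + real n * (1 / real N) = real (N + n) / real N" using N by (simp add: field_simps)
          moreover have "real (N + n) \<noteq> 0" using N by simp
          ultimately show ?thesis unfolding tel by (simp add: diff_divide_distrib add.commute)
        qed
        ultimately have "\<bar>yy N p - z $ i\<bar> \<le> 2 * c" using elim(1) by linarith
        moreover have "\<bar>kk N p - 1\<bar> \<le> c" using cN unfolding kk_eq[OF N] by simp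
        ultimately show ?case by simp
      qed
    qed
  qed
  have ev_rest: "AE p in J. snd p \<in> C - E \<longrightarrow> snd p \<in> U \<or> (\<forall>\<^sub>F N in sequentially. kk N p \<le> c \<and> \<bar>yy N p\<bar> \<le> c \<and> occ N p \<le> c)"
    using rest AE_neighbour
  proof eventually_elim
    case (elim p)
    let ?X = "snd p"
    have step: "\<forall>k. \<exists>s. ?X (Suc k) = ?X k + nbr s" using elim(2) by blast
    show ?case
    proof (intro impI)
      assume "snd p \<in> C - E"
      with elim(1) consider "snd p \<in> U" | "\<forall>\<^sub>F N in sequentially. finite {k. snd p (n + k) \<in> F N} \<and> real (card {k. snd p (n + k) \<in> F N}) \<le> c * real N"
        by blast
      then show "snd p \<in> U \<or> (\<forall>\<^sub>F N in sequentially. kk N p \<le> c \<and> \<bar>yy N p\<bar> \<le> c \<and> occ N p \<le> c)"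
      proof cases
        case 2
        then have "\<forall>\<^sub>F N in sequentially. kk N p \<le> c \<and> \<bar>yy N p\<bar> \<le> c \<and> occ N p \<le> c"
          using eventually_ge_at_top[of 2]
        proof eventually_elim
          case (elim N)
          then have fin: "finite {k. ?X (n + k) \<in> F N}" and N: "N \<ge> 2" by auto
          have "card {k \<in> {..<N}. ?X (n + k) \<in> F N} \<le> card {k. ?X (n + k) \<in> F N}"
            using fin by (intro card_mono) auto
          then have cN: "real (card {k \<in> {..<N}. ?X (n + k) \<in> F N}) \<le> c * N" using elim by linarith
          have "\<bar>\<Sum>k<N. of_bool (?X (n + k) \<in> F N) * 1\<bar> \<le> c * N"
            by (rule abs_sum_nth_diff_le) (use cN in auto)
          then have "kk N p \<le> c" using N by (simp add: kk_def vis_eq divide_le_eq)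
          moreover have "\<bar>\<Sum>k<N. of_bool (?X (n + k) \<in> F N) * ?\<Delta> p k\<bar> \<le> c * N"
            by (rule abs_sum_nth_diff_le) (use cN \<Delta>_bound[OF step] in auto)
          then have "\<bar>yy N p\<bar> \<le> c" using N by (simp add: yy_def vis_eq abs_divide divide_le_eq)
          moreover have "occ N p \<le> c"
          proof -
            have "(\<Sum>k. (1 - 1 / real N) ^ k * ?vis N p k) = (\<Sum>k\<in>{k. ?X (n + k) \<in> F N}. (1 - 1 / real N) ^ k * ?vis N p k)"
              by (rule suminf_finite[OF fin]) simp
            also have "\<dots> \<le> (\<Sum>k\<in>{k. ?X (n + k) \<in> F N}. 1)"
              using r[OF N] by (intro sum_mono) (auto simp: indicator_def intro: power_le_one)
            also have "\<dots> \<le> c * N" using elim by simp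
            finally show ?thesis using N by (simp add: occ_def divide_le_eq)
          qed
          ultimately show ?case by simp
        qed
        then show ?thesis ..
      qed simp
    qed
  qed
  have AE_nb: "AE p in J. \<forall>N. \<bar>yy N p\<bar> \<le> 1"
    using AE_neighbour by eventually_elim (use y_bound in blast)
  have exps: "J.expectation (\<lambda>p. ?I p * ?E p) = pE" "J.expectation (\<lambda>p. ?I p * ?U p) \<le> \<sigma>"
  proof -
    have eq: "J.expectation (\<lambda>p. ?I p * indicator A (snd p)) = J.prob {p \<in> space J. snd p \<in> C \<inter> A}" if "A \<in> sets paths" for A
    proof -
      have "{p. snd p \<in> C \<inter> A} \<inter> space J \<in> sets J" using CS that by (intro path_event_J) auto
      then have "{p \<in> space J. snd p \<in> C \<inter> A} \<in> sets J" by (simp add: Int_def conj_commute)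
      then have "J.prob {p \<in> space J. snd p \<in> C \<inter> A} = J.expectation (indicator {p \<in> space J. snd p \<in> C \<inter> A})" by simp
      also have "\<dots> = J.expectation (\<lambda>p. ?I p * indicator A (snd p))"
        by (intro Bochner_Integration.integral_cong) (auto simp: indicator_def)
      finally show ?thesis ..
    qed
    show "J.expectation (\<lambda>p. ?I p * ?E p) = pE" using eq[OF CS(2)] by (simp add: pE_def)
    show "J.expectation (\<lambda>p. ?I p * ?U p) \<le> \<sigma>" using eq[OF U] \<sigma> by simp
  qed
  have int: "integrable J ?I" "integrable J (\<lambda>p. ?I p * ?E p)" "integrable J (\<lambda>p. ?I p * ?U p)"
  proof -
    have m: "(\<lambda>p. ?I p * ?E p) \<in> borel_measurable J" "(\<lambda>p. ?I p * ?U p) \<in> borel_measurable J"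
      by (intro borel_measurable_times mI)+
    show "integrable J ?I" by (rule J.integrable_const_bound[OF _ mI(1), where B = 1]) (simp add: indicator_def)
    show "integrable J (\<lambda>p. ?I p * ?E p)" by (rule J.integrable_const_bound[OF _ m(1), where B = 1]) (simp add: indicator_def)
    show "integrable J (\<lambda>p. ?I p * ?U p)" by (rule J.integrable_const_bound[OF _ m(2), where B = 1]) (simp add: indicator_def)
  qed
  have EI1: "J.expectation ?I \<le> 1"
    using integral_mono[OF int(1), of "\<lambda>_. 1"] by (simp add: J.prob_space indicator_def)
  \<comment> \<open>On C, in mean, \<open>yy\<close> is compared with z on E and 0 elsewhere,
    \<open>kk\<close> with the indicator of E, and \<open>occ\<close> is bounded by this indicator.
    On U outside E only the trivial bound 1 is available, at the price of \<sigma>.\<close>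
  obtain a where a: "a \<longlonglongrightarrow> 0" "\<And>N. J.expectation (\<lambda>p. ?I p * \<bar>yy N p - z $ i * ?E p\<bar>) \<le> J.expectation (\<lambda>p. 3 * c * ?I p + ?I p * ?U p) + a N"
  proof (rule J.expectation_eventually_le[where K = ?K and h = "\<lambda>N p. ?I p * \<bar>yy N p - z $ i * ?E p\<bar>" and g = "\<lambda>p. 3 * c * ?I p + ?I p * ?U p"])
    show "(\<lambda>p. ?I p * \<bar>yy N p - z $ i * ?E p\<bar>) \<in> borel_measurable J" for N
      by (intro borel_measurable_times borel_measurable_abs borel_measurable_diff my mI borel_measurable_const)
    show "(\<lambda>p. 3 * c * ?I p + ?I p * ?U p) \<in> borel_measurable J"
      by (intro borel_measurable_times borel_measurable_add mI borel_measurable_const)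
    show "AE p in J. \<bar>?I p * \<bar>yy N p - z $ i * ?E p\<bar>\<bar> \<le> ?K" for N
      using AE_nb
    proof eventually_elim
      case (elim p)
      then have "\<bar>yy N p\<bar> \<le> 1" by blast
      then show ?case using Kc by (auto simp: indicator_def)
    qed
    show "AE p in J. \<bar>3 * c * ?I p + ?I p * ?U p\<bar> \<le> ?K" using Kc by (intro AE_I2) (auto simp: indicator_def)
    show "AE p in J. \<forall>\<^sub>F N in sequentially. ?I p * \<bar>yy N p - z $ i * ?E p\<bar> \<le> 3 * c * ?I p + ?I p * ?U p"
      using ev_main ev_rest AE_nb
    proof eventually_elim
      case (elim p)
      show ?case
      proof (cases "snd p \<in> C")
        case True
        consider "snd p \<in> E" | "snd p \<notin> E" "snd p \<in> U" | "snd p \<notin> E" "snd p \<notin> U" by blast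
        then show ?thesis
        proof cases
          case 1
          then show ?thesis using elim(1) True Kc by (auto elim!: eventually_mono simp: indicator_def)
        next
          case 2
          then show ?thesis using elim(3) True Kc
            by (intro always_eventually allI) (auto simp: indicator_def intro: order_trans)
        next
          case 3
          then show ?thesis using elim(2) True Kc by (auto elim!: eventually_mono simp: indicator_def)
        qed
      qed simp
    qed
  qed blast
  obtain b where b: "b \<longlonglongrightarrow> 0" "\<And>N. J.expectation (\<lambda>p. ?I p * \<bar>kk N p - ?E p\<bar>) \<le> J.expectation (\<lambda>p. c * ?I p + ?I p * ?U p) + b N"
  proof (rule J.expectation_eventually_le[where K = ?K and h = "\<lambda>N p. ?I p * \<bar>kk N p - ?E p\<bar>" and g = "\<lambda>p. c * ?I p + ?I p * ?U p"])
    show "(\<lambda>p. ?I p * \<bar>kk N p - ?E p\<bar>) \<in> borel_measurable J" for N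
      by (intro borel_measurable_times borel_measurable_abs borel_measurable_diff mk mI)
    show "(\<lambda>p. c * ?I p + ?I p * ?U p) \<in> borel_measurable J"
      by (intro borel_measurable_times borel_measurable_add mI borel_measurable_const)
    show "AE p in J. \<bar>?I p * \<bar>kk N p - ?E p\<bar>\<bar> \<le> ?K" for N
    proof (intro AE_I2)
      fix p show "\<bar>?I p * \<bar>kk N p - ?E p\<bar>\<bar> \<le> ?K" using Kc k_bounds[of N p] by (auto simp: indicator_def)
    qed
    show "AE p in J. \<bar>c * ?I p + ?I p * ?U p\<bar> \<le> ?K" using Kc by (intro AE_I2) (auto simp: indicator_def)
    show "AE p in J. \<forall>\<^sub>F N in sequentially. ?I p * \<bar>kk N p - ?E p\<bar> \<le> c * ?I p + ?I p * ?U p"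
      using ev_main ev_rest
    proof eventually_elim
      case (elim p)
      have abs: "\<bar>kk N p\<bar> = kk N p" for N using k_bounds[of N p] by simp
      show ?case
      proof (cases "snd p \<in> C")
        case True
        consider "snd p \<in> E" | "snd p \<notin> E" "snd p \<in> U" | "snd p \<notin> E" "snd p \<notin> U" by blast
        then show ?thesis
        proof cases
          case 1
          then show ?thesis using elim(1) True Kc by (auto elim!: eventually_mono simp: indicator_def)
        next
          case 2
          have "kk N p \<le> c + 1" for N using k_bounds(2)[of N p] Kc by linarith
          with 2 show ?thesis using True
            by (intro always_eventually allI) (simp add: indicator_def abs)
        next
          case 3
          then show ?thesis using elim(2) True Kc by (auto elim!: eventually_mono simp: indicator_def abs)
        qed
      qed simp
    qed
  qed blast
  obtain d where d: "d \<longlonglongrightarrow> 0" "\<And>N. J.expectation (\<lambda>p. ?I p * occ N p) \<le> J.expectation (\<lambda>p. ?I p * ?E p + (c * ?I p + ?I p * ?U p)) + d N"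
  proof (rule J.expectation_eventually_le[where K = ?K and h = "\<lambda>N p. ?I p * occ N p" and g = "\<lambda>p. ?I p * ?E p + (c * ?I p + ?I p * ?U p)"])
    show "(\<lambda>p. ?I p * occ N p) \<in> borel_measurable J" for N
      by (intro borel_measurable_times mo mI)
    show "(\<lambda>p. ?I p * ?E p + (c * ?I p + ?I p * ?U p)) \<in> borel_measurable J"
      by (intro borel_measurable_times borel_measurable_add mI borel_measurable_const)
    show "AE p in J. \<bar>?I p * occ N p\<bar> \<le> ?K" for N
    proof (intro AE_I2)
      fix p show "\<bar>?I p * occ N p\<bar> \<le> ?K" using Kc o_bounds[of N p] by (auto simp: indicator_def)
    qed
    show "AE p in J. \<bar>?I p * ?E p + (c * ?I p + ?I p * ?U p)\<bar> \<le> ?K" using Kc by (intro AE_I2) (auto simp: indicator_def)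
    show "AE p in J. \<forall>\<^sub>F N in sequentially. ?I p * occ N p \<le> ?I p * ?E p + (c * ?I p + ?I p * ?U p)"
      using ev_rest
    proof eventually_elim
      case (elim p)
      show ?case
      proof (cases "snd p \<in> C \<and> snd p \<notin> E \<and> snd p \<notin> U")
        case True
        then show ?thesis using elim Kc by (auto elim!: eventually_mono simp: indicator_def)
      next
        case False
        have "occ N p \<le> c + 1" "occ N p \<le> 1 + c" "occ N p \<le> 2 + c" for N using o_bounds(2)[of N p] Kc by linarith+
        then show ?thesis using False Kc o_bounds(2)[of _ p]
          by (intro always_eventually allI) (auto simp: indicator_def)
      qed
    qed
  qed blast
  let ?e = "\<lambda>N. card (F N) * (1 / 2) ^ ((2 * CARD('d) + 9) ^ I N) :: real"
  let ?\<gamma> = "cluster_const CARD('d) \<alpha> * \<epsilon>"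
  have \<gamma>0: "0 \<le> ?\<gamma>" using \<epsilon> cluster_const_nonneg[OF \<alpha>] by simp
  have v1: "\<bar>?v\<bar> \<le> 1"
  proof -
    have "0 \<le> \<xi> $ s" "\<xi> $ s \<le> 1" for s
      using prob_vector[OF \<xi>(1)] member_le_sum[of s UNIV "($) \<xi>"] by auto
    from this[of "Inl i"] this[of "Inr i"] show ?thesis by auto
  qed
  \<comment> \<open>A chain of three comparisons: z times \<open>pE\<close> with the mean of
    \<open>yy\<close>, this with ?v times the mean of \<open>kk\<close> by the drift estimate, and
    this with ?v times \<open>pE\<close>. All estimates over N steps are divided by N.\<close>
  have bound: "pE * \<bar>z $ i - ?v\<bar> \<le> (3 * c + \<sigma> + a N) + (c + \<sigma> + b N) + 2 * \<epsilon> * (pE + c + \<sigma> + b N)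
      + 12 * ?\<gamma> * (pE + c + \<sigma> + d N) + 6 * ?e N" if N: "N \<ge> 2" for N
  proof -
    have N0: "0 < real N" using N by simp
    let ?Y = "J.expectation (\<lambda>p. ?I p * yy N p)" and ?Kx = "J.expectation (\<lambda>p. ?I p * kk N p)" and ?O = "J.expectation (\<lambda>p. ?I p * occ N p)"
    let ?B = "J.expectation (\<lambda>p. ?I p * (\<Sum>k<N. indicator (F N \<inter> bad_sites (fst p)) (snd p (n + k))))"
    have iy: "integrable J (\<lambda>p. ?I p * yy N p)"
    proof (rule J.integrable_const_bound[where B = 1])
      show "AE p in J. norm (?I p * yy N p) \<le> 1" using AE_nb by eventually_elim (auto simp: indicator_def)
    qed (intro borel_measurable_times mI my)
    have ik: "integrable J (\<lambda>p. ?I p * kk N p)"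
    proof (rule J.integrable_const_bound[where B = 1])
      show "AE p in J. norm (?I p * kk N p) \<le> 1" using k_bounds by (intro AE_I2) (auto simp: indicator_def abs_le_iff intro: order_trans[of _ 0])
    qed (intro borel_measurable_times mI mk)
    have Yeq: "J.expectation (\<lambda>p. ?I p * (\<Sum>k<N. ?vis N p k * ?\<Delta> p k)) = N * ?Y"
      using N0 by (subst integral_mult_right_zero[symmetric]) (simp add: yy_def mult_ac)
    have Keq: "J.expectation (\<lambda>p. ?I p * (\<Sum>k<N. ?vis N p k)) = N * ?Kx"
      using N0 by (subst integral_mult_right_zero[symmetric]) (simp add: kk_def mult_ac)
    have Oeq: "J.expectation (\<lambda>p. ?I p * (\<Sum>k. (1 - 1 / N) ^ k * ?vis N p k)) = N * ?O"
      using N0 N by (subst integral_mult_right_zero[symmetric]) (simp add: occ_def mult_ac)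
    have d1: "\<bar>N * ?Y - ?v * (N * ?Kx)\<bar> \<le> 2 * \<epsilon> * (N * ?Kx) + 2 * ?B"
      using drift_estimate[where n = n and x = x and N = N and F = "F N" and i = i] unfolding C_def[symmetric] Yeq Keq by simp
    have d2: "?B \<le> 3 * (2 * ?\<gamma> * (N * ?O) + N * ?e N)"
      using bad_fraction_le[where F = "F N" and N = N and n = n and x = x and I = "I N", OF F N avoid] unfolding C_def[symmetric] Oeq by simp
    have "real N * \<bar>y - v * k\<bar> = \<bar>real N * y - v * (real N * k)\<bar>" for y v k :: real
    proof -
      have "real N * \<bar>y - v * k\<bar> = \<bar>real N * (y - v * k)\<bar>" by (simp add: abs_mult)
      then show ?thesis by (simp add: right_diff_distrib mult.left_commute)
    qed
    then have "N * \<bar>?Y - ?v * ?Kx\<bar> = \<bar>N * ?Y - ?v * (N * ?Kx)\<bar>" .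
    also note d1
    also have "2 * \<epsilon> * (N * ?Kx) + 2 * ?B \<le> 2 * \<epsilon> * (N * ?Kx) + 2 * (3 * (2 * ?\<gamma> * (N * ?O) + N * ?e N))"
      by (intro add_left_mono mult_left_mono d2) simp
    also have "\<dots> = N * (2 * \<epsilon> * ?Kx + 12 * ?\<gamma> * ?O + 6 * ?e N)"
    proof -
      have "2 * \<epsilon> * (real N * k) + 2 * (3 * (2 * g * (real N * q) + real N * e)) = real N * (2 * \<epsilon> * k + 12 * g * q + 6 * e)" for k g q e :: real
        by (simp add: algebra_simps)
      then show ?thesis .
    qed
    finally have "N * \<bar>?Y - ?v * ?Kx\<bar> \<le> N * (2 * \<epsilon> * ?Kx + 12 * ?\<gamma> * ?O + 6 * ?e N)" .
    then have drift: "\<bar>?Y - ?v * ?Kx\<bar> \<le> 2 * \<epsilon> * ?Kx + 12 * ?\<gamma> * ?O + 6 * ?e N"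
      using N0 by (simp only: mult_le_cancel_left_pos)
    have 1: "\<bar>?Y - z $ i * pE\<bar> \<le> 3 * c + \<sigma> + a N"
    proof -
      have "?Y - z $ i * pE = J.expectation (\<lambda>p. ?I p * (yy N p - z $ i * ?E p))"
        using iy int by (simp add: right_diff_distrib mult.left_commute flip: exps(1))
      also have "\<bar>\<dots>\<bar> \<le> J.expectation (\<lambda>p. \<bar>?I p * (yy N p - z $ i * ?E p)\<bar>)" by (rule integral_abs_bound)
      also have "\<dots> = J.expectation (\<lambda>p. ?I p * \<bar>yy N p - z $ i * ?E p\<bar>)" by (simp add: abs_mult)
      also have "\<dots> \<le> J.expectation (\<lambda>p. 3 * c * ?I p + ?I p * ?U p) + a N" by (rule a)
      also have "\<dots> \<le> 3 * c * 1 + \<sigma> + a N" using int exps(2) mult_left_mono[OF EI1, of "3 * c"] Kc by simp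
      finally show ?thesis by simp
    qed
    have 2: "\<bar>?Kx - pE\<bar> \<le> c + \<sigma> + b N"
    proof -
      have "?Kx - pE = J.expectation (\<lambda>p. ?I p * (kk N p - ?E p))"
        using ik int by (simp add: right_diff_distrib flip: exps(1))
      also have "\<bar>\<dots>\<bar> \<le> J.expectation (\<lambda>p. \<bar>?I p * (kk N p - ?E p)\<bar>)" by (rule integral_abs_bound)
      also have "\<dots> = J.expectation (\<lambda>p. ?I p * \<bar>kk N p - ?E p\<bar>)" by (simp add: abs_mult)
      also have "\<dots> \<le> J.expectation (\<lambda>p. c * ?I p + ?I p * ?U p) + b N" by (rule b)
      also have "\<dots> \<le> c * 1 + \<sigma> + b N" using int exps(2) EI1 Kc mult_left_mono[OF EI1 Kc] by simp
      finally show ?thesis by simp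
    qed
    have 3: "?O \<le> pE + c + \<sigma> + d N"
    proof -
      have "?O \<le> J.expectation (\<lambda>p. ?I p * ?E p + (c * ?I p + ?I p * ?U p)) + d N" by (rule d)
      also have "\<dots> \<le> pE + (c * 1 + \<sigma>) + d N" using int exps EI1 Kc mult_left_mono[OF EI1 Kc] by simp
      finally show ?thesis by simp
    qed
    have "\<bar>?v * (?Kx - pE)\<bar> \<le> 1 * \<bar>?Kx - pE\<bar>" unfolding abs_mult using v1 by (intro mult_right_mono) auto
    then have 4: "\<bar>?v * ?Kx - ?v * pE\<bar> \<le> c + \<sigma> + b N" using 2 by (simp add: right_diff_distrib)
    have "\<epsilon> * ?Kx \<le> \<epsilon> * (pE + c + \<sigma> + b N)" using 2 \<epsilon>(2) by (intro mult_left_mono) auto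
    moreover have "?\<gamma> * ?O \<le> ?\<gamma> * (pE + c + \<sigma> + d N)" using 3 \<gamma>0 by (intro mult_left_mono)
    moreover have "pE * \<bar>z $ i - ?v\<bar> = \<bar>z $ i * pE - ?v * pE\<bar>"
      by (simp add: pE_def abs_mult mult.commute flip: left_diff_distrib)
    ultimately show ?thesis using drift 1 4 by linarith
  qed
  have "(\<lambda>N. (3 * c + \<sigma> + a N) + (c + \<sigma> + b N) + 2 * \<epsilon> * (pE + c + \<sigma> + b N) + 12 * ?\<gamma> * (pE + c + \<sigma> + d N) + 6 * ?e N)
      \<longlonglongrightarrow> (3 * c + \<sigma> + 0) + (c + \<sigma> + 0) + 2 * \<epsilon> * (pE + c + \<sigma> + 0) + 12 * ?\<gamma> * (pE + c + \<sigma> + 0) + 6 * 0"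
    by (intro tendsto_intros a b d err)
  from LIMSEQ_le_const[OF this] bound
  have "pE * \<bar>z $ i - ?v\<bar> \<le> (3 * c + \<sigma> + 0) + (c + \<sigma> + 0) + 2 * \<epsilon> * (pE + c + \<sigma> + 0) + 12 * ?\<gamma> * (pE + c + \<sigma> + 0) + 6 * 0"
    by blast
  then show ?thesis by (simp add: algebra_simps)
qed

end

section \<open>Velocities of the perturbed walk\<close>

lemma cube_floor_iff: "y \<in> cube 0 (nat \<lfloor>R\<rfloor>) \<longleftrightarrow> (\<forall>j. \<bar>real_of_int (y $ j)\<bar> \<le> R)" if "0 \<le> R"
proof -
  have "\<bar>y $ j - 0 $ j\<bar> \<le> int (nat \<lfloor>R\<rfloor>) \<longleftrightarrow> \<bar>real_of_int (y $ j)\<bar> \<le> R" for j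
    using that by (simp add: le_floor_iff)
  then show ?thesis by (simp add: cube_def)
qed

text \<open>From some time k0 on, coordinate j exceeds half of its linear growth, so the walk is in
  the cube of radius \<rho> * N at most up to time c * N / 2. The other c * N / 2 absorbs the first
  k0 times and rounding.\<close>

lemma nonzero_velocity_leaves_cube:
  assumes v: "has_velocity X v" "v $ j \<noteq> 0" and c: "0 < c" and \<rho>: "0 < \<rho>" "\<rho> \<le> c * \<bar>v $ j\<bar> / 4"
  shows "\<forall>\<^sub>F N in sequentially. finite {k. X (n + k) \<in> cube 0 (nat \<lfloor>\<rho> * real N\<rfloor>)} \<and>
    real (card {k. X (n + k) \<in> cube 0 (nat \<lfloor>\<rho> * real N\<rfloor>)}) \<le> c * real N"
proof -
  have "\<forall>\<^sub>F m in sequentially. dist (X m $ j / m) (v $ j) < \<bar>v $ j\<bar> / 2"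
    using tendstoD[OF has_velocity_nth[OF v(1), of j], of "\<bar>v $ j\<bar> / 2"] v(2) by simp
  then obtain k0 where k0: "\<And>m. m \<ge> k0 \<Longrightarrow> dist (X m $ j / m) (v $ j) < \<bar>v $ j\<bar> / 2"
    by (auto simp: eventually_sequentially)
  have far: "real m * \<bar>v $ j\<bar> / 2 \<le> \<bar>real_of_int (X m $ j)\<bar>" if m: "m \<ge> k0" for m
  proof (cases "m = 0")
    case False
    have "\<bar>v $ j\<bar> / 2 \<le> \<bar>X m $ j / m\<bar>" using k0[OF m] unfolding dist_real_def by linarith
    then show ?thesis using False by (simp add: field_simps abs_divide)
  qed simp
  have "\<forall>\<^sub>F N in sequentially. real N \<ge> 2 * (k0 + 1) / c" by (rule eventually_ge_at_top[of "nat \<lceil>2 * (k0 + 1) / c\<rceil>", THEN eventually_mono]) linarith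
  then show ?thesis
  proof eventually_elim
    case (elim N)
    let ?S = "{k. X (n + k) \<in> cube 0 (nat \<lfloor>\<rho> * real N\<rfloor>)}"
    have "?S \<subseteq> {..<k0} \<union> {..nat \<lfloor>c * N / 2\<rfloor>}"
    proof
      fix k assume "k \<in> ?S"
      then have le: "\<bar>real_of_int (X (n + k) $ j)\<bar> \<le> \<rho> * N" using \<rho> by (simp add: cube_floor_iff)
      show "k \<in> {..<k0} \<union> {..nat \<lfloor>c * N / 2\<rfloor>}"
      proof (cases "n + k < k0")
        case False
        then have "real (n + k) * \<bar>v $ j\<bar> / 2 \<le> \<rho> * N" using far[of "n + k"] le by linarith
        also have "\<dots> \<le> c * \<bar>v $ j\<bar> / 4 * N" using \<rho> by (intro mult_right_mono) auto
        finally have "real (n + k) * \<bar>v $ j\<bar> \<le> (c * N / 2) * \<bar>v $ j\<bar>" by (simp add: algebra_simps)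
        then have "real (n + k) \<le> c * N / 2" using v(2) by (simp add: mult_le_cancel_right)
        then have "real k \<le> c * N / 2" by simp
        then show ?thesis by (simp add: le_nat_floor)
      qed simp
    qed
    moreover have fin: "finite ({..<k0} \<union> {..nat \<lfloor>c * N / 2\<rfloor>})" by simp
    ultimately have "finite ?S" "card ?S \<le> card ({..<k0} \<union> {..nat \<lfloor>c * N / 2\<rfloor>})"
      by (auto intro: finite_subset card_mono)
    moreover have "card ({..<k0} \<union> {..nat \<lfloor>c * N / 2\<rfloor>}) \<le> k0 + Suc (nat \<lfloor>c * N / 2\<rfloor>)"
      by (rule order_trans[OF card_Un_le]) simp
    moreover have "real (nat \<lfloor>c * N / 2\<rfloor>) \<le> c * N / 2" by (rule of_nat_floor) (use c in simp)
    moreover have "real k0 + 1 \<le> c * N / 2" using elim c by (simp add: field_simps)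
    ultimately show ?case by simp
  qed
qed

lemma zero_velocity_stays_in_cube:
  fixes X :: "nat \<Rightarrow> int ^ 'd::finite"
  assumes v: "has_velocity X 0" and step: "X 0 = 0" "\<forall>k. \<exists>s. X (Suc k) = X k + nbr s" and \<rho>: "0 < \<rho>"
  shows "\<forall>\<^sub>F N in sequentially. \<forall>k<N. X k \<in> cube 0 (nat \<lfloor>\<rho> * real N\<rfloor>)"
proof -
  have "\<forall>\<^sub>F m in sequentially. \<forall>j\<in>UNIV. dist (X m $ j / m) 0 < \<rho>"
    using has_velocity_nth[OF v] \<rho> by (intro eventually_ball_finite) (auto simp: tendsto_iff)
  then obtain k0 where k0: "\<And>m j. m \<ge> k0 \<Longrightarrow> dist (X m $ j / m) 0 < \<rho>" by (auto simp: eventually_sequentially)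
  have "\<forall>\<^sub>F N in sequentially. real N \<ge> k0 / \<rho>" by (rule eventually_ge_at_top[of "nat \<lceil>k0 / \<rho>\<rceil>", THEN eventually_mono]) linarith
  then show ?thesis
  proof eventually_elim
    case (elim N)
    show ?case
    proof (intro allI impI)
      fix k assume k: "k < N"
      have "\<bar>real_of_int (X k $ j)\<bar> \<le> \<rho> * N" for j
      proof (cases "k < k0 \<or> k = 0")
        case True
        have "\<bar>X k $ j\<bar> \<le> int k" using neighbour_path_bound(2)[OF step(2), of 0 k j] step(1) by simp
        then have "\<bar>real_of_int (X k $ j)\<bar> \<le> k" by linarith
        moreover have "real k0 \<le> \<rho> * N" using elim \<rho> by (simp add: field_simps)
        ultimately show ?thesis using True \<rho> by auto
      next
        case False
        then have "\<bar>real_of_int (X k $ j)\<bar> \<le> \<rho> * k" using k0[of k j] by (simp add: dist_real_def abs_divide field_simps)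
        also have "\<dots> \<le> \<rho> * N" using k \<rho> by simp
        finally show ?thesis .
      qed
      then show "X k \<in> cube 0 (nat \<lfloor>\<rho> * real N\<rfloor>)" using \<rho> by (simp add: cube_floor_iff)
    qed
  qed
qed

lemma polynomial_times_exponential_tendsto_0:
  fixes m :: "nat \<Rightarrow> nat"
  assumes \<delta>: "0 < \<delta>" and m: "\<And>N. \<delta> * real N - K \<le> real (m N)" and f: "\<And>N. 0 \<le> f N" "\<And>N. f N \<le> real ((2 * (N + n) + 1) ^ D)"
  shows "(\<lambda>N. f N * (1 / 2) ^ m N) \<longlonglongrightarrow> 0"
proof -
  \<comment> \<open>The side length u N grows like 2 * N; the 2 in \<gamma> compensates this, so
    that exp (\<gamma> * u N) is a constant multiple of 2^(\<delta> * N).\<close>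
  define \<gamma> where "\<gamma> = \<delta> * ln 2 / 2"
  have \<gamma>: "0 < \<gamma>" using \<delta> by (simp add: \<gamma>_def)
  define u where "u N = 2 * (real N + n) + 1" for N
  define B where "B = exp (\<gamma> * (2 * n + 1) + K * ln 2) / \<gamma> ^ D"
  have lim: "(\<lambda>N. B * ((\<gamma> * u N) ^ D / exp (\<gamma> * u N))) \<longlonglongrightarrow> B * 0"
  proof (intro tendsto_mult tendsto_const filterlim_compose[OF tendsto_power_div_exp_0])
    have "filterlim (\<lambda>N. \<gamma> * (1 + 2 * real n) + (2 * \<gamma>) * real N) at_top sequentially"
      using \<gamma> by (intro filterlim_tendsto_add_at_top[OF tendsto_const] filterlim_tendsto_pos_mult_at_top[OF tendsto_const _ filterlim_real_sequentially]) auto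
    then show "filterlim (\<lambda>N. \<gamma> * u N) at_top sequentially" by (simp add: u_def algebra_simps)
  qed
  have bound: "f N * (1 / 2) ^ m N \<le> B * ((\<gamma> * u N) ^ D / exp (\<gamma> * u N))" for N
  proof -
    have "(1 / 2 :: real) ^ m N = exp (- (real (m N) * ln 2))"
      by (simp add: exp_minus exp_of_nat_mult power_one_over inverse_eq_divide)
    also have "\<dots> \<le> exp (\<gamma> * (2 * n + 1) + K * ln 2 - \<gamma> * u N)"
    proof -
      have "(\<delta> * real N - K) * ln 2 \<le> real (m N) * ln 2" using m by (intro mult_right_mono) auto
      moreover have "\<gamma> * (2 * n + 1) + K * ln 2 - \<gamma> * u N = - ((\<delta> * real N - K) * ln 2)"
        by (simp add: \<gamma>_def u_def field_simps)
      ultimately show ?thesis by simp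
    qed
    finally have "(1 / 2 :: real) ^ m N \<le> exp (\<gamma> * (2 * n + 1) + K * ln 2) / exp (\<gamma> * u N)" by (simp add: exp_diff)
    moreover have "f N \<le> u N ^ D" using f(2)[of N] by (simp add: u_def algebra_simps)
    ultimately have "f N * (1 / 2) ^ m N \<le> u N ^ D * (exp (\<gamma> * (2 * n + 1) + K * ln 2) / exp (\<gamma> * u N))"
      using f(1)[of N] by (intro mult_mono) (auto simp: u_def)
    also have "\<dots> = B * ((\<gamma> * u N) ^ D / exp (\<gamma> * u N))"
      using \<gamma> by (simp add: B_def power_mult_distrib)
    finally show ?thesis .
  qed
  show ?thesis
    by (rule tendsto_sandwich[OF _ _ tendsto_const lim[simplified]]) (use bound f in auto)
qed

context random_walk
begin

lemma path_event_sets_J: "A \<in> sets paths \<Longrightarrow> {p \<in> space J. snd p \<in> A} \<in> sets J"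
  using path_event_J[of A] by (simp add: Int_def conj_commute)

lemma prob_eventually_null:
  assumes "\<And>n. A n \<in> sets J" "AE p in J. \<forall>\<^sub>F n in sequentially. p \<notin> A n"
  shows "(\<lambda>n. J.prob (A n)) \<longlonglongrightarrow> 0"
proof -
  have "(\<lambda>n. J.expectation (indicator (A n))) \<longlonglongrightarrow> J.expectation (\<lambda>_. 0 :: real)"
  proof (rule integral_dominated_convergence[where w = "\<lambda>_. 1"])
    show "AE p in J. (\<lambda>n. indicator (A n) p :: real) \<longlonglongrightarrow> 0"
      using assms(2) by eventually_elim (auto intro!: tendsto_eventually elim: eventually_mono)
  qed (use assms(1) in \<open>auto simp: indicator_def\<close>)
  then show ?thesis using assms(1) by simp
qed

text \<open>As the velocity takes two values, the rescaled position at a late time n tells with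
  small error whether it is z. The event \<open>W n\<close> that it is near z is a countable
  disjoint union of cylinders of length n, and on at least one of them the relative error is no
  larger than on average.\<close>

lemma approximating_cylinder:
  assumes vel: "AE p in J. has_velocity (snd p) v \<or> has_velocity (snd p) w"
    and pos: "0 < J.prob {p \<in> space J. has_velocity (snd p) z}" and \<sigma>: "0 < \<sigma>"
  obtains n x where "0 < J.prob {p \<in> space J. snd p \<in> cylinder n x}"
    "J.prob {p \<in> space J. snd p \<in> cylinder n x \<and> \<not> has_velocity (snd p) z} \<le> \<sigma> * J.prob {p \<in> space J. snd p \<in> cylinder n x}"
proof -
  \<comment> \<open>Half the distance from z to the other velocity; the default 1 keeps the radius
    positive if v or w is z itself.\<close>
  define d where "d = (if v = z then 1 else dist v z) / 2"
  define d' where "d' = min d ((if w = z then 1 else dist w z) / 2)"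
  have d': "0 < d'" by (auto simp: d_def d'_def)
  define W where "W n = {X. dist (rescaled X n) z < d'}" for n
  define E where "E = {X. has_velocity X z}"
  have E: "E \<in> sets paths" unfolding E_def by (rule has_velocity_sets)
  have Wn: "W n \<in> sets paths" for n
  proof -
    have "{X \<in> space paths. X n \<in> {u. dist ((1 / real n) *\<^sub>R (\<chi> j. real_of_int (u $ j))) z < d'}} \<in> sets paths"
      by measurable
    then show ?thesis by (simp add: W_def rescaled_def)
  qed
  let ?q = "J.prob {p \<in> space J. snd p \<in> E}"
  have q: "0 < ?q" using pos by (simp add: E_def)
  have lim1: "(\<lambda>n. J.prob {p \<in> space J. snd p \<in> W n - E}) \<longlonglongrightarrow> 0"
  proof (rule prob_eventually_null)
    show "AE p in J. \<forall>\<^sub>F n in sequentially. p \<notin> {p \<in> space J. snd p \<in> W n - E}"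
      using vel
    proof eventually_elim
      case (elim p)
      show ?case
      proof (cases "snd p \<in> E")
        case False
        with elim obtain u where u: "u = v \<or> u = w" "has_velocity (snd p) u" "u \<noteq> z" by (auto simp: E_def)
        have "d' \<le> dist u z / 2" using u by (auto simp: d'_def d_def)
        moreover have "\<forall>\<^sub>F n in sequentially. dist (rescaled (snd p) n) u < dist u z / 2"
          using u tendstoD[of "rescaled (snd p)" u sequentially "dist u z / 2"] by (simp add: has_velocity_iff_rescaled)
        ultimately show ?thesis
        proof (elim eventually_mono, goal_cases)
          case (1 n)
          then show ?case using dist_triangle[of u z "rescaled (snd p) n"] by (auto simp: W_def dist_commute)
        qed
      qed simp
    qed
  qed (use E Wn path_event_sets_J in auto)
  have lim2: "(\<lambda>n. J.prob {p \<in> space J. snd p \<in> E - W n}) \<longlonglongrightarrow> 0"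
  proof (rule prob_eventually_null)
    show "AE p in J. \<forall>\<^sub>F n in sequentially. p \<notin> {p \<in> space J. snd p \<in> E - W n}"
    proof (intro AE_I2)
      fix p
      show "\<forall>\<^sub>F n in sequentially. p \<notin> {p \<in> space J. snd p \<in> E - W n}"
      proof (cases "snd p \<in> E")
        case True
        then have "\<forall>\<^sub>F n in sequentially. dist (rescaled (snd p) n) z < d'"
          using d' by (auto simp: E_def has_velocity_iff_rescaled tendsto_iff)
        then show ?thesis by (rule eventually_mono) (auto simp: W_def)
      qed simp
    qed
  qed (use E Wn path_event_sets_J in auto)
  have "\<forall>\<^sub>F n in sequentially. J.prob {p \<in> space J. snd p \<in> W n - E} < \<sigma> * (?q / 2)"
    by (rule order_tendstoD(2)[OF lim1]) (use q \<sigma> in simp)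
  moreover have "\<forall>\<^sub>F n in sequentially. J.prob {p \<in> space J. snd p \<in> E - W n} < ?q / 2"
    by (rule order_tendstoD(2)[OF lim2]) (use q in simp)
  ultimately have "\<forall>\<^sub>F n in sequentially. J.prob {p \<in> space J. snd p \<in> W n - E} < \<sigma> * (?q / 2) \<and> J.prob {p \<in> space J. snd p \<in> E - W n} < ?q / 2"
    by eventually_elim simp
  then obtain n where n: "J.prob {p \<in> space J. snd p \<in> W n - E} < \<sigma> * (?q / 2)" "J.prob {p \<in> space J. snd p \<in> E - W n} < ?q / 2"
    by (auto simp: eventually_sequentially)
  have "?q \<le> J.prob {p \<in> space J. snd p \<in> E - W n} + J.prob {p \<in> space J. snd p \<in> W n}"
    by (rule order_trans[OF J.finite_measure_mono measure_Un_le]) (use E Wn path_event_sets_J in auto)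
  then have Wq: "?q / 2 < J.prob {p \<in> space J. snd p \<in> W n}" using n(2) by linarith
  \<comment> \<open>Initial segments are coded as lists, of which there are countably many.\<close>
  define L where "L = {l :: (int ^ 'd) list. length l = Suc n \<and> cylinder n ((!) l) \<subseteq> W n}"
  have L: "countable L" by (rule countable_subset[OF subset_UNIV]) simp
  have decomp: "W n = (\<Union>l\<in>L. cylinder n ((!) l))"
  proof (intro equalityI subsetI)
    fix X assume X: "X \<in> W n"
    let ?l = "map X [0..<Suc n]"
    have "cylinder n ((!) ?l) \<subseteq> W n"
      using X by (auto simp: cylinder_def W_def rescaled_def nth_map_upt simp del: upt_Suc dest!: spec[of _ n])
    then have "?l \<in> L" by (simp add: L_def)
    moreover have "X \<in> cylinder n ((!) ?l)" by (auto simp: cylinder_def simp del: upt_Suc)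
    ultimately show "X \<in> (\<Union>l\<in>L. cylinder n ((!) l))" by blast
  qed (auto simp: L_def)
  have disj: "disjoint_family_on (\<lambda>l. {p \<in> space J. snd p \<in> cylinder n ((!) l) \<inter> B}) L" for B
    unfolding disjoint_family_on_def
  proof (intro ballI impI)
    fix l l' assume l: "l \<in> L" "l' \<in> L" "l \<noteq> l'"
    then obtain i where "i \<le> n" "l ! i \<noteq> l' ! i" by (auto simp: L_def list_eq_iff_nth_eq less_Suc_eq_le)
    then show "{p \<in> space J. snd p \<in> cylinder n ((!) l) \<inter> B} \<inter> {p \<in> space J. snd p \<in> cylinder n ((!) l') \<inter> B} = {}"
      by (auto simp: cylinder_def)
  qed
  have total: "emeasure J {p \<in> space J. snd p \<in> W n \<inter> B} = (\<integral>\<^sup>+l. emeasure J {p \<in> space J. snd p \<in> cylinder n ((!) l) \<inter> B} \<partial>count_space L)"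
    if "B \<in> sets paths" for B
  proof -
    have "{p \<in> space J. snd p \<in> W n \<inter> B} = (\<Union>l\<in>L. {p \<in> space J. snd p \<in> cylinder n ((!) l) \<inter> B})"
      unfolding decomp by auto
    then show ?thesis
      using that sets_cylinder L disj by (simp only:) (intro emeasure_UN_countable path_event_sets_J sets.Int)
  qed
  have "\<exists>l\<in>L. 0 < J.prob {p \<in> space J. snd p \<in> cylinder n ((!) l)} \<and>
    J.prob {p \<in> space J. snd p \<in> cylinder n ((!) l) \<inter> - E} \<le> \<sigma> * J.prob {p \<in> space J. snd p \<in> cylinder n ((!) l)}"
  proof (rule ccontr)
    assume neg: "\<not> ?thesis"
    have UNIV_sets: "UNIV \<in> sets (paths :: (nat \<Rightarrow> int ^ 'd) measure)" using sets.top[of paths] by simp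
    have E': "- E \<in> sets paths" using sets.compl_sets[OF E] by (simp add: Compl_eq_Diff_UNIV)
    have "ennreal (\<sigma> * J.prob {p \<in> space J. snd p \<in> W n}) = ennreal \<sigma> * emeasure J {p \<in> space J. snd p \<in> W n \<inter> UNIV}"
      using \<sigma> by (simp add: J.emeasure_eq_measure ennreal_mult)
    also have "\<dots> = (\<integral>\<^sup>+l. ennreal \<sigma> * emeasure J {p \<in> space J. snd p \<in> cylinder n ((!) l) \<inter> UNIV} \<partial>count_space L)"
      unfolding total[OF UNIV_sets] by (rule nn_integral_cmult[symmetric]) simp
    also have "\<dots> \<le> (\<integral>\<^sup>+l. emeasure J {p \<in> space J. snd p \<in> cylinder n ((!) l) \<inter> - E} \<partial>count_space L)"
    proof (intro nn_integral_mono)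
      fix l assume "l \<in> space (count_space L)"
      then have "\<not> (0 < J.prob {p \<in> space J. snd p \<in> cylinder n ((!) l)} \<and>
        J.prob {p \<in> space J. snd p \<in> cylinder n ((!) l) \<inter> - E} \<le> \<sigma> * J.prob {p \<in> space J. snd p \<in> cylinder n ((!) l)})"
        using neg by auto
      moreover have "0 \<le> J.prob {p \<in> space J. snd p \<in> cylinder n ((!) l)}" by (rule measure_nonneg)
      ultimately have "J.prob {p \<in> space J. snd p \<in> cylinder n ((!) l)} = 0 \<or>
          \<sigma> * J.prob {p \<in> space J. snd p \<in> cylinder n ((!) l)} < J.prob {p \<in> space J. snd p \<in> cylinder n ((!) l) \<inter> - E}"
        by linarith
      then show "ennreal \<sigma> * emeasure J {p \<in> space J. snd p \<in> cylinder n ((!) l) \<inter> UNIV} \<le> emeasure J {p \<in> space J. snd p \<in> cylinder n ((!) l) \<inter> - E}"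
        using \<sigma> by (auto simp: J.emeasure_eq_measure ennreal_mult[symmetric] intro!: ennreal_leI)
    qed
    also have "\<dots> = emeasure J {p \<in> space J. snd p \<in> W n \<inter> - E}" by (rule total[OF E', symmetric])
    also have "\<dots> = ennreal (J.prob {p \<in> space J. snd p \<in> W n - E})"
      by (simp add: J.emeasure_eq_measure Diff_eq)
    finally have "\<sigma> * J.prob {p \<in> space J. snd p \<in> W n} \<le> J.prob {p \<in> space J. snd p \<in> W n - E}"
      by (simp add: ennreal_le_iff)
    moreover have "\<sigma> * (?q / 2) \<le> \<sigma> * J.prob {p \<in> space J. snd p \<in> W n}" using Wq \<sigma> by (intro mult_left_mono) auto
    ultimately show False using n(1) by linarith
  qed
  then show thesis using that by (auto simp: E_def)
qed

text \<open>The sites far from the origin are fresh for a walk with nonzero velocity.\<close>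

lemma nonzero_velocity_close:
  assumes vel: "AE p in J. has_velocity (snd p) v \<or> has_velocity (snd p) w"
    and pos: "0 < J.prob {p \<in> space J. has_velocity (snd p) z}" and z: "z \<noteq> 0"
  shows "\<bar>z $ i - (\<xi> $ Inl i - \<xi> $ Inr i)\<bar> \<le> 2 * \<epsilon> + 12 * (cluster_const CARD('d) \<alpha> * \<epsilon>)"
proof (rule ccontr)
  define g where "g = 2 * \<epsilon> + 12 * (cluster_const CARD('d) \<alpha> * \<epsilon>)"
  let ?\<delta> = "\<bar>z $ i - (\<xi> $ Inl i - \<xi> $ Inr i)\<bar>"
  assume "\<not> ?thesis"
  then have t: "0 < ?\<delta> - g" by (simp add: g_def)
  have \<gamma>0: "0 \<le> g" using \<epsilon> cluster_const_nonneg[OF \<alpha>] by (simp add: g_def)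
  \<comment> \<open>With c = \<sigma> * P the errors in \<open>main\<close> add up to \<sigma> * P *
    (6 + 2 * g), which is at most a quarter of P * (?\<delta> - g). The main term is at least half
    of it, since the velocity is z on at least half of the cylinder.\<close>
  define \<sigma> where "\<sigma> = min (1 / 2) ((?\<delta> - g) / (4 * (6 + 2 * g)))"
  have \<sigma>: "0 < \<sigma>" "\<sigma> \<le> 1 / 2" 
  proof -
    have "0 < 4 * (6 + 2 * g)" using \<gamma>0 by (simp add: add_pos_nonneg)
    then show "0 < \<sigma>" unfolding \<sigma>_def using t by (simp only: min_less_iff_conj divide_pos_pos)
    show "\<sigma> \<le> 1 / 2" unfolding \<sigma>_def by (rule min.cobounded1)
  qed
  have \<sigma>2: "\<sigma> * (6 + 2 * g) \<le> (?\<delta> - g) / 4"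
  proof -
    have "\<sigma> \<le> (?\<delta> - g) / (4 * (6 + 2 * g))" by (simp add: \<sigma>_def)
    then show ?thesis using \<gamma>0 by (simp add: field_simps)
  qed
  obtain n x where Cpos: "0 < J.prob {p \<in> space J. snd p \<in> cylinder n x}"
    and CE: "J.prob {p \<in> space J. snd p \<in> cylinder n x \<and> \<not> has_velocity (snd p) z} \<le> \<sigma> * J.prob {p \<in> space J. snd p \<in> cylinder n x}"
    using approximating_cylinder[OF vel pos \<sigma>(1)] by blast
  let ?C = "cylinder n x" and ?E = "{X. has_velocity X z}"
  define P where "P = J.prob {p \<in> space J. snd p \<in> ?C}"
  have E: "?E \<in> sets paths" by (rule has_velocity_sets)
  have E': "- ?E \<in> sets paths" using sets.compl_sets[OF E] by (simp add: Compl_eq_Diff_UNIV)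
  \<comment> \<open>A cylinder of positive probability contains a nearest-neighbour path from the
    origin.\<close>
  have x: "x k \<in> cube 0 n" if "k \<le> n" for k
  proof -
    have "\<not> (AE p in J. snd p \<notin> ?C)"
    proof
      assume "AE p in J. snd p \<notin> ?C"
      then have "J.prob {p \<in> space J. snd p \<in> ?C} = 0"
        using path_event_sets_J[OF sets_cylinder, of n x] by (subst J.prob_eq_0) auto
      then show False using Cpos by simp
    qed
    have "\<exists>X. X \<in> ?C \<and> X 0 = 0 \<and> (\<forall>k. \<exists>s. X (Suc k) = X k + nbr s)"
    proof (rule ccontr)
      assume none: "\<not> ?thesis"
      have "AE p in J. snd p \<notin> ?C" using AE_neighbour by eventually_elim (use none in blast)
      with \<open>\<not> (AE p in J. snd p \<notin> ?C)\<close> show False by blast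
    qed
    then obtain X where X: "X \<in> ?C" "X 0 = 0" "\<forall>k. \<exists>s. X (Suc k) = X k + nbr s" by blast
    have "X (0 + k) \<in> cube (X 0) k" by (rule neighbour_path_bound(3)[OF X(3)])
    then have "x k \<in> cube 0 k" using X(1,2) that by (simp add: cylinder_def)
    then show ?thesis using cube_mono[OF that] by blast
  qed
  obtain j where j: "z $ j \<noteq> 0" using z by (auto simp: vec_eq_iff)
  define c where "c = \<sigma> * P"
  have c: "0 < c" using \<sigma> Cpos by (simp add: c_def P_def)
  define \<rho> where "\<rho> = c * \<bar>z $ j\<bar> / 4"
  have \<rho>: "0 < \<rho>" using c j by (simp add: \<rho>_def)
  define m where "m N = nat \<lfloor>\<rho> * real N\<rfloor> - n" for N
  let ?b = "2 * CARD('d) + 9"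
  \<comment> \<open>The path x stays in the cube of radius n, so cubes of radius m N around sites
    outside the cube of radius \<rho> * N do not meet it. The largest power of \<open>?b\<close>
    below m N is taken; it is linear in N up to constants.\<close>
  have "\<exists>I. m N \<noteq> 0 \<longrightarrow> ?b ^ I \<le> m N \<and> m N < ?b ^ Suc I" for N
  proof (cases "m N = 0")
    case False
    have "\<exists>I. ?b ^ I \<le> m N \<and> m N < ?b ^ (I + 1)"
      by (rule ex_power_ivl1) (use False in auto)
    then show ?thesis by auto
  qed simp
  then obtain I where I: "\<And>N. m N \<noteq> 0 \<Longrightarrow> ?b ^ I N \<le> m N" "\<And>N. m N \<noteq> 0 \<Longrightarrow> m N < ?b ^ Suc (I N)" by metis
  \<comment> \<open>The walk is within distance N + n of the origin at all times that matter, so the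
    outer cube loses nothing and makes the size of F N polynomial in N. The error is exponentially
    small in a quantity linear in N.\<close>
  define F where "F N = (if m N = 0 then {} else cube 0 (N + n) - cube (0 :: int ^ 'd) (nat \<lfloor>\<rho> * real N\<rfloor>))" for N
  have main: "J.prob {p \<in> space J. snd p \<in> ?C \<inter> ?E} * ?\<delta> \<le> 4 * c + 2 * (\<sigma> * P) + g * (J.prob {p \<in> space J. snd p \<in> ?C \<inter> ?E} + c + \<sigma> * P)"
    unfolding g_def
  \<comment> \<open>Nothing is known about the walk on the rest of the cylinder, so all of it is put
    into U; its probability is at most \<sigma> * P.\<close>
  proof (rule velocity_close[where F = F and I = I and U = "- ?E"])
    show "0 < c" by fact
    show "finite (F N)" for N by (simp add: F_def finite_cube)
    show "x k \<notin> cube y (?b ^ I N)" if y: "y \<in> F N" and k: "k < n" for N y k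
    proof
      assume xk: "x k \<in> cube y (?b ^ I N)"
      have mN: "m N \<noteq> 0" using y by (auto simp: F_def split: if_splits)
      have "y \<in> cube 0 (nat \<lfloor>\<rho> * real N\<rfloor>)"
      proof (rule cube_intro)
        fix i
        have "\<bar>x k $ i - y $ i\<bar> \<le> int (?b ^ I N)" using xk unfolding cube_def by blast
        moreover have "\<bar>x k $ i\<bar> \<le> int n" using x[of k] k by (simp add: cube_def)
        moreover have "?b ^ I N \<le> m N" using I mN by blast
        moreover have "m N + n = nat \<lfloor>\<rho> * real N\<rfloor>" using mN by (simp add: m_def)
        ultimately show "\<bar>y $ i - 0 $ i\<bar> \<le> int (nat \<lfloor>\<rho> * real N\<rfloor>)" by (simp only: zero_index)
      qed
      then show False using y by (auto simp: F_def split: if_splits)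
    qed
    show "(\<lambda>N. real (card (F N)) * (1 / 2) ^ (?b ^ I N)) \<longlonglongrightarrow> 0"
    proof (rule polynomial_times_exponential_tendsto_0[where \<delta> = "\<rho> / ?b" and K = "(n + 1) / ?b" and n = n and D = "CARD('d)"])
      show "0 < \<rho> / ?b" using \<rho> by simp
      show "\<rho> / ?b * real N - (n + 1) / ?b \<le> real (?b ^ I N)" for N
      proof -
        have "m N < ?b * ?b ^ I N" using I(2)[of N] by (cases "m N = 0") auto
        then have "real (m N) \<le> real (?b * ?b ^ I N)" by (intro of_nat_mono) simp
        moreover have "\<rho> * real N - n - 1 \<le> real (m N)" unfolding m_def by linarith
        ultimately have "\<rho> * real N - n - 1 \<le> real ?b * real (?b ^ I N)" by (simp only: of_nat_mult)
        then have "(\<rho> * real N - n - 1) / real ?b \<le> real (?b ^ I N)" by (subst pos_divide_le_eq) (auto simp: mult.commute)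
        then show ?thesis by (simp add: diff_divide_distrib add_divide_distrib algebra_simps)
      qed
      show "real (card (F N)) \<le> real ((2 * (N + n) + 1) ^ CARD('d))" for N
      proof -
        have "card (F N) \<le> card (cube (0 :: int ^ 'd) (N + n))" by (intro card_mono finite_cube) (auto simp: F_def)
        also have "\<dots> \<le> (2 * (N + n) + 1) ^ CARD('d)" by (rule card_cube_le)
        finally show ?thesis by (rule of_nat_mono)
      qed
    qed simp
    show "- ?E \<in> sets paths" by (rule E')
    show "AE p in J. snd p \<in> ?C \<inter> ?E \<longrightarrow> (\<forall>\<^sub>F N in sequentially. real (card {k. k < N \<and> snd p (n + k) \<notin> F N}) \<le> c * real N)"
      using AE_neighbour
    proof eventually_elim
      case (elim p)
      show ?case
      proof
        assume p: "snd p \<in> ?C \<inter> ?E"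
        let ?X = "snd p"
        have "\<forall>\<^sub>F N in sequentially. N \<ge> nat \<lceil>(n + 1) / \<rho>\<rceil>" by (rule eventually_ge_at_top)
        moreover have "\<forall>\<^sub>F N in sequentially. finite {k. ?X (n + k) \<in> cube 0 (nat \<lfloor>\<rho> * real N\<rfloor>)} \<and>
            real (card {k. ?X (n + k) \<in> cube 0 (nat \<lfloor>\<rho> * real N\<rfloor>)}) \<le> c * real N"
          using nonzero_velocity_leaves_cube[of ?X z j c \<rho> n] p j c \<rho> by (simp add: \<rho>_def)
        ultimately show "\<forall>\<^sub>F N in sequentially. real (card {k. k < N \<and> ?X (n + k) \<notin> F N}) \<le> c * real N"
        proof eventually_elim
          case (elim N)
          have "real N \<ge> (n + 1) / \<rho>" using elim(1) by linarith
          then have "\<rho> * real N \<ge> n + 1" using \<rho> by (simp add: field_simps)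
          then have "nat \<lfloor>\<rho> * real N\<rfloor> \<ge> n + 1" by (simp add: le_nat_floor)
          then have mN: "m N \<noteq> 0" by (simp add: m_def)
          have "{k. k < N \<and> ?X (n + k) \<notin> F N} \<subseteq> {k. ?X (n + k) \<in> cube 0 (nat \<lfloor>\<rho> * real N\<rfloor>)}"
          proof (intro subsetI)
            fix k assume k: "k \<in> {k. k < N \<and> ?X (n + k) \<notin> F N}"
            have "?X (0 + (n + k)) \<in> cube (?X 0) (n + k)"
              using \<open>?X 0 = 0 \<and> (\<forall>k. \<exists>s. ?X (Suc k) = ?X k + nbr s)\<close> by (intro neighbour_path_bound(3)) simp
            then have "?X (n + k) \<in> cube 0 (n + k)"
              using \<open>?X 0 = 0 \<and> (\<forall>k. \<exists>s. ?X (Suc k) = ?X k + nbr s)\<close> by simp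
            then have "?X (n + k) \<in> cube 0 (N + n)" using cube_mono[of "n + k" "N + n"] k by auto
            then show "k \<in> {k. ?X (n + k) \<in> cube 0 (nat \<lfloor>\<rho> * real N\<rfloor>)}" using k mN by (auto simp: F_def)
          qed
          then have "card {k. k < N \<and> ?X (n + k) \<notin> F N} \<le> card {k. ?X (n + k) \<in> cube 0 (nat \<lfloor>\<rho> * real N\<rfloor>)}"
            using elim by (intro card_mono) auto
          then show ?case using elim by linarith
        qed
      qed
    qed
    show "AE p in J. snd p \<in> ?C - ?E \<longrightarrow> snd p \<in> - ?E \<or> (\<forall>\<^sub>F N in sequentially. finite {k. snd p (n + k) \<in> F N} \<and> real (card {k. snd p (n + k) \<in> F N}) \<le> c * real N)"
      by (intro AE_I2) auto
    show "J.prob {p \<in> space J. snd p \<in> ?C \<inter> - ?E} \<le> \<sigma> * P" using CE by (simp add: P_def)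
  qed
  define q where "q = J.prob {p \<in> space J. snd p \<in> ?C \<inter> ?E}"
  have P: "P = q + J.prob {p \<in> space J. snd p \<in> ?C \<inter> - ?E}"
  proof -
    have eq: "{p \<in> space J. snd p \<in> ?C} = {p \<in> space J. snd p \<in> ?C \<inter> ?E} \<union> {p \<in> space J. snd p \<in> ?C \<inter> - ?E}" by auto
    have "{p \<in> space J. snd p \<in> ?C \<inter> ?E} \<in> sets J" "{p \<in> space J. snd p \<in> ?C \<inter> - ?E} \<in> sets J"
      by (intro path_event_sets_J sets.Int sets_cylinder E E')+
    then show ?thesis unfolding P_def q_def eq by (rule J.finite_measure_Union) auto
  qed
  then have "(1 - \<sigma>) * P \<le> q" using CE by (simp add: P_def algebra_simps)
  moreover have "1 / 2 * P \<le> (1 - \<sigma>) * P" using \<sigma> Cpos by (intro mult_right_mono) (auto simp: P_def)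
  ultimately have "1 / 2 * P * (?\<delta> - g) \<le> q * (?\<delta> - g)" using t by (intro mult_right_mono) auto
  also have "\<dots> \<le> P * (\<sigma> * (6 + 2 * g))"
    using main unfolding c_def q_def[symmetric] by (simp add: algebra_simps)
  also have "\<dots> \<le> P * ((?\<delta> - g) / 4)" using \<sigma>2 by (intro mult_left_mono) (auto simp: P_def)
  finally have "P * (?\<delta> - g) \<le> 0" by (simp add: field_simps)
  moreover have "0 < P * (?\<delta> - g)" using t Cpos by (intro mult_pos_pos) (auto simp: P_def)
  ultimately show False by linarith
qed

text \<open>With velocity 0 the walk may keep returning to the explored region, so no path is
  conditioned on: n = 0, and there is nothing to avoid. The two velocities are separated by space
  instead. Up to time N a walk of velocity 0 eventually stays in the cube of radius \<rho> * N,
  while for small \<rho> a walk with the other velocity spends little time there.\<close>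

lemma zero_velocity_close:
  assumes vel: "AE p in J. has_velocity (snd p) v \<or> has_velocity (snd p) w"
    and pos: "0 < J.prob {p \<in> space J. has_velocity (snd p) 0}"
  shows "\<bar>\<xi> $ Inl i - \<xi> $ Inr i\<bar> \<le> 2 * \<epsilon> + 12 * (cluster_const CARD('d) \<alpha> * \<epsilon>)"
proof (rule ccontr)
  let ?\<gamma> = "2 * \<epsilon> + 12 * (cluster_const CARD('d) \<alpha> * \<epsilon>)" and ?\<delta> = "\<bar>(0 :: real ^ 'd) $ i - (\<xi> $ Inl i - \<xi> $ Inr i)\<bar>"
  assume "\<not> ?thesis"
  then have t: "0 < ?\<delta> - ?\<gamma>" by simp
  have \<gamma>0: "0 \<le> ?\<gamma>" using \<epsilon> cluster_const_nonneg[OF \<alpha>] by simp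
  let ?C = "cylinder 0 (\<lambda>_. 0 :: int ^ 'd)" and ?E = "{X :: nat \<Rightarrow> int ^ 'd. has_velocity X 0}"
  define q where "q = J.prob {p \<in> space J. has_velocity (snd p) 0}"
  \<comment> \<open>Makes the error c * (4 + ?\<gamma>) half of q * (?\<delta> - ?\<gamma>).\<close>
  define c where "c = q * (?\<delta> - ?\<gamma>) / (2 * (4 + ?\<gamma>))"
  have q: "0 < q" using pos by (simp add: q_def)
  have c: "0 < c" using q t \<gamma>0 by (simp add: c_def)
  have "\<exists>\<rho>>0. \<forall>u \<in> {v, w} - {0}. \<exists>j. u $ j \<noteq> 0 \<and> \<rho> \<le> c * \<bar>u $ j\<bar> / 4"
  proof -
    have "\<exists>\<rho>>0. u \<noteq> 0 \<longrightarrow> (\<exists>j. u $ j \<noteq> 0 \<and> \<rho> \<le> c * \<bar>u $ j\<bar> / 4)" for u :: "real ^ 'd"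
    proof (cases "u = 0")
      case False
      then obtain j where "u $ j \<noteq> 0" by (auto simp: vec_eq_iff)
      then show ?thesis using c by (intro exI[of _ "c * \<bar>u $ j\<bar> / 4"]) auto
    qed (auto intro: exI[of _ 1])
    from this[of v] this[of w] obtain \<rho> \<rho>' where
      "0 < \<rho>" "v \<noteq> 0 \<longrightarrow> (\<exists>j. v $ j \<noteq> 0 \<and> \<rho> \<le> c * \<bar>v $ j\<bar> / 4)"
      "0 < \<rho>'" "w \<noteq> 0 \<longrightarrow> (\<exists>j. w $ j \<noteq> 0 \<and> \<rho>' \<le> c * \<bar>w $ j\<bar> / 4)" by blast
    then show ?thesis by (intro exI[of _ "min \<rho> \<rho>'"]) (auto simp: min_le_iff_disj)
  qed
  then obtain \<rho>0 where \<rho>0: "0 < \<rho>0" "\<And>u. u \<in> {v, w} - {0} \<Longrightarrow> \<exists>j. u $ j \<noteq> 0 \<and> \<rho>0 \<le> c * \<bar>u $ j\<bar> / 4" by blast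
  define \<rho> where "\<rho> = min 1 \<rho>0"
  have \<rho>: "0 < \<rho>" "\<rho> \<le> 1" "\<rho> \<le> \<rho>0" using \<rho>0 by (auto simp: \<rho>_def)
  let ?b = "2 * CARD('d) + 9"
  let ?F = "\<lambda>N. cube (0 :: int ^ 'd) (nat \<lfloor>\<rho> * real N\<rfloor>)"
  have main: "J.prob {p \<in> space J. snd p \<in> ?C \<inter> ?E} * ?\<delta> \<le> 4 * c + 2 * 0 + ?\<gamma> * (J.prob {p \<in> space J. snd p \<in> ?C \<inter> ?E} + c + 0)"
  \<comment> \<open>As no path limits the scale, I N can be any sequence with ?b^(I N) growing at
    least linearly.\<close>
  proof (rule velocity_close[where F = ?F and I = "\<lambda>N. N" and U = "{}"])
    show "0 < c" by fact
    show "finite (?F N)" for N by (rule finite_cube)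
    show "(\<lambda>N. real (card (?F N)) * (1 / 2) ^ (?b ^ N)) \<longlonglongrightarrow> 0"
    proof (rule polynomial_times_exponential_tendsto_0[where \<delta> = 1 and K = 0 and n = 0 and D = "CARD('d)"])
      show "1 * real N - 0 \<le> real (?b ^ N)" for N
      proof -
        have "N \<le> 2 ^ N" by (rule less_imp_le) (rule less_exp)
        also have "\<dots> \<le> ?b ^ N" by (rule power_mono) auto
        finally show ?thesis by (simp del: of_nat_power)
      qed
      show "real (card (?F N)) \<le> real ((2 * (N + 0) + 1) ^ CARD('d))" for N
      proof -
        have "\<rho> * real N \<le> 1 * real N" using \<rho> by (intro mult_right_mono) auto
        then have "nat \<lfloor>\<rho> * real N\<rfloor> \<le> N" by linarith
        then have "card (?F N) \<le> card (cube (0 :: int ^ 'd) N)" by (intro card_mono finite_cube cube_mono)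
        also have "\<dots> \<le> (2 * N + 1) ^ CARD('d)" by (rule card_cube_le)
        finally show ?thesis by (simp del: of_nat_power)
      qed
    qed auto
    show "AE p in J. snd p \<in> ?C \<inter> ?E \<longrightarrow> (\<forall>\<^sub>F N in sequentially. real (card {k. k < N \<and> snd p (0 + k) \<notin> ?F N}) \<le> c * real N)"
      using AE_neighbour
    proof eventually_elim
      case (elim p)
      show ?case
      proof
        assume p: "snd p \<in> ?C \<inter> ?E"
        have "\<forall>\<^sub>F N in sequentially. \<forall>k<N. snd p k \<in> ?F N"
          using p elim \<rho> by (intro zero_velocity_stays_in_cube) auto
        then show "\<forall>\<^sub>F N in sequentially. real (card {k. k < N \<and> snd p (0 + k) \<notin> ?F N}) \<le> c * real N"
        proof eventually_elim
          case (elim N)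
          then have "{k. k < N \<and> snd p (0 + k) \<notin> ?F N} = {}" by auto
          then show ?case using c by (simp only: card.empty) simp
        qed
      qed
    qed
    show "AE p in J. snd p \<in> ?C - ?E \<longrightarrow> snd p \<in> {} \<or> (\<forall>\<^sub>F N in sequentially. finite {k. snd p (0 + k) \<in> ?F N} \<and> real (card {k. snd p (0 + k) \<in> ?F N}) \<le> c * real N)"
      using vel
    proof eventually_elim
      case (elim p)
      show ?case
      proof (intro impI disjI2)
        assume p: "snd p \<in> ?C - ?E"
        with elim obtain u where u: "u \<in> {v, w} - {0}" "has_velocity (snd p) u" by blast
        obtain j where "u $ j \<noteq> 0" "\<rho>0 \<le> c * \<bar>u $ j\<bar> / 4" using \<rho>0(2)[OF u(1)] by blast
        then show "\<forall>\<^sub>F N in sequentially. finite {k. snd p (0 + k) \<in> ?F N} \<and> real (card {k. snd p (0 + k) \<in> ?F N}) \<le> c * real N"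
          using u(2) c \<rho> by (intro nonzero_velocity_leaves_cube) auto
      qed
    qed
  qed auto
  have "J.prob {p \<in> space J. snd p \<in> ?C \<inter> ?E} = q"
    unfolding q_def
  proof (rule J.finite_measure_eq_AE)
    show "AE p in J. (p \<in> {p \<in> space J. snd p \<in> ?C \<inter> ?E}) = (p \<in> {p \<in> space J. has_velocity (snd p) 0})"
      using AE_neighbour by eventually_elim (auto simp: cylinder_def)
    show "{p \<in> space J. snd p \<in> ?C \<inter> ?E} \<in> sets J"
      by (intro path_event_sets_J sets.Int sets_cylinder has_velocity_sets)
    show "{p \<in> space J. has_velocity (snd p) 0} \<in> sets J" using path_event_sets_J[OF has_velocity_sets[of 0]] by simp
  qed
  with main have "q * ?\<delta> \<le> 4 * c + ?\<gamma> * (q + c)" by simp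
  then have "q * (?\<delta> - ?\<gamma>) \<le> c * (4 + ?\<gamma>)" by (simp add: algebra_simps)
  also have "\<dots> = q * (?\<delta> - ?\<gamma>) / 2" using \<gamma>0 by (simp add: c_def field_simps)
  finally have "q * (?\<delta> - ?\<gamma>) \<le> 0" by simp
  moreover have "0 < q * (?\<delta> - ?\<gamma>)" using q t by (rule mult_pos_pos)
  ultimately show False by linarith
qed

lemma velocity_estimate:
  assumes "AE p in J. has_velocity (snd p) v \<or> has_velocity (snd p) w"
    and "0 < J.prob {p \<in> space J. has_velocity (snd p) z}"
  shows "\<bar>z $ i - (\<xi> $ Inl i - \<xi> $ Inr i)\<bar> \<le> 2 * \<epsilon> + 12 * (cluster_const CARD('d) \<alpha> * \<epsilon>)"
  using nonzero_velocity_close[OF assms, of i] zero_velocity_close[of v w i] assms by (cases "z = 0") auto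

end

section \<open>Velocity laws and weak neighbourhoods\<close>

text \<open>A fair coin chooses between v and w. As an image measure \<open>half_half\<close> is
  visibly countably additive, and its integrals reduce to those of the Bernoulli law.\<close>

lemma half_half_eq_distr:
  fixes v w :: "'a::topological_space"
  assumes "v \<in> S" "w \<in> S"
  shows "half_half S v w = distr (measure_pmf (bernoulli_pmf (1 / 2))) (borel_on S) (\<lambda>b. if b then v else w)"
proof -
  let ?N = "distr (measure_pmf (bernoulli_pmf (1 / 2))) (borel_on S) (\<lambda>b. if b then v else w)"
  have sp: "space (borel_on S) = S" by (simp add: space_restrict_space)
  have meas: "(\<lambda>b. if b then v else w) \<in> measure_pmf (bernoulli_pmf (1 / 2)) \<rightarrow>\<^sub>M borel_on S"
    using assms by (auto simp: sp)
  have "half_half S v w = measure_of S (sets (borel_on S)) (emeasure ?N)"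
    unfolding half_half_def
  proof (rule measure_of_eq)
    show "sets (borel_on S) \<subseteq> Pow S" using sets.sets_into_space[of _ "borel_on S"] by (auto simp: sp)
    fix A assume "A \<in> sigma_sets S (sets (borel_on S))"
    then have A: "A \<in> sets (borel_on S)" using sets.sigma_sets_eq[of "borel_on S"] by (simp add: sp)
    have "emeasure ?N A = (\<integral>\<^sup>+x. indicator A x \<partial>?N)" using A by simp
    also have "\<dots> = (\<integral>\<^sup>+b. indicator A (if b then v else w) \<partial>measure_pmf (bernoulli_pmf (1 / 2)))"
      using A by (intro nn_integral_distr[OF meas]) simp
    also have "\<dots> = 1 / 2 * indicator A v + 1 / 2 * indicator A w"
      by (subst nn_integral_bernoulli_pmf)
         (auto simp: indicator_def divide_ennreal_def ennreal_divide_numeral divide_ennreal[symmetric])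
    finally show "1 / 2 * emeasure (dirac_on S v) A + 1 / 2 * emeasure (dirac_on S w) A = emeasure ?N A"
      using A by simp
  qed
  also have "\<dots> = ?N" using measure_of_of_measure[of ?N] by (simp add: sp)
  finally show ?thesis .
qed

lemma half_half_commute: "half_half S v w = half_half S w v"
  by (simp add: half_half_def add.commute)

lemma half_half_in_prob_measures:
  assumes "v \<in> S" "w \<in> S"
  shows "half_half S v w \<in> prob_measures S"
proof -
  interpret prob_space "half_half S v w"
    unfolding half_half_eq_distr[OF assms]
    by (intro prob_space.prob_space_distr measure_pmf.prob_space_axioms) (use assms in \<open>auto simp: space_restrict_space\<close>)
  show ?thesis using prob_space_axioms by (simp add: prob_measures_def half_half_eq_distr[OF assms])
qed

lemma dirac_in_prob_measures: "v \<in> S \<Longrightarrow> dirac_on S v \<in> prob_measures S"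
  by (auto simp: prob_measures_def space_restrict_space intro!: prob_space_return)

lemma integral_half_half:
  fixes f :: "'a::topological_space \<Rightarrow> real"
  assumes "v \<in> S" "w \<in> S" "f \<in> borel_measurable (borel_on S)"
  shows "(\<integral>x. f x \<partial>half_half S v w) = (f v + f w) / 2"
  unfolding half_half_eq_distr[OF assms(1,2)]
  by (subst integral_distr) (use assms in \<open>auto simp: space_restrict_space\<close>)

section \<open>Weak neighbourhoods of a Dirac mass\<close>

lemma topspace_weak_topology: "topspace (weak_topology S) = prob_measures S"
proof -
  have "bounded ((\<lambda>_. 0 :: real) ` S)" by (rule bounded_subset[of "{0}"]) auto
  then have "\<exists>f :: 'a \<Rightarrow> real. \<exists>U. prob_measures S = {\<mu> \<in> prob_measures S. (\<integral>x. f x \<partial>\<mu>) \<in> U} \<and> continuous_on S f \<and> bounded (f ` S) \<and> open U"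
    by (intro exI[of _ "\<lambda>_. 0"] exI[of _ UNIV]) auto
  then show ?thesis
    unfolding weak_topology_def topology_generated_by_topspace by blast
qed

lemma openin_weak_topology_integral:
  fixes f :: "'a::topological_space \<Rightarrow> real"
  assumes "continuous_on S f" "bounded (f ` S)" "open U"
  shows "openin (weak_topology S) {\<mu> \<in> prob_measures S. (\<integral>x. f x \<partial>\<mu>) \<in> U}"
  unfolding weak_topology_def using assms by (intro topology_generated_by_Basis) blast

text \<open>Containing the laws with all atoms near v0 is a property that passes to finite
  intersections and to unions, so it suffices to check the generating sets. There the integral is f
  v or the mean of f v and f w, which is as close to f v0 as the farther of the two values.\<close>

lemma weak_neighbourhood_dirac:
  fixes S :: "'a::metric_space set"
  assumes V: "openin (weak_topology S) V" and v0: "v0 \<in> S" "dirac_on S v0 \<in> V"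
  obtains \<delta> where "0 < \<delta>"
    "\<And>v. v \<in> S \<Longrightarrow> dist v v0 \<le> \<delta> \<Longrightarrow> dirac_on S v \<in> V"
    "\<And>v w. v \<in> S \<Longrightarrow> w \<in> S \<Longrightarrow> dist v v0 \<le> \<delta> \<Longrightarrow> dist w v0 \<le> \<delta> \<Longrightarrow> half_half S v w \<in> V"
proof -
  define near where "near \<delta> V \<longleftrightarrow> (\<forall>v\<in>S. \<forall>w\<in>S. dist v v0 \<le> \<delta> \<longrightarrow> dist w v0 \<le> \<delta> \<longrightarrow> dirac_on S v \<in> V \<and> half_half S v w \<in> V)" for \<delta> :: real and V
  let ?B = "{{\<mu> \<in> prob_measures S. (\<integral>x. f x \<partial>\<mu>) \<in> U} | (f :: 'a \<Rightarrow> real) U. continuous_on S f \<and> bounded (f ` S) \<and> open U}"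
  have "generate_topology_on ?B V"
    using V unfolding weak_topology_def by (rule openin_topology_generated_by)
  then have "dirac_on S v0 \<in> V \<longrightarrow> (\<exists>\<delta>>0. near \<delta> V)"
  proof induction
    case Empty
    then show ?case by simp
  next
    case (Int A B)
    show ?case
    proof
      assume "dirac_on S v0 \<in> A \<inter> B"
      with Int obtain a b where "0 < a" "near a A" "0 < b" "near b B" by auto
      then show "\<exists>\<delta>>0. near \<delta> (A \<inter> B)" by (intro exI[of _ "min a b"]) (auto simp: near_def)
    qed
  next
    case (UN K)
    show ?case
    proof
      assume "dirac_on S v0 \<in> \<Union> K"
      then obtain k where k: "k \<in> K" "dirac_on S v0 \<in> k" by auto
      with UN obtain a where "0 < a" "near a k" by blast
      then show "\<exists>\<delta>>0. near \<delta> (\<Union> K)" using k by (intro exI[of _ a]) (auto simp: near_def)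
    qed
  next
    case (Basis A)
    then obtain f :: "'a \<Rightarrow> real" and U where A: "A = {\<mu> \<in> prob_measures S. (\<integral>x. f x \<partial>\<mu>) \<in> U}"
      and f: "continuous_on S f" and U: "open U" by blast
    have fm: "f \<in> borel_measurable (borel_on S)" by (rule borel_measurable_continuous_on_restrict[OF f])
    have dirac: "(\<integral>x. f x \<partial>dirac_on S v) = f v" if "v \<in> S" for v
      using that fm by (intro integral_return) (auto simp: space_restrict_space)
    show ?case
    proof
      assume "dirac_on S v0 \<in> A"
      then have "f v0 \<in> U" using dirac[OF v0(1)] by (simp add: A)
      then obtain e where e: "0 < e" "ball (f v0) e \<subseteq> U" using U openE by blast
      obtain d where d: "0 < d" "\<And>v. v \<in> S \<Longrightarrow> dist v v0 < d \<Longrightarrow> dist (f v) (f v0) < e"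
        using f v0(1) e(1) unfolding continuous_on_iff by blast
      have "near (d / 2) A"
        unfolding near_def
      proof (intro ballI impI)
        fix v w assume vw: "v \<in> S" "w \<in> S" "dist v v0 \<le> d / 2" "dist w v0 \<le> d / 2"
        then have fd: "dist (f v) (f v0) < e" "dist (f w) (f v0) < e" using d by auto
        then have "dist (f v0) ((f v + f w) / 2) < e" by (simp add: dist_real_def abs_less_iff field_simps)
        then have "f v \<in> U" "(f v + f w) / 2 \<in> U" using e(2) fd by (auto simp: dist_commute)
        moreover have "(\<integral>x. f x \<partial>half_half S v w) = (f v + f w) / 2" by (rule integral_half_half[OF vw(1,2) fm])
        ultimately show "dirac_on S v \<in> A \<and> half_half S v w \<in> A"
          unfolding A using vw(1,2) by (auto simp only: mem_Collect_eq dirac dirac_in_prob_measures half_half_in_prob_measures)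
      qed
      then show "\<exists>\<delta>>0. near \<delta> A" using d(1) by (intro exI[of _ "d / 2"]) auto
    qed
  qed
  then obtain \<delta> where "0 < \<delta>" "near \<delta> V" using v0 by auto
  then show thesis using that[of \<delta>] unfolding near_def by blast
qed

lemma neighbour_path_l1_norm:
  fixes X :: "nat \<Rightarrow> int ^ 'd::finite"
  assumes "X 0 = 0" "\<And>k. \<exists>s. X (Suc k) = X k + nbr s"
  shows "(\<Sum>j\<in>UNIV. \<bar>X n $ j\<bar>) \<le> int n"
proof (induction n)
  case (Suc n)
  obtain s where s: "X (Suc n) = X n + nbr s" using assms(2) by blast
  have nbr: "(\<Sum>j\<in>UNIV. \<bar>nbr s $ j\<bar>) = \<bar>orientation s\<bar>"
  proof -
    have "\<bar>nbr s $ j\<bar> = (if j = axis_of s then \<bar>orientation s\<bar> else 0)" for j by (simp add: nbr_nth)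
    then show ?thesis by simp
  qed
  have "(\<Sum>j\<in>UNIV. \<bar>X (Suc n) $ j\<bar>) \<le> (\<Sum>j\<in>UNIV. \<bar>X n $ j\<bar> + \<bar>nbr s $ j\<bar>)"
    unfolding s by (intro sum_mono) simp
  also have "\<dots> = (\<Sum>j\<in>UNIV. \<bar>X n $ j\<bar>) + \<bar>orientation s\<bar>" by (simp only: sum.distrib nbr)
  also have "\<bar>orientation s\<bar> = 1" using orientation_cases[of s] by auto
  finally show ?case using Suc by simp
qed (simp add: assms(1))

lemma has_velocity_in_l1_ball:
  fixes X :: "nat \<Rightarrow> int ^ 'd::finite"
  assumes v: "has_velocity X z" and norm: "\<And>n. (\<Sum>j\<in>UNIV. \<bar>X n $ j\<bar>) \<le> int n"
  shows "z \<in> l1_ball"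
proof -
  have lim: "(\<lambda>n. \<Sum>j\<in>UNIV. \<bar>X n $ j / n\<bar>) \<longlonglongrightarrow> (\<Sum>j\<in>UNIV. \<bar>z $ j\<bar>)"
    by (rule tendsto_sum, rule tendsto_rabs, rule has_velocity_nth[OF v])
  have le: "(\<Sum>j\<in>UNIV. \<bar>X n $ j / n\<bar>) \<le> 1" for n
  proof -
    have "(\<Sum>j\<in>UNIV. \<bar>X n $ j / n\<bar>) = real_of_int (\<Sum>j\<in>UNIV. \<bar>X n $ j\<bar>) / n"
      by (simp add: abs_divide sum_divide_distrib)
    also have "\<dots> \<le> 1"
    proof -
      have "real_of_int (\<Sum>j\<in>UNIV. \<bar>X n $ j\<bar>) \<le> real_of_int (int n)" using norm[of n] by (simp only: of_int_le_iff)
      then show ?thesis by (intro divide_le_eq_1[THEN iffD2]) (cases "n = 0"; simp only: of_int_of_nat_eq; simp)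
    qed
    finally show ?thesis .
  qed
  have "(\<Sum>j\<in>UNIV. \<bar>z $ j\<bar>) \<le> 1" by (rule LIMSEQ_le_const2[OF lim]) (intro exI[of _ 0] allI impI le)
  then show ?thesis by (simp add: l1_ball_def)
qed

section \<open>Velocities of positive probability and the value of \<open>v_star\<close>\<close>

definition possible_velocity :: "(real ^ ('d::finite + 'd)) measure \<Rightarrow> real ^ 'd \<Rightarrow> bool" where
  "possible_velocity \<nu> z \<longleftrightarrow> 0 < measure (joint_law \<nu>) {p \<in> space (joint_law \<nu>). has_velocity (snd p) z}"

lemma is_velocity_law_iff:
  "is_velocity_law \<nu> \<rho> \<longleftrightarrow>
     (\<exists>v. (AE p in joint_law \<nu>. has_velocity (snd p) v) \<and> \<rho> = dirac_on l1_ball v) \<or>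
     (\<exists>v w. v \<noteq> w \<and> (AE p in joint_law \<nu>. has_velocity (snd p) v \<or> has_velocity (snd p) w) \<and>
        possible_velocity \<nu> v \<and> possible_velocity \<nu> w \<and> \<rho> = half_half l1_ball v w)"
  unfolding is_velocity_law_def possible_velocity_def by (simp add: case_prod_beta')

context
  fixes \<nu> :: "(real ^ ('d::finite + 'd)) measure" and \<kappa> :: real and \<eta> \<theta> :: nat
  assumes \<nu>: "\<nu> \<in> prob_measures (Sigma_N \<kappa> \<eta> \<theta>)"
begin

lemma velocity_event: "{p \<in> space (joint_law \<nu>). has_velocity (snd p) z} \<in> sets (joint_law \<nu>)"
proof -
  have "snd \<in> joint_law \<nu> \<rightarrow>\<^sub>M paths"
    unfolding measurable_cong_sets[OF prob_space_joint_law(2)[OF \<nu>] refl] by (rule measurable_snd)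
  from measurable_sets[OF this has_velocity_sets[of z]] show ?thesis by (simp add: vimage_def Int_def conj_commute)
qed

lemma impossible_velocity_AE: "\<not> possible_velocity \<nu> z \<Longrightarrow> AE p in joint_law \<nu>. \<not> has_velocity (snd p) z"
proof -
  interpret J: prob_space "joint_law \<nu>" by (rule prob_space_joint_law(1)[OF \<nu>])
  assume "\<not> possible_velocity \<nu> z"
  then have "J.prob {p \<in> space (joint_law \<nu>). has_velocity (snd p) z} = 0"
    unfolding possible_velocity_def using measure_nonneg[of "joint_law \<nu>" "{p \<in> space (joint_law \<nu>). has_velocity (snd p) z}"] by linarith
  then show ?thesis using velocity_event[of z] by (subst (asm) J.prob_eq_0) auto
qed

lemma possible_velocity_cases:
  assumes "possible_velocity \<nu> z" "AE p in joint_law \<nu>. has_velocity (snd p) v \<or> has_velocity (snd p) w"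
  shows "z = v \<or> z = w"
proof (rule ccontr)
  interpret J: prob_space "joint_law \<nu>" by (rule prob_space_joint_law(1)[OF \<nu>])
  assume "\<not> ?thesis"
  then have "AE p in joint_law \<nu>. \<not> has_velocity (snd p) z"
    using assms(2) by (auto elim!: eventually_mono dest: has_velocity_unique)
  then have "J.prob {p \<in> space (joint_law \<nu>). has_velocity (snd p) z} = 0"
    using velocity_event[of z] by (subst J.prob_eq_0) auto
  then show False using assms(1) by (simp add: possible_velocity_def)
qed

lemma AE_possible_velocity: "AE p in joint_law \<nu>. has_velocity (snd p) z \<Longrightarrow> possible_velocity \<nu> z"
proof -
  interpret J: prob_space "joint_law \<nu>" by (rule prob_space_joint_law(1)[OF \<nu>])
  assume "AE p in joint_law \<nu>. has_velocity (snd p) z"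
  then have "J.prob {p \<in> space (joint_law \<nu>). has_velocity (snd p) z} = 1"
    using velocity_event[of z] by (subst J.prob_eq_1) (auto elim!: eventually_mono)
  then show ?thesis by (simp add: possible_velocity_def)
qed

text \<open>The walk determines the set {v, w} of velocities of positive probability. The two
  alternatives of the definition correspond to v = w and v \<noteq> w, and \<open>half_half\<close>
  does not depend on the order.\<close>

lemma is_velocity_law_unique:
  assumes "is_velocity_law \<nu> \<rho>" "is_velocity_law \<nu> \<rho>'"
  shows "\<rho> = \<rho>'"
proof -
  define laws where "laws \<rho> v w \<longleftrightarrow> (AE p in joint_law \<nu>. has_velocity (snd p) v \<or> has_velocity (snd p) w) \<and>
    possible_velocity \<nu> v \<and> possible_velocity \<nu> w \<and> \<rho> = (if v = w then dirac_on l1_ball v else half_half l1_ball v w)" for \<rho> v w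
  have laws: "\<exists>v w. laws \<rho> v w" if "is_velocity_law \<nu> \<rho>" for \<rho>
    using that unfolding is_velocity_law_iff
  proof (elim disjE exE conjE)
    fix v assume "AE p in joint_law \<nu>. has_velocity (snd p) v" "\<rho> = dirac_on l1_ball v"
    then have "laws \<rho> v v" using AE_possible_velocity by (simp add: laws_def)
    then show ?thesis by (intro exI)
  next
    fix v w assume "v \<noteq> w" "AE p in joint_law \<nu>. has_velocity (snd p) v \<or> has_velocity (snd p) w"
      "possible_velocity \<nu> v" "possible_velocity \<nu> w" "\<rho> = half_half l1_ball v w"
    then have "laws \<rho> v w" by (simp add: laws_def)
    then show ?thesis by (intro exI)
  qed
  obtain v w where l: "laws \<rho> v w" using laws[OF assms(1)] by (elim exE)
  obtain v' w' where l': "laws \<rho>' v' w'" using laws[OF assms(2)] by (elim exE)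
  note vw = l[unfolded laws_def] note vw' = l'[unfolded laws_def]
  note cases = possible_velocity_cases[OF _ conjunct1[OF vw]] possible_velocity_cases[OF _ conjunct1[OF vw']]
  have "v = v' \<or> v = w'" "w = v' \<or> w = w'" "v' = v \<or> v' = w" "w' = v \<or> w' = w"
    using vw vw' by (simp_all only: cases)
  then have "v = v' \<and> w = w' \<or> v = w' \<and> w = v'" by argo
  then show ?thesis using vw vw' half_half_commute[of l1_ball v w] by (elim disjE) simp_all
qed

text \<open>If one of the two candidates has probability 0, the velocity is almost surely the other
  one; so some \<rho> satisfies \<open>is_velocity_law\<close>, and by uniqueness the definite
  description \<open>v_star\<close> denotes it.\<close>

lemma v_star_cases:
  assumes "AE p in joint_law \<nu>. has_velocity (snd p) v \<or> has_velocity (snd p) w"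
  obtains z where "possible_velocity \<nu> z" "v_star \<nu> = dirac_on l1_ball z"
  | z z' where "z \<noteq> z'" "possible_velocity \<nu> z" "possible_velocity \<nu> z'" "v_star \<nu> = half_half l1_ball z z'"
proof -
  have "\<exists>\<rho>. is_velocity_law \<nu> \<rho>"
  proof (cases "v \<noteq> w \<and> possible_velocity \<nu> v \<and> possible_velocity \<nu> w")
    case True
    then have "is_velocity_law \<nu> (half_half l1_ball v w)" using assms unfolding is_velocity_law_iff by (intro disjI2 exI conjI) simp_all
    then show ?thesis ..
  next
    case False
    then consider "v = w" | "\<not> possible_velocity \<nu> v" | "\<not> possible_velocity \<nu> w" by argo
    then have "(AE p in joint_law \<nu>. has_velocity (snd p) v) \<or> (AE p in joint_law \<nu>. has_velocity (snd p) w)"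
    proof cases
      case 1
      then show ?thesis using assms by simp
    next
      case 2
      from impossible_velocity_AE[OF this] assms have "AE p in joint_law \<nu>. has_velocity (snd p) w"
        by eventually_elim simp
      then show ?thesis ..
    next
      case 3
      from impossible_velocity_AE[OF this] assms have "AE p in joint_law \<nu>. has_velocity (snd p) v"
        by eventually_elim simp
      then show ?thesis ..
    qed
    then obtain u where "AE p in joint_law \<nu>. has_velocity (snd p) u" by (elim disjE)
    then have "is_velocity_law \<nu> (dirac_on l1_ball u)"
      unfolding is_velocity_law_iff by (intro disjI1 exI[of _ u] conjI) simp_all
    then show ?thesis ..
  qed
  then obtain \<rho> where \<rho>: "is_velocity_law \<nu> \<rho>" ..
  have v_star: "v_star \<nu> = \<rho>"
    unfolding v_star_def by (rule the_equality[where P = "is_velocity_law \<nu>", OF \<rho> is_velocity_law_unique[OF _ \<rho>]])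
  from \<rho>[unfolded is_velocity_law_iff] show thesis
  proof (elim disjE exE conjE)
    fix z assume z: "AE p in joint_law \<nu>. has_velocity (snd p) z" "\<rho> = dirac_on l1_ball z"
    show thesis by (rule that(1)[OF AE_possible_velocity[OF z(1)] v_star[unfolded z(2)]])
  next
    fix z z' assume z: "z \<noteq> z'" "possible_velocity \<nu> z" "possible_velocity \<nu> z'" "\<rho> = half_half l1_ball z z'"
    show thesis by (rule that(2)[OF z(1-3) v_star[unfolded z(4)]])
  qed
qed

lemma possible_velocity_in_l1_ball:
  assumes "possible_velocity \<nu> z"
  shows "z \<in> l1_ball"
proof (rule ccontr)
  interpret J: prob_space "joint_law \<nu>" by (rule prob_space_joint_law(1)[OF \<nu>])
  assume z: "z \<notin> l1_ball"
  have "AE p in joint_law \<nu>. \<not> has_velocity (snd p) z"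
    using AE_joint_law_neighbour[OF \<nu>]
  proof (rule eventually_mono)
    fix p :: "'d environment \<times> (nat \<Rightarrow> int ^ 'd)"
    assume p: "snd p 0 = 0 \<and> (\<forall>k. \<exists>s. snd p (Suc k) = snd p k + nbr s)"
    show "\<not> has_velocity (snd p) z"
      using has_velocity_in_l1_ball[OF _ neighbour_path_l1_norm[OF conjunct1[OF p] spec[OF conjunct2[OF p]]]] z
      by (rule contrapos_nn[rotated])
  qed
  then have "J.prob {p \<in> space (joint_law \<nu>). has_velocity (snd p) z} = 0"
    by (subst J.prob_eq_0[OF velocity_event]) (rule eventually_mono, simp_all)
  then show False using assms by (simp add: possible_velocity_def)
qed

end

text \<open>The axis of \<open>dir i\<close> depends on i modulo d only, and two indices in {1..2 *
  d} agree modulo d exactly if they differ by 0 or d.\<close>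

lemma axis_of_dir:
  assumes "\<eta> \<in> {1..2 * CARD('d)}" "\<theta> \<in> {1..2 * CARD('d)}" "\<bar>int \<eta> - int \<theta>\<bar> \<notin> {0, int CARD('d)}"
  shows "axis_of (dir \<eta> :: 'd::finite + 'd) \<noteq> axis_of (dir \<theta> :: 'd + 'd)"
proof
  define \<iota> where "\<iota> i = (if i \<le> CARD('d) then i - 1 else i - CARD('d) - 1)" for i
  have ax: "axis_of (dir i :: 'd + 'd) = from_nat_into UNIV (\<iota> i)" for i
    by (simp add: dir_def axis_of_def \<iota>_def)
  have "inj_on (from_nat_into (UNIV :: 'd set)) {..<CARD('d)}"
    using bij_betw_from_nat_into_finite[of "UNIV :: 'd set"] by (simp add: bij_betw_def)
  moreover have "\<iota> i \<in> {..<CARD('d)}" if "i \<in> {1..2 * CARD('d)}" for i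
    using that by (auto simp: \<iota>_def)
  moreover assume "axis_of (dir \<eta> :: 'd + 'd) = axis_of (dir \<theta> :: 'd + 'd)"
  ultimately have "\<iota> \<eta> = \<iota> \<theta>" using assms(1,2) unfolding ax by (auto dest: inj_onD)
  then show False using assms by (auto simp: \<iota>_def split: if_splits)
qed

section \<open>Continuity at the Dirac mass\<close>

definition local_drift :: "real ^ ('d::finite + 'd) \<Rightarrow> real ^ 'd" where
  "local_drift \<xi> = (\<chi> i. \<xi> $ Inl i - \<xi> $ Inr i)"

text \<open>In \<open>velocity_estimate\<close> the error is controlled by d, \<alpha> and
  \<epsilon> alone. Here \<alpha> depends on \<kappa> and \<xi> only, so one \<epsilon> serves all
  \<nu>, v, w and z.\<close>

lemma velocities_near_dirac:
  fixes \<xi> :: "real ^ ('d::finite + 'd)"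
  assumes \<kappa>: "\<kappa> > 0" and axes: "axis_of (dir \<eta> :: 'd + 'd) \<noteq> axis_of (dir \<theta> :: 'd + 'd)"
    and \<xi>: "\<xi> \<in> Sigma_N \<kappa> \<eta> \<theta>" "\<And>s. \<xi> $ s > 0" and \<delta>: "0 < \<delta>"
  obtains \<epsilon> where "0 < \<epsilon>" "\<And>\<nu> v w z. \<nu> \<in> prob_measures (Sigma_N \<kappa> \<eta> \<theta>) \<Longrightarrow>
      emeasure \<nu> {p \<in> Sigma_N \<kappa> \<eta> \<theta>. \<epsilon> \<le> dist p \<xi>} \<le> ennreal \<epsilon> \<Longrightarrow>
      AE p in joint_law \<nu>. has_velocity (snd p) v \<or> has_velocity (snd p) w \<Longrightarrow>
      possible_velocity \<nu> z \<Longrightarrow> dist z (local_drift \<xi>) \<le> \<delta>"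
proof -
  let ?\<Sigma> = "Sigma_N \<kappa> \<eta> \<theta> :: (real ^ ('d + 'd)) set"
  let ?d = "real CARD('d)"
  define m where "m = Min (range (($) \<xi>))"
  have m: "0 < m" "\<And>s. m \<le> \<xi> $ s" using \<xi>(2) by (auto simp: m_def)
  \<comment> \<open>Good vectors differ from \<xi> by at most m / 2 in each entry and so have
    entries at least m / 2; bad vectors still have \<kappa> in the two given directions.\<close>
  define \<alpha> where "\<alpha> = min \<kappa> (m / 2)"
  have \<alpha>: "0 < \<alpha>" "\<alpha> \<le> 1"
  proof -
    show "0 < \<alpha>" using \<kappa> m by (simp add: \<alpha>_def)
    have "\<kappa> \<le> 1" using \<xi>(1) by (auto simp: Sigma_N_def intro: order_trans)
    then show "\<alpha> \<le> 1" by (simp add: \<alpha>_def min_le_iff_disj)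
  qed
  let ?c = "cluster_const CARD('d) \<alpha>"
  have c: "0 \<le> ?c" by (rule cluster_const_nonneg[OF \<alpha>])
  \<comment> \<open>The bound m / 2 keeps good vectors elliptic, the one with ?c + 1 gives
    \<open>?c * \<epsilon> \<le> 1 / 2\<close>, and the last one makes the error, summed over the
    coordinates, at most \<delta>.\<close>
  define \<epsilon> where "\<epsilon> = min (min (1 / 2) (m / 2)) (min (1 / (2 * (?c + 1))) (\<delta> / (?d * (2 + 12 * ?c))))"
  have d0: "0 < ?d" by simp
  have \<epsilon>: "0 < \<epsilon>" "\<epsilon> \<le> 1 / 2" "\<epsilon> \<le> m / 2" "\<epsilon> \<le> 1 / (2 * (?c + 1))" "\<epsilon> \<le> \<delta> / (?d * (2 + 12 * ?c))"
  proof -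
    have "0 < 1 / (2 * (?c + 1))" "0 < \<delta> / (?d * (2 + 12 * ?c))" using c \<delta> d0 by (auto intro!: divide_pos_pos mult_pos_pos)
    then show "0 < \<epsilon>" using m(1) unfolding \<epsilon>_def min_less_iff_conj by simp
    show "\<epsilon> \<le> 1 / 2" "\<epsilon> \<le> m / 2" unfolding \<epsilon>_def by (intro min.coboundedI1 min.cobounded1 min.cobounded2)+
    show "\<epsilon> \<le> 1 / (2 * (?c + 1))" "\<epsilon> \<le> \<delta> / (?d * (2 + 12 * ?c))"
      unfolding \<epsilon>_def by (intro min.coboundedI2 min.cobounded1 min.cobounded2)+
  qed
  have c\<epsilon>: "?c * \<epsilon> \<le> 1 / 2"
  proof -
    have "(?c + 1) * \<epsilon> \<le> 1 / 2" using \<epsilon>(4) c by (simp add: field_simps)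
    then show ?thesis using \<epsilon>(1) by (simp add: algebra_simps)
  qed
  have \<delta>\<epsilon>: "?d * (2 * \<epsilon> + 12 * (?c * \<epsilon>)) \<le> \<delta>"
  proof -
    have "0 < ?d * (2 + 12 * ?c)" using c d0 by (intro mult_pos_pos) auto
    then have "\<epsilon> * (?d * (2 + 12 * ?c)) \<le> \<delta>" using \<epsilon>(5) by (simp only: pos_le_divide_eq)
    then show ?thesis by (simp add: algebra_simps)
  qed
  show thesis
  proof (rule that[OF \<epsilon>(1)])
    fix \<nu> :: "(real ^ ('d + 'd)) measure" and v w z :: "real ^ 'd"
    let ?Bad = "{p \<in> ?\<Sigma>. \<epsilon> \<le> dist p \<xi>}"
    assume \<nu>: "\<nu> \<in> prob_measures ?\<Sigma>" and Bad: "emeasure \<nu> ?Bad \<le> ennreal \<epsilon>"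
      and vel: "AE p in joint_law \<nu>. has_velocity (snd p) v \<or> has_velocity (snd p) w" and z: "possible_velocity \<nu> z"
    have sets: "sets \<nu> = sets (borel_on ?\<Sigma>)" and ps: "prob_space \<nu>" using \<nu> by (auto simp: prob_measures_def)
    have space: "space \<nu> = ?\<Sigma>" using sets_eq_imp_space_eq[OF sets] by (simp add: space_restrict_space)
    have near: "\<bar>p $ s - \<xi> $ s\<bar> \<le> \<epsilon>" if "p \<in> ?\<Sigma>" "p \<notin> ?Bad" for p s
      using component_le_norm_cart[of "p - \<xi>" s] that by (simp add: dist_norm)
    interpret W: random_walk \<nu> "dir \<eta>" "dir \<theta>" \<alpha> ?Bad \<xi> \<kappa> \<eta> \<theta> \<epsilon>
    proof (intro random_walk.intro perturbed_environment.intro ps perturbed_environment_axioms.intro random_walk_axioms.intro)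
      show "(\<lambda>p. p $ s) \<in> borel_measurable \<nu>" for s
        unfolding measurable_cong_sets[OF sets refl]
        by (intro measurable_restrict_space1 borel_measurable_continuous_onI continuous_intros)
      show "?Bad \<in> sets \<nu>"
      proof -
        have "{p. \<epsilon> \<le> dist p \<xi>} \<in> sets (borel :: (real ^ ('d + 'd)) measure)" by measurable
        then show ?thesis unfolding sets sets_restrict_space by (intro image_eqI[of _ _ "{p. \<epsilon> \<le> dist p \<xi>}"]) auto
      qed
      show "\<alpha> \<le> p $ s" if "p \<in> space \<nu>" "p \<notin> ?Bad" for p s
        using near[of p s] that m(2)[of s] \<epsilon>(3) by (auto simp: space \<alpha>_def min_le_iff_disj)
      show "\<bar>p $ s - \<xi> $ s\<bar> \<le> \<epsilon>" if "p \<in> space \<nu>" "p \<notin> ?Bad" for p s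
        using near that by (simp add: space)
      show "\<xi> \<notin> ?Bad" using \<epsilon>(1) by simp
      show "\<nu> \<in> prob_measures (Sigma_N \<kappa> \<eta> \<theta>)" by fact
    qed (use \<xi> \<alpha> \<epsilon> c\<epsilon> Bad axes in \<open>auto simp: space Sigma_N_def \<alpha>_def min_le_iff_disj\<close>)
    have comp: "\<bar>(z - local_drift \<xi>) $ i\<bar> \<le> 2 * \<epsilon> + 12 * (?c * \<epsilon>)" for i
      using W.velocity_estimate[OF vel, of z i] z by (simp add: possible_velocity_def local_drift_def)
    have "dist z (local_drift \<xi>) \<le> (\<Sum>i\<in>UNIV. \<bar>(z - local_drift \<xi>) $ i\<bar>)"
      unfolding dist_norm by (rule norm_le_l1_cart)
    also have "\<dots> \<le> ?d * (2 * \<epsilon> + 12 * (?c * \<epsilon>))"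
      using sum_bounded_above[of UNIV "\<lambda>i. \<bar>(z - local_drift \<xi>) $ i\<bar>", OF comp] by simp
    finally show "dist z (local_drift \<xi>) \<le> \<delta>" using \<delta>\<epsilon> by simp
  qed
qed

theorem corollary4:
  fixes \<kappa> :: real and \<eta> \<theta> :: nat and \<xi> :: "real ^ ('d::finite + 'd)"
  assumes "CARD('d) \<ge> 2"
    and "\<kappa> > 0"
    and "\<eta> \<in> {1..2 * CARD('d)}" and "\<theta> \<in> {1..2 * CARD('d)}"
    and "\<bar>int \<eta> - int \<theta>\<bar> \<notin> {0, int CARD('d)}"
    and velocity_exists: "\<And>\<nu> :: (real ^ ('d + 'd)) measure.
      \<nu> \<in> prob_measures (Sigma_N \<kappa> \<eta> \<theta>) \<Longrightarrow>
      \<exists>v w. AE (\<omega>, X) in joint_law \<nu>. has_velocity X v \<or> has_velocity X w"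
    and "\<xi> \<in> Sigma_N \<kappa> \<eta> \<theta>" and "\<And>s. \<xi> $ s > 0"
    and "\<mu> = dirac_on (Sigma_N \<kappa> \<eta> \<theta>) \<xi>"
  shows "topcontinuous_at (weak_topology (Sigma_N \<kappa> \<eta> \<theta>)) (weak_topology l1_ball) v_star \<mu>"
proof -
  let ?\<Sigma> = "Sigma_N \<kappa> \<eta> \<theta> :: (real ^ ('d + 'd)) set"
  let ?v = "local_drift \<xi>"
  note \<xi> = assms(7,8) and \<mu> = assms(9)
  note axes = axis_of_dir[OF assms(3-5)]
  have vel: "\<exists>v w. AE p in joint_law \<nu>. has_velocity (snd p) v \<or> has_velocity (snd p) w"
    if "\<nu> \<in> prob_measures ?\<Sigma>" for \<nu>
    using velocity_exists[OF that] by (simp add: case_prod_beta')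
  have \<mu>P: "\<mu> \<in> prob_measures ?\<Sigma>" unfolding \<mu> by (rule dirac_in_prob_measures[OF \<xi>(1)])
  have in_codomain: "v_star \<nu> \<in> prob_measures l1_ball" if \<nu>: "\<nu> \<in> prob_measures ?\<Sigma>" for \<nu>
  proof -
    obtain v w where "AE p in joint_law \<nu>. has_velocity (snd p) v \<or> has_velocity (snd p) w" using vel[OF \<nu>] by blast
    then show ?thesis
      by (rule v_star_cases[OF \<nu>])
         (use possible_velocity_in_l1_ball[OF \<nu>] in \<open>auto intro: dirac_in_prob_measures half_half_in_prob_measures\<close>)
  qed
  \<comment> \<open>\<mu> satisfies the closeness condition for every \<epsilon>, so the velocity in
    the constant environment comes from the same estimate and not from a law of large
    numbers.\<close>
  have \<mu>_velocity: "z = ?v" if z: "possible_velocity \<mu> z" for z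
  proof -
    obtain v w where vw: "AE p in joint_law \<mu>. has_velocity (snd p) v \<or> has_velocity (snd p) w" using vel[OF \<mu>P] by blast
    have "dist z ?v \<le> 0 + \<delta>" if "0 < \<delta>" for \<delta>
    proof -
      obtain \<epsilon> where \<epsilon>: "0 < \<epsilon>" "\<And>\<nu> v w z. \<nu> \<in> prob_measures ?\<Sigma> \<Longrightarrow>
        emeasure \<nu> {p \<in> ?\<Sigma>. \<epsilon> \<le> dist p \<xi>} \<le> ennreal \<epsilon> \<Longrightarrow>
        AE p in joint_law \<nu>. has_velocity (snd p) v \<or> has_velocity (snd p) w \<Longrightarrow>
        possible_velocity \<nu> z \<Longrightarrow> dist z ?v \<le> \<delta>"
        using velocities_near_dirac[OF assms(2) axes \<xi> \<open>0 < \<delta>\<close>] by blast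
      \<comment> \<open>Outside the sigma-algebra \<open>emeasure\<close> is 0 by convention, so
        both cases give 0.\<close>
      have "emeasure \<mu> {p \<in> ?\<Sigma>. \<epsilon> \<le> dist p \<xi>} = 0"
        unfolding \<mu> using \<epsilon>(1) by (cases "{p \<in> ?\<Sigma>. \<epsilon> \<le> dist p \<xi>} \<in> sets (borel_on ?\<Sigma>)") (auto simp: emeasure_notin_sets)
      then show ?thesis using \<epsilon>(2)[OF \<mu>P _ vw z] by simp
    qed
    then have "dist z ?v \<le> 0" by (rule field_le_epsilon)
    then show ?thesis by simp
  qed
  obtain v w where \<mu>_vel: "AE p in joint_law \<mu>. has_velocity (snd p) v \<or> has_velocity (snd p) w" using vel[OF \<mu>P] by blast
  have v_star_\<mu>: "v_star \<mu> = dirac_on l1_ball ?v" and v_ball: "?v \<in> l1_ball"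
    by (rule v_star_cases[OF \<mu>P \<mu>_vel]; use \<mu>_velocity possible_velocity_in_l1_ball[OF \<mu>P] in blast)+
  show ?thesis
    unfolding topcontinuous_at_def topspace_weak_topology
  proof (intro conjI Pi_I allI impI \<mu>P in_codomain)
    fix V assume "openin (weak_topology l1_ball) V \<and> v_star \<mu> \<in> V"
    then have "openin (weak_topology l1_ball) V" "dirac_on l1_ball ?v \<in> V" by (auto simp: v_star_\<mu>)
    from weak_neighbourhood_dirac[OF this(1) v_ball this(2)]
    obtain \<delta> where \<delta>: "0 < \<delta>" "\<And>v. v \<in> l1_ball \<Longrightarrow> dist v ?v \<le> \<delta> \<Longrightarrow> dirac_on l1_ball v \<in> V"
      "\<And>v w. v \<in> l1_ball \<Longrightarrow> w \<in> l1_ball \<Longrightarrow> dist v ?v \<le> \<delta> \<Longrightarrow> dist w ?v \<le> \<delta> \<Longrightarrow> half_half l1_ball v w \<in> V"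
      by blast
    obtain \<epsilon> where \<epsilon>: "0 < \<epsilon>" "\<And>\<nu> v w z. \<nu> \<in> prob_measures ?\<Sigma> \<Longrightarrow>
      emeasure \<nu> {p \<in> ?\<Sigma>. \<epsilon> \<le> dist p \<xi>} \<le> ennreal \<epsilon> \<Longrightarrow>
      AE p in joint_law \<nu>. has_velocity (snd p) v \<or> has_velocity (snd p) w \<Longrightarrow>
      possible_velocity \<nu> z \<Longrightarrow> dist z ?v \<le> \<delta>"
      using velocities_near_dirac[OF assms(2) axes \<xi> \<delta>(1)] by blast
    \<comment> \<open>A bounded continuous test function that vanishes at \<xi>. By Markov's
      inequality, a mean below \<epsilon> * \<epsilon> leaves probability at most \<epsilon> for a
      distance of at least \<epsilon>.\<close>
    let ?f = "\<lambda>p. dist p \<xi>"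
    have f2: "?f p \<le> 2" if "p \<in> ?\<Sigma>" for p
    proof -
      have n: "norm p \<le> 1" if "p \<in> ?\<Sigma>" for p
        using norm_le_l1_cart[of p] that by (simp add: Sigma_N_def)
      show ?thesis using norm_triangle_ineq4[of p \<xi>] n[OF that] n[OF \<xi>(1)] by (simp add: dist_norm)
    qed
    have f: "continuous_on ?\<Sigma> ?f" "bounded (?f ` ?\<Sigma>)"
      using f2 by (auto intro!: continuous_intros boundedI[of _ 2])
    have fm: "?f \<in> borel_measurable (borel_on ?\<Sigma>)" by (rule borel_measurable_continuous_on_restrict[OF f(1)])
    define U where "U = {\<nu> \<in> prob_measures ?\<Sigma>. (\<integral>p. ?f p \<partial>\<nu>) \<in> {..<\<epsilon> * \<epsilon>}}"
    have "openin (weak_topology ?\<Sigma>) U"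
      unfolding U_def by (rule openin_weak_topology_integral[OF f]) simp
    moreover have "\<mu> \<in> U"
    proof -
      have "(\<integral>p. ?f p \<partial>\<mu>) = ?f \<xi>" unfolding \<mu> by (rule integral_return) (use \<xi> fm in \<open>auto simp: space_restrict_space\<close>)
      then show ?thesis using \<mu>P \<epsilon>(1) by (simp add: U_def)
    qed
    moreover have "v_star \<nu> \<in> V" if "\<nu> \<in> U" for \<nu>
    proof -
      have \<nu>: "\<nu> \<in> prob_measures ?\<Sigma>" and int: "(\<integral>p. ?f p \<partial>\<nu>) < \<epsilon> * \<epsilon>" using that by (auto simp: U_def)
      have sets: "sets \<nu> = sets (borel_on ?\<Sigma>)" and ps: "prob_space \<nu>" using \<nu> by (auto simp: prob_measures_def)
      interpret prob_space \<nu> by fact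
      have space: "space \<nu> = ?\<Sigma>" using sets_eq_imp_space_eq[OF sets] by (simp add: space_restrict_space)
      have "integrable \<nu> ?f"
        by (rule integrable_const_bound[where B = 2]) (use f2 fm in \<open>auto simp: space measurable_cong_sets[OF sets refl]\<close>)
      then have "emeasure \<nu> {p \<in> space \<nu>. \<epsilon> \<le> ?f p} \<le> ennreal ((1 / \<epsilon>) * (\<integral>p. ?f p \<partial>\<nu>))"
        using \<epsilon>(1) by (intro integral_Markov_inequality) auto
      also have "(1 / \<epsilon>) * (\<integral>p. ?f p \<partial>\<nu>) \<le> \<epsilon>" using int \<epsilon>(1) by (simp add: field_simps)
      finally have Bad: "emeasure \<nu> {p \<in> ?\<Sigma>. \<epsilon> \<le> ?f p} \<le> ennreal \<epsilon>" by (simp add: space ennreal_leI)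
      obtain v w where \<nu>_vel: "AE p in joint_law \<nu>. has_velocity (snd p) v \<or> has_velocity (snd p) w" using vel[OF \<nu>] by blast
      note near = \<epsilon>(2)[OF \<nu> Bad \<nu>_vel] and ball = possible_velocity_in_l1_ball[OF \<nu>]
      show ?thesis
        by (rule v_star_cases[OF \<nu> \<nu>_vel]) (use \<delta>(2,3) near ball in simp_all)
    qed
    ultimately show "\<exists>U. openin (weak_topology ?\<Sigma>) U \<and> \<mu> \<in> U \<and> (\<forall>\<nu>\<in>U. v_star \<nu> \<in> V)" by blast
  qed
qed

end
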